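(* Let $\Lambda$ be a basic finite dimensional algebra over an algebraically closed field $K$ whose Jacobson radical $J$ satisfies $J^2=0$, and let $\mathbf{d}$ be a dimension vector. Let $T_1, T_2$ be semisimple left $\Lambda$-modules, both realizable with respect to $\mathbf{d}$. For $i=1,2$ let $U_i$ be the generic socle of the modules in $\mathbf{Rep}^{T_i}_{\mathbf d}$. Then $$\mathbf{Rep}^{T_1}_{\mathbf d}\subseteq \overline{\mathbf{Rep}^{T_2}_{\mathbf d}}\quad\Longleftrightarrow\quad (\underline{\dim}\,T_1,\underline{\dim}\,U_1)\ \ge\ (\underline{\dim}\,T_2,\underline{\dim}\,U_2),$$ where the closure is taken in $\mathbf{Rep}_{\mathbf d}(\Lambda)$.
   Context: Write $\Lambda=KQ/I$ with $Q$ a finite quiver with vertices $e_1,\dots,e_n$ (identified with primitive idempotents of $\Lambda$) and arrow set $Q_1$, and $I$ an admissible ideal; since $J^2=0$, $I$ is generated by all paths of length $2$. Simple modules: $S_i=\Lambda e_i/Je_i$. Modules are finite dimensional left modules; $\underline{\dim}$ denotes the dimension vector in $(\mathbb N_0)^n$; $\operatorname{top}M=M/JM$; $\operatorname{soc}M$ is the socle. Isomorphic semisimple modules are identified. For $\mathbf d=(d_1,\dots,d_n)$, $\mathbf{Rep}_{\mathbf d}(\Lambda)$ is the affine variety of tuples $(x_\alpha)_{\alpha\in Q_1}\in\prod_\alpha \operatorname{Hom}_K(K^{d_{\mathrm{start}(\alpha)}},K^{d_{\mathrm{end}(\alpha)}})$ satisfying all relations in $I$, with Zariski topology and the conjugation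 action of $\operatorname{GL}(\mathbf d)=\prod_i\operatorname{GL}_{d_i}(K)$, whose orbits correspond to isomorphism classes of $\Lambda$-modules with dimension vector $\mathbf d$. A module is said to be "in" a subset of $\mathbf{Rep}_{\mathbf d}(\Lambda)$ if it corresponds to a point of that subset. For a semisimple module $T$, $\mathbf{Rep}^T_{\mathbf d}\subseteq\mathbf{Rep}_{\mathbf d}(\Lambda)$ is the locally closed subvariety of points whose modules have top $T$. $T$ is realizable with respect to $\mathbf d$ if $\mathbf{Rep}^T_{\mathbf d}\neq\varnothing$. For $J^2=0$, every nonempty $\mathbf{Rep}^T_{\mathbf d}$ is irreducible. The generic socle of the modules in an irreducible subvariety $\mathfrak U$ of $\mathbf{Rep}_{\mathbf d}(\Lambda)$ is the (unique) semisimple module that is the socle of all modules in some dense open subset of $\mathfrak U$. $(\mathbb N_0)^n$ carries the componentwise partial order, and $(\mathbb N_0)^n\times(\mathbb N_0)^n$ the induced componentwise partial order on pairs. *)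

theory Defs
  imports
    "HOL-Algebra.Module"
    "HOL-Algebra.QuotRing"
    "HOL-Analysis.Abstract_Topology"
    "HOL-Computational_Algebra.Polynomial"
    "Jordan_Normal_Form.Matrix"
    "Graph_Theory.Arc_Walk"
begin

section \<open>Left modules over a (noncommutative) ring\<close>

text \<open>
  The record \<^type>\<open>module\<close> and the locale \<^locale>\<open>submodule\<close> of HOL-Algebra do not need a commutative
  ring of scalars, the locale \<^locale>\<open>module\<close> does. The notions below are stated for
  the bare records and are meant for rings with unit and left modules.
\<close>

definition left_ideal :: "'r set \<Rightarrow> ('r, 'x) ring_scheme \<Rightarrow> bool" where
  "left_ideal L R \<longleftrightarrow> additive_subgroup L R \<and> (\<forall>a\<in>carrier R. \<forall>b\<in>L. a \<otimes>\<^bsub>R\<^esub> b \<in> L)"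

definition maximal_left_ideal :: "'r set \<Rightarrow> ('r, 'x) ring_scheme \<Rightarrow> bool" where
  "maximal_left_ideal L R \<longleftrightarrow> left_ideal L R \<and> L \<noteq> carrier R \<and>
     (\<forall>L'. left_ideal L' R \<and> L \<subseteq> L' \<longrightarrow> L' = L \<or> L' = carrier R)"

definition jacobson_radical :: "('r, 'x) ring_scheme \<Rightarrow> 'r set" where
  "jacobson_radical R = {a \<in> carrier R. \<forall>L. maximal_left_ideal L R \<longrightarrow> a \<in> L}"

definition submodule_generated ::
    "('r, 'x) ring_scheme \<Rightarrow> ('r, 'm, 'y) module_scheme \<Rightarrow> 'm set \<Rightarrow> 'm set" where
  "submodule_generated R M S = \<Inter>{N. submodule N R M \<and> S \<subseteq> N}"

definition simple_submodule ::
    "'m set \<Rightarrow> ('r, 'x) ring_scheme \<Rightarrow> ('r, 'm, 'y) module_scheme \<Rightarrow> bool" where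
  "simple_submodule N R M \<longleftrightarrow> submodule N R M \<and> N \<noteq> {\<zero>\<^bsub>M\<^esub>} \<and>
     (\<forall>N'. submodule N' R M \<and> N' \<subseteq> N \<longrightarrow> N' = {\<zero>\<^bsub>M\<^esub>} \<or> N' = N)"

definition socle :: "('r, 'x) ring_scheme \<Rightarrow> ('r, 'm, 'y) module_scheme \<Rightarrow> 'm set" where
  "socle R M = submodule_generated R M (\<Union>{N. simple_submodule N R M})"

definition semisimple_module :: "('r, 'x) ring_scheme \<Rightarrow> ('r, 'm, 'y) module_scheme \<Rightarrow> bool" where
  "semisimple_module R M \<longleftrightarrow> socle R M = carrier M"

text \<open>The submodule \<open>JM\<close>, where \<open>J\<close> is the Jacobson radical of the ring of scalars.\<close>

definition radical_submodule ::
    "('r, 'x) ring_scheme \<Rightarrow> ('r, 'm, 'y) module_scheme \<Rightarrow> 'm set" where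
  "radical_submodule R M =
     submodule_generated R M {a \<odot>\<^bsub>M\<^esub> m | a m. a \<in> jacobson_radical R \<and> m \<in> carrier M}"

text \<open>The multiplicative fields of the record are irrelevant for a module.\<close>

definition quotient_module ::
    "('r, 'm, 'y) module_scheme \<Rightarrow> 'm set \<Rightarrow> ('r, 'm set) module" where
  "quotient_module M N =
     \<lparr>carrier = a_rcosets\<^bsub>M\<^esub> N, monoid.mult = undefined, one = undefined, zero = N, add = set_add M,
      smult = (\<lambda>a C. \<Union>m\<in>C. N +>\<^bsub>M\<^esub> (a \<odot>\<^bsub>M\<^esub> m))\<rparr>"

definition top_module ::
    "('r, 'x) ring_scheme \<Rightarrow> ('r, 'm, 'y) module_scheme \<Rightarrow> ('r, 'm set) module" where
  "top_module R M = quotient_module M (radical_submodule R M)"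

definition socle_module ::
    "('r, 'x) ring_scheme \<Rightarrow> ('r, 'm) module \<Rightarrow> ('r, 'm) module" where
  "socle_module R M = M\<lparr>carrier := socle R M\<rparr>"

definition module_isomorphic ::
    "('r, 'x) ring_scheme \<Rightarrow> ('r, 'm, 'y) module_scheme \<Rightarrow> ('r, 'n, 'z) module_scheme \<Rightarrow> bool" where
  "module_isomorphic R M N \<longleftrightarrow> (\<exists>f. bij_betw f (carrier M) (carrier N) \<and>
     (\<forall>m\<in>carrier M. \<forall>m'\<in>carrier M. f (m \<oplus>\<^bsub>M\<^esub> m') = f m \<oplus>\<^bsub>N\<^esub> f m') \<and>
     (\<forall>a\<in>carrier R. \<forall>m\<in>carrier M. f (a \<odot>\<^bsub>M\<^esub> m) = a \<odot>\<^bsub>N\<^esub> f m))"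


section \<open>Path algebras and admissible ideals\<close>

text \<open>
  A finite quiver is a \<^locale>\<open>fin_digraph\<close> (loops and multiple arrows are allowed). A path is a pair
  \<open>(u, p)\<close> of its starting vertex and its list of arrows in the order in which they are traversed;
  \<open>(u, [])\<close> is the idempotent \<open>e\<^sub>u\<close>. An element of the path algebra is a finitely supported
  coefficient function on paths.
\<close>

type_synonym ('v, 'a) path = "'v \<times> 'a list"

definition is_path :: "('v, 'a) pre_digraph \<Rightarrow> ('v, 'a) path \<Rightarrow> bool" where
  "is_path Q q \<longleftrightarrow> (\<exists>w. pre_digraph.awalk Q (fst q) (snd q) w)"

definition path_end :: "('v, 'a) pre_digraph \<Rightarrow> ('v, 'a) path \<Rightarrow> 'v" where
  "path_end Q q = pre_digraph.awlast Q (fst q) (snd q)"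

text \<open>
  As modules are left modules, the product \<open>pq\<close> of two paths is ``\<open>p\<close> after \<open>q\<close>'' if \<open>q\<close> ends where
  \<open>p\<close> starts, and \<open>0\<close> otherwise. So the coefficient of \<open>r \<otimes> s\<close> at a path is a sum over all ways to
  cut this path into an initial segment (contributed by \<open>s\<close>) and a final segment (contributed
  by \<open>r\<close>).
\<close>

definition path_algebra ::
    "('v, 'a) pre_digraph \<Rightarrow> (('v, 'a) path \<Rightarrow> 'k :: field) ring" where
  "path_algebra Q =
     \<lparr>carrier = {r. finite {q. r q \<noteq> 0} \<and> (\<forall>q. r q \<noteq> 0 \<longrightarrow> is_path Q q)},
      monoid.mult = (\<lambda>r s (u, p). \<Sum>k\<le>length p.
        r (path_end Q (u, take k p), drop k p) * s (u, take k p)),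
      one = (\<lambda>(u, p). if u \<in> verts Q \<and> p = [] then 1 else 0),
      zero = (\<lambda>q. 0),
      add = (\<lambda>r s q. r q + s q)\<rparr>"

definition path_elem :: "('v, 'a) path \<Rightarrow> ('v, 'a) path \<Rightarrow> 'k :: field" where
  "path_elem q = (\<lambda>q'. if q' = q then 1 else 0)"

text \<open>The \<open>l\<close>-th power of the arrow ideal, i.e. the ideal generated by all paths of length \<open>l\<close>.\<close>

definition arrow_ideal_power ::
    "('v, 'a) pre_digraph \<Rightarrow> nat \<Rightarrow> (('v, 'a) path \<Rightarrow> 'k :: field) set" where
  "arrow_ideal_power Q l =
     Idl\<^bsub>path_algebra Q\<^esub> {path_elem q | q. is_path Q q \<and> length (snd q) = l}"

definition admissible_ideal ::
    "('v, 'a) pre_digraph \<Rightarrow> (('v, 'a) path \<Rightarrow> 'k :: field) set \<Rightarrow> bool" where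
  "admissible_ideal Q I \<longleftrightarrow> ideal I (path_algebra Q) \<and>
     (\<exists>l\<ge>2. arrow_ideal_power Q l \<subseteq> I) \<and> I \<subseteq> arrow_ideal_power Q 2"

text \<open>The algebra \<open>\<Lambda> = KQ/I\<close>; its elements are cosets of \<open>I\<close>.\<close>

abbreviation bound_quiver_algebra ::
    "('v, 'a) pre_digraph \<Rightarrow> (('v, 'a) path \<Rightarrow> 'k :: field) set \<Rightarrow>
     (('v, 'a) path \<Rightarrow> 'k) set ring" where
  "bound_quiver_algebra Q I \<equiv> path_algebra Q Quot I"

definition jacobson_radical_square_zero :: "('r, 'x) ring_scheme \<Rightarrow> bool" where
  "jacobson_radical_square_zero R \<longleftrightarrow>
     (\<forall>a\<in>jacobson_radical R. \<forall>b\<in>jacobson_radical R. a \<otimes>\<^bsub>R\<^esub> b = \<zero>\<^bsub>R\<^esub>)"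


section \<open>Representations\<close>

text \<open>
  Dimension vectors are functions on the vertices (only the values on \<^term>\<open>verts Q\<close> matter).
  A tuple \<open>(x\<^sub>\<alpha>)\<^sub>\<alpha>\<close> of linear maps is a family of matrices, \<open>x\<^sub>\<alpha>\<close> acting on
  column vectors. The underlying space of a module is \<open>\<Oplus>\<^sub>v K\<^bsup>d v\<^esup>\<close>.
\<close>

definition rep_affine_space ::
    "('v, 'a) pre_digraph \<Rightarrow> ('v \<Rightarrow> nat) \<Rightarrow> ('a \<Rightarrow> 'k :: field mat) set" where
  "rep_affine_space Q d = (\<Pi>\<^sub>E \<alpha>\<in>arcs Q. carrier_mat (d (head Q \<alpha>)) (d (tail Q \<alpha>)))"

definition rep_vectors ::
    "('v, 'a) pre_digraph \<Rightarrow> ('v \<Rightarrow> nat) \<Rightarrow> ('v \<Rightarrow> 'k :: field vec) set" where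
  "rep_vectors Q d = (\<Pi>\<^sub>E v\<in>verts Q. carrier_vec (d v))"

fun path_mat ::
    "('v, 'a) pre_digraph \<Rightarrow> ('v \<Rightarrow> nat) \<Rightarrow> ('a \<Rightarrow> 'k :: field mat) \<Rightarrow> ('v, 'a) path \<Rightarrow> 'k mat" where
  "path_mat Q d x (u, []) = 1\<^sub>m (d u)"
| "path_mat Q d x (u, \<alpha> # p) = path_mat Q d x (head Q \<alpha>, p) * x \<alpha>"

definition path_algebra_act ::
    "('v, 'a) pre_digraph \<Rightarrow> ('v \<Rightarrow> nat) \<Rightarrow> ('a \<Rightarrow> 'k :: field mat) \<Rightarrow>
     (('v, 'a) path \<Rightarrow> 'k) \<Rightarrow> ('v \<Rightarrow> 'k vec) \<Rightarrow> 'v \<Rightarrow> 'k vec" where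
  "path_algebra_act Q d x r m = (\<lambda>v\<in>verts Q. vec (d v) (\<lambda>i.
     \<Sum>q | r q \<noteq> 0 \<and> path_end Q q = v. r q * (path_mat Q d x q *\<^sub>v m (fst q)) $ i))"

text \<open>The variety of points satisfying all relations in \<open>I\<close>, i.e. on which \<open>I\<close> acts as \<open>0\<close>.\<close>

definition Rep ::
    "('v, 'a) pre_digraph \<Rightarrow> (('v, 'a) path \<Rightarrow> 'k :: field) set \<Rightarrow> ('v \<Rightarrow> nat) \<Rightarrow>
     ('a \<Rightarrow> 'k mat) set" where
  "Rep Q I d = {x \<in> rep_affine_space Q d. \<forall>r\<in>I. \<forall>m\<in>rep_vectors Q d.
     path_algebra_act Q d x r m = (\<lambda>v\<in>verts Q. 0\<^sub>v (d v))}"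

text \<open>
  The \<open>\<Lambda>\<close>-module given by a point \<open>x\<close> of \<^term>\<open>Rep Q I d\<close>. A coset of \<open>I\<close> acts through any of its
  representatives; the choice is irrelevant because \<open>I\<close> acts as zero.
\<close>

definition rep_module ::
    "('v, 'a) pre_digraph \<Rightarrow> ('v \<Rightarrow> nat) \<Rightarrow> ('a \<Rightarrow> 'k :: field mat) \<Rightarrow>
     ((('v, 'a) path \<Rightarrow> 'k) set, 'v \<Rightarrow> 'k vec) module" where
  "rep_module Q d x =
     \<lparr>carrier = rep_vectors Q d, monoid.mult = undefined, one = undefined,
      zero = (\<lambda>v\<in>verts Q. 0\<^sub>v (d v)),
      add = (\<lambda>m m'. \<lambda>v\<in>verts Q. m v + m' v),
      smult = (\<lambda>C m. path_algebra_act Q d x (SOME r. r \<in> C) m)\<rparr>"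

text \<open>
  Every finite dimensional \<open>\<Lambda>\<close>-module is isomorphic to one given by a dimension vector and a point of
  the corresponding variety. Different pairs may describe isomorphic modules.
\<close>

type_synonym ('v, 'a, 'k) fd_module = "('v \<Rightarrow> nat) \<times> ('a \<Rightarrow> 'k mat)"

abbreviation dim_vector :: "('v, 'a, 'k) fd_module \<Rightarrow> 'v \<Rightarrow> nat" where
  "dim_vector T \<equiv> fst T"

abbreviation module_of ::
    "('v, 'a) pre_digraph \<Rightarrow> ('v, 'a, 'k :: field) fd_module \<Rightarrow>
     ((('v, 'a) path \<Rightarrow> 'k) set, 'v \<Rightarrow> 'k vec) module" where
  "module_of Q T \<equiv> rep_module Q (fst T) (snd T)"

definition semisimple_fd_module ::
    "('v, 'a) pre_digraph \<Rightarrow> (('v, 'a) path \<Rightarrow> 'k :: field) set \<Rightarrow> ('v, 'a, 'k) fd_module \<Rightarrow> bool"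
  where
  "semisimple_fd_module Q I T \<longleftrightarrow>
     snd T \<in> Rep Q I (fst T) \<and> semisimple_module (bound_quiver_algebra Q I) (module_of Q T)"

definition Rep_top ::
    "('v, 'a) pre_digraph \<Rightarrow> (('v, 'a) path \<Rightarrow> 'k :: field) set \<Rightarrow> ('v \<Rightarrow> nat) \<Rightarrow>
     ('v, 'a, 'k) fd_module \<Rightarrow> ('a \<Rightarrow> 'k mat) set" where
  "Rep_top Q I d T = {x \<in> Rep Q I d.
     module_isomorphic (bound_quiver_algebra Q I)
       (top_module (bound_quiver_algebra Q I) (rep_module Q d x)) (module_of Q T)}"

definition realizable ::
    "('v, 'a) pre_digraph \<Rightarrow> (('v, 'a) path \<Rightarrow> 'k :: field) set \<Rightarrow> ('v \<Rightarrow> nat) \<Rightarrow>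
     ('v, 'a, 'k) fd_module \<Rightarrow> bool" where
  "realizable Q I d T \<longleftrightarrow> Rep_top Q I d T \<noteq> {}"


section \<open>Zariski topology and generic socles\<close>

inductive_set rep_poly_functions ::
    "('v, 'a) pre_digraph \<Rightarrow> ('v \<Rightarrow> nat) \<Rightarrow> (('a \<Rightarrow> 'k :: field mat) \<Rightarrow> 'k) set"
  for Q d where
  const: "(\<lambda>x. c) \<in> rep_poly_functions Q d"
| coord: "\<lbrakk>\<alpha> \<in> arcs Q; i < d (head Q \<alpha>); j < d (tail Q \<alpha>)\<rbrakk>
    \<Longrightarrow> (\<lambda>x. x \<alpha> $$ (i, j)) \<in> rep_poly_functions Q d"
| add: "\<lbrakk>f \<in> rep_poly_functions Q d; g \<in> rep_poly_functions Q d\<rbrakk>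
    \<Longrightarrow> (\<lambda>x. f x + g x) \<in> rep_poly_functions Q d"
| mult: "\<lbrakk>f \<in> rep_poly_functions Q d; g \<in> rep_poly_functions Q d\<rbrakk>
    \<Longrightarrow> (\<lambda>x. f x * g x) \<in> rep_poly_functions Q d"

definition zariski_open ::
    "('v, 'a) pre_digraph \<Rightarrow> ('v \<Rightarrow> nat) \<Rightarrow> ('a \<Rightarrow> 'k :: field mat) set \<Rightarrow> bool" where
  "zariski_open Q d U \<longleftrightarrow>
     (\<exists>F \<subseteq> rep_poly_functions Q d. U = rep_affine_space Q d - {x. \<forall>f\<in>F. f x = 0})"

definition zariski_affine ::
    "('v, 'a) pre_digraph \<Rightarrow> ('v \<Rightarrow> nat) \<Rightarrow> ('a \<Rightarrow> 'k :: field mat) topology" where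
  "zariski_affine Q d = topology (zariski_open Q d)"

lemma zariski_open_iff:
  "zariski_open Q d U \<longleftrightarrow> U \<subseteq> rep_affine_space Q d \<and>
     (\<forall>x\<in>U. \<exists>f\<in>rep_poly_functions Q d. f x \<noteq> 0 \<and> (\<forall>y\<in>rep_affine_space Q d. f y \<noteq> 0 \<longrightarrow> y \<in> U))"
  (is "?L \<longleftrightarrow> ?R")
proof
  assume ?L
  then obtain F where F: "F \<subseteq> rep_poly_functions Q d"
      "U = rep_affine_space Q d - {x. \<forall>f\<in>F. f x = 0}"
    unfolding zariski_open_def by (elim exE conjE)
  show ?R
  proof (intro conjI ballI)
    show "U \<subseteq> rep_affine_space Q d" unfolding F(2) by (rule Diff_subset)
    fix x assume "x \<in> U"
    then obtain f where f: "f \<in> F" "f x \<noteq> 0" unfolding F(2) by blast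
    then have "\<forall>y\<in>rep_affine_space Q d. f y \<noteq> 0 \<longrightarrow> y \<in> U" unfolding F(2) by blast
    then show "\<exists>f\<in>rep_poly_functions Q d. f x \<noteq> 0 \<and>
        (\<forall>y\<in>rep_affine_space Q d. f y \<noteq> 0 \<longrightarrow> y \<in> U)"
      using f F(1) by (intro bexI[of _ f]) auto
  qed
next
  assume R: ?R
  define F where "F = {f \<in> rep_poly_functions Q d. \<forall>y\<in>rep_affine_space Q d. f y \<noteq> 0 \<longrightarrow> y \<in> U}"
  have "U = rep_affine_space Q d - {x. \<forall>f\<in>F. f x = 0}"
  proof (intro subset_antisym subsetI)
    fix x assume x: "x \<in> U"
    then obtain f where "f \<in> F" "f x \<noteq> 0" using R unfolding F_def by blast
    then show "x \<in> rep_affine_space Q d - {x. \<forall>f\<in>F. f x = 0}" using x R by blast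
  next
    fix x assume "x \<in> rep_affine_space Q d - {x. \<forall>f\<in>F. f x = 0}"
    then show "x \<in> U" unfolding F_def by blast
  qed
  moreover have "F \<subseteq> rep_poly_functions Q d" unfolding F_def by (rule Collect_restrict)
  ultimately show ?L unfolding zariski_open_def by (intro exI[of _ F] conjI)
qed

lemma istopology_zariski_open: "istopology (zariski_open Q d)"
  unfolding istopology_def
proof (intro conjI allI impI)
  fix S T :: "('a \<Rightarrow> 'k :: field mat) set"
  assume S: "zariski_open Q d S" and T: "zariski_open Q d T"
  show "zariski_open Q d (S \<inter> T)"
    unfolding zariski_open_iff
  proof (intro conjI ballI)
    show "S \<inter> T \<subseteq> rep_affine_space Q d" using S unfolding zariski_open_iff by blast
    fix x assume x: "x \<in> S \<inter> T"
    obtain f where f: "f \<in> rep_poly_functions Q d" "f x \<noteq> 0"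
        "\<And>y. y \<in> rep_affine_space Q d \<Longrightarrow> f y \<noteq> 0 \<Longrightarrow> y \<in> S"
      using S x unfolding zariski_open_iff by blast
    obtain g where g: "g \<in> rep_poly_functions Q d" "g x \<noteq> 0"
        "\<And>y. y \<in> rep_affine_space Q d \<Longrightarrow> g y \<noteq> 0 \<Longrightarrow> y \<in> T"
      using T x unfolding zariski_open_iff by blast
    show "\<exists>h\<in>rep_poly_functions Q d. h x \<noteq> 0 \<and>
        (\<forall>y\<in>rep_affine_space Q d. h y \<noteq> 0 \<longrightarrow> y \<in> S \<inter> T)"
    proof (intro bexI conjI ballI impI)
      show "(\<lambda>x. f x * g x) \<in> rep_poly_functions Q d" using f(1) g(1) by (rule rep_poly_functions.mult)
      show "f x * g x \<noteq> 0" using f(2) g(2) by simp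
      fix y assume "y \<in> rep_affine_space Q d" "f y * g y \<noteq> 0"
      then show "y \<in> S \<inter> T" using f(3) g(3) by simp
    qed
  qed
next
  fix \<K> :: "('a \<Rightarrow> 'k :: field mat) set set"
  assume K: "\<forall>K\<in>\<K>. zariski_open Q d K"
  show "zariski_open Q d (\<Union>\<K>)"
    unfolding zariski_open_iff
  proof (intro conjI ballI)
    show "\<Union>\<K> \<subseteq> rep_affine_space Q d" using K unfolding zariski_open_iff by (intro Union_least) simp
    fix x assume "x \<in> \<Union>\<K>"
    then obtain A where A: "A \<in> \<K>" "x \<in> A" by (rule UnionE)
    then obtain f where "f \<in> rep_poly_functions Q d" "f x \<noteq> 0"
        "\<And>y. y \<in> rep_affine_space Q d \<Longrightarrow> f y \<noteq> 0 \<Longrightarrow> y \<in> A"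
      using bspec[OF K A(1)] unfolding zariski_open_iff by blast
    then show "\<exists>f\<in>rep_poly_functions Q d. f x \<noteq> 0 \<and>
        (\<forall>y\<in>rep_affine_space Q d. f y \<noteq> 0 \<longrightarrow> y \<in> \<Union>\<K>)"
      using A(1) by (intro bexI[of _ f] conjI ballI impI UnionI[of A]) simp_all
  qed
qed

definition zariski_Rep ::
    "('v, 'a) pre_digraph \<Rightarrow> (('v, 'a) path \<Rightarrow> 'k :: field) set \<Rightarrow> ('v \<Rightarrow> nat) \<Rightarrow>
     ('a \<Rightarrow> 'k mat) topology" where
  "zariski_Rep Q I d = subtopology (zariski_affine Q d) (Rep Q I d)"

text \<open>
  \<open>U\<close> is the generic socle of the modules in \<open>X\<close>: it is, up to isomorphism, the socle of all modules
  in some dense open subset of \<open>X\<close>. (For irreducible \<open>X\<close>, as in all uses, it is unique.)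
\<close>

definition generic_socle ::
    "('v, 'a) pre_digraph \<Rightarrow> (('v, 'a) path \<Rightarrow> 'k :: field) set \<Rightarrow> ('v \<Rightarrow> nat) \<Rightarrow>
     ('a \<Rightarrow> 'k mat) set \<Rightarrow> ('v, 'a, 'k) fd_module \<Rightarrow> bool" where
  "generic_socle Q I d X U \<longleftrightarrow> semisimple_fd_module Q I U \<and>
     (\<exists>V. openin (subtopology (zariski_Rep Q I d) X) V \<and>
       subtopology (zariski_Rep Q I d) X closure_of V = X \<and>
       (\<forall>x\<in>V. module_isomorphic (bound_quiver_algebra Q I)
         (socle_module (bound_quiver_algebra Q I) (rep_module Q d x)) (module_of Q U)))"

end

theory Submission
  imports Defs "Jordan_Normal_Form.Determinant"
begin

text \<open>
  Since \<open>J\<^sup>2 = 0\<close>, a point of the variety is a family of matrices with \<open>x\<^sub>\<beta> x\<^sub>\<alpha> = 0\<close> whenever \<open>\<beta>\<close> starts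
  where \<open>\<alpha>\<close> ends. At a vertex \<open>v\<close>, let \<open>W\<^sub>v(x)\<close> be the sum of the images of the \<open>x\<^sub>\<alpha>\<close> ending in \<open>v\<close>, and
  \<open>N\<^sub>v(x)\<close> the common kernel of the \<open>x\<^sub>\<alpha>\<close> starting in \<open>v\<close>; these are the components of \<open>JM\<close> and of the
  socle of the module \<open>M\<close>, and \<open>W\<^sub>v(x) \<subseteq> N\<^sub>v(x)\<close>. So the top fixes \<open>dim W\<^sub>v(x)\<close>, the socle fixes
  \<open>dim N\<^sub>v(x)\<close>, and one implication is the semicontinuity of these dimensions.

  Conversely, semicontinuity bounds \<open>dim N\<^sub>v(x)\<close> from below on all of the first stratum, so that
  for \<open>x\<close> in this stratum there are subspaces \<open>W\<^sub>v(x) \<subseteq> W'\<^sub>v \<subseteq> N\<^sub>v(x)\<close> whose codimensions are given by the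
  second top. A point of the second stratum can be conjugated to a point \<open>y\<close> with \<open>W\<^sub>v(y) = W'\<^sub>v\<close>. All
  points of the line through \<open>x\<close> and \<open>y\<close> kill the \<open>W'\<^sub>v\<close> and map into them, hence lie in the
  variety, and all but finitely many of them lie in the second stratum.
\<close>

section \<open>Dual systems and dimensions of subspaces\<close>

text \<open>Dimension is counted by dual systems because one kind of data then serves three
  purposes. Completed to a dual basis, a dual system puts a subspace, or a flag of two, into the
  coordinate form \<open>coord_subspace\<close>; two dual bases define the base change that
  conjugates one point into another; and the matrix of pairings turns "at least k independent
  vectors" into the nonvanishing of a determinant, which is polynomial in the point. So a lower
  bound on the dimension of an image is an open condition. Kernels are brought under the same
  argument as orthogonal complements of images for the reversed quiver. The other obstacle is that
  strata and generic socles are given by isomorphisms of abstract \<Lambda>-modules. These have to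
  be translated into dimensions at the vertices: in both directions for tops, since a constructed
  point must be shown to lie in a stratum, but only from the module to the dimension for socles. The
  translation rests on the fact that \<Lambda> acts only through the coefficients at trivial paths
  and arrows, and that these coefficients do not change within a coset of \<open>I\<close>.\<close>

definition vec_subspace :: "nat \<Rightarrow> 'k :: field vec set \<Rightarrow> bool" where
  "vec_subspace n W \<longleftrightarrow> W \<subseteq> carrier_vec n \<and> 0\<^sub>v n \<in> W \<and> (\<forall>v\<in>W. \<forall>w\<in>W. v + w \<in> W) \<and>
     (\<forall>c. \<forall>v\<in>W. c \<cdot>\<^sub>v v \<in> W)"

definition lin_comb :: "nat \<Rightarrow> nat \<Rightarrow> (nat \<Rightarrow> 'k) \<Rightarrow> (nat \<Rightarrow> 'k vec) \<Rightarrow> 'k :: field vec" where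
  "lin_comb n r c b = vec n (\<lambda>i. \<Sum>j<r. c j * b j $ i)"

text \<open>The functionals \<open>a i\<close> witness the linear independence of the vectors \<open>b i\<close>.\<close>

definition dual_system :: "nat \<Rightarrow> nat \<Rightarrow> (nat \<Rightarrow> 'k :: field vec) \<Rightarrow> (nat \<Rightarrow> 'k vec) \<Rightarrow> bool" where
  "dual_system n r a b \<longleftrightarrow> (\<forall>i<r. a i \<in> carrier_vec n \<and> b i \<in> carrier_vec n) \<and>
     (\<forall>i<r. \<forall>j<r. a i \<bullet> b j = (if i = j then 1 else 0))"

text \<open>The maximum exists: \<open>r = 0\<close> always qualifies, and
  \<open>dual_system_le\<close> bounds \<open>r\<close> by \<open>n\<close>. Being defined for
  arbitrary sets, \<open>vdim\<close> is monotone at once.\<close>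

definition vdim :: "nat \<Rightarrow> 'k :: field vec set \<Rightarrow> nat" where
  "vdim n W = (GREATEST r. \<exists>a b. dual_system n r a b \<and> b ` {..<r} \<subseteq> W)"

lemma lin_comb_carrier [simp]: "lin_comb n r c b \<in> carrier_vec n"
  by (simp add: lin_comb_def)

lemma dim_lin_comb [simp]: "dim_vec (lin_comb n r c b) = n"
  by (simp add: lin_comb_def)

lemma lin_comb_Suc:
  assumes "b r \<in> carrier_vec n"
  shows "lin_comb n (Suc r) c b = lin_comb n r c b + c r \<cdot>\<^sub>v b r"
  using assms by (auto simp: lin_comb_def)

lemma lin_comb_in_subspace:
  assumes "vec_subspace n W" "\<And>i. i < r \<Longrightarrow> b i \<in> W"
  shows "lin_comb n r c b \<in> W"
  using assms(2)
proof (induction r)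
  case 0
  have "lin_comb n 0 c b = 0\<^sub>v n" by (auto simp: lin_comb_def)
  then show ?case using assms(1) by (simp add: vec_subspace_def)
next
  case (Suc r)
  have "b r \<in> carrier_vec n" using Suc.prems assms(1) by (auto simp: vec_subspace_def)
  then have "lin_comb n (Suc r) c b = lin_comb n r c b + c r \<cdot>\<^sub>v b r" by (rule lin_comb_Suc)
  then show ?case using Suc assms(1) by (simp add: vec_subspace_def)
qed

lemma scalar_prod_lin_comb:
  assumes "v \<in> carrier_vec n" "\<And>j. j < r \<Longrightarrow> b j \<in> carrier_vec n"
  shows "v \<bullet> lin_comb n r c b = (\<Sum>j<r. c j * (v \<bullet> b j))"
  using assms(2)
proof (induction r)
  case 0
  have "lin_comb n 0 c b = 0\<^sub>v n" by (auto simp: lin_comb_def)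
  then show ?case using assms(1) by simp
next
  case (Suc r)
  have "b r \<in> carrier_vec n" using Suc.prems by simp
  then show ?case using Suc assms(1)
    by (simp add: lin_comb_Suc scalar_prod_add_distrib[of _ n])
qed

lemma lin_comb_cong:
  assumes "\<And>j. j < r \<Longrightarrow> c j = c' j" "\<And>j. j < r \<Longrightarrow> b j = b' j"
  shows "lin_comb n r c b = lin_comb n r c' b'"
  unfolding lin_comb_def using assms by (intro eq_vecI) auto

lemma dual_system_coeff:
  assumes "dual_system n r a b" "i < r"
  shows "a i \<bullet> lin_comb n r c b = c i"
proof -
  have "a i \<bullet> lin_comb n r c b = (\<Sum>j<r. c j * (a i \<bullet> b j))"
    using assms by (intro scalar_prod_lin_comb) (auto simp: dual_system_def)
  also have "\<dots> = (\<Sum>j<r. if i = j then c j else 0)"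
    using assms by (intro sum.cong) (auto simp: dual_system_def)
  also have "\<dots> = c i" using assms(2) by simp
  finally show ?thesis .
qed

text \<open>A Gram-Schmidt step for the pairing: the remainder of \<open>w\<close> after subtracting
  its expansion is annihilated by every \<open>a j\<close>, and it is nonzero by assumption, so some
  functional detects it.\<close>

lemma dual_system_extend:
  fixes b :: "nat \<Rightarrow> 'k :: field vec"
  assumes ds: "dual_system n r a b" and w: "w \<in> carrier_vec n"
    and nw: "w \<noteq> lin_comb n r (\<lambda>j. a j \<bullet> w) b"
  obtains u where "dual_system n (Suc r) (a(r := u)) (b(r := w - lin_comb n r (\<lambda>j. a j \<bullet> w) b))"
proof -
  define w' where "w' = w - lin_comb n r (\<lambda>j. a j \<bullet> w) b"
  have w': "w' \<in> carrier_vec n" using w by (simp add: w'_def)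
  have a: "a i \<in> carrier_vec n" and b: "b i \<in> carrier_vec n" if "i < r" for i
    using ds that by (auto simp: dual_system_def)
  have aw': "a i \<bullet> w' = 0" if "i < r" for i
    using a[OF that] w dual_system_coeff[OF ds that, of "\<lambda>j. a j \<bullet> w"]
    by (simp add: w'_def scalar_prod_minus_distrib[of _ n])
  obtain i where i: "i < n" "w' $ i \<noteq> 0"
  proof (rule ccontr)
    assume *: "\<not> thesis"
    have "w = lin_comb n r (\<lambda>j. a j \<bullet> w) b"
    proof (rule eq_vecI)
      fix i assume "i < dim_vec (lin_comb n r (\<lambda>j. a j \<bullet> w) b)"
      then have i: "i < n" by simp
      then have "w' $ i = 0" using * that by blast
      then show "w $ i = lin_comb n r (\<lambda>j. a j \<bullet> w) b $ i" using i w by (simp add: w'_def)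
    qed (use w in auto)
    then show False using nw by blast
  qed
  \<comment> \<open>\<open>unit_vec n i\<close> reads off a nonzero coordinate of \<open>w'\<close>.
    Subtracting its values \<open>b j $ i\<close> on the old vectors makes it vanish there, and the
    factor gives it the value 1 at \<open>w'\<close>.\<close>
  define u where "u = (1 / w' $ i) \<cdot>\<^sub>v (unit_vec n i - lin_comb n r (\<lambda>j. b j $ i) a)"
  have u: "u \<in> carrier_vec n" by (simp add: u_def)
  have *: "u \<bullet> v = (1 / w' $ i) * (v $ i - (\<Sum>j<r. b j $ i * (a j \<bullet> v)))"
    if v: "v \<in> carrier_vec n" for v
  proof -
    have "lin_comb n r (\<lambda>j. b j $ i) a \<bullet> v = v \<bullet> lin_comb n r (\<lambda>j. b j $ i) a"
      using v by (intro comm_scalar_prod) auto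
    also have "\<dots> = (\<Sum>j<r. b j $ i * (v \<bullet> a j))"
      using v a by (intro scalar_prod_lin_comb) auto
    also have "\<dots> = (\<Sum>j<r. b j $ i * (a j \<bullet> v))"
      using v a by (intro sum.cong) (auto simp: comm_scalar_prod[of _ n])
    finally show ?thesis using v i(1)
      by (simp add: u_def minus_scalar_prod_distrib[of _ n])
  qed
  have ub: "u \<bullet> b k = 0" if "k < r" for k
  proof -
    have "(\<Sum>j<r. b j $ i * (a j \<bullet> b k)) = (\<Sum>j<r. if j = k then b j $ i else 0)"
      using ds that by (intro sum.cong) (auto simp: dual_system_def)
    then show ?thesis using that by (simp add: *[OF b[OF that]])
  qed
  have uw: "u \<bullet> w' = 1" using i(2) by (simp add: *[OF w'] aw')
  have "dual_system n (Suc r) (a(r := u)) (b(r := w'))"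
    using ds u w' ub uw aw' unfolding dual_system_def by (auto simp: less_Suc_eq)
  then show thesis using that unfolding w'_def by blast
qed

text \<open>Write the functionals as rows and the vectors as columns. If \<open>r > n\<close>,
  padding with zeros gives square matrices of size \<open>r\<close> whose product is the identity,
  although column \<open>n\<close> of \<open>A\<close> is zero and so
  \<open>det A = 0\<close>.\<close>

lemma dual_system_le:
  fixes b :: "nat \<Rightarrow> 'k :: field vec"
  assumes "dual_system n r a b"
  shows "r \<le> n"
proof (rule ccontr)
  assume "\<not> r \<le> n"
  then have nr: "n < r" by simp
  define A where "A = mat r r (\<lambda>(i, j). if j < n then a i $ j else 0)"
  define B where "B = mat r r (\<lambda>(i, j). if i < n then b j $ i else 0)"
  have carr: "A \<in> carrier_mat r r" "B \<in> carrier_mat r r" by (auto simp: A_def B_def)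
  have "A * B = 1\<^sub>m r"
  proof (rule eq_matI)
    fix i j assume "i < dim_row (1\<^sub>m r :: 'k mat)" "j < dim_col (1\<^sub>m r :: 'k mat)"
    then have ij: "i < r" "j < r" by auto
    have bj: "dim_vec (b j) = n" using assms ij by (auto simp: dual_system_def)
    have "(A * B) $$ (i, j) = (\<Sum>k\<in>{0..<r}. if k < n then a i $ k * b j $ k else 0)"
      using ij by (auto simp: A_def B_def scalar_prod_def intro!: sum.cong)
    also have "\<dots> = (\<Sum>k\<in>{0..<n}. a i $ k * b j $ k)"
      using nr by (intro sum.mono_neutral_cong_right) auto
    also have "\<dots> = a i \<bullet> b j" by (simp add: scalar_prod_def bj)
    finally show "(A * B) $$ (i, j) = 1\<^sub>m r $$ (i, j)"
      using assms ij by (auto simp: dual_system_def)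
  qed (auto simp: A_def B_def)
  then have "det A * det B = 1" using det_mult[OF carr] by simp
  moreover have "det A = 0"
  proof -
    have "A *\<^sub>v unit_vec r n = 0\<^sub>v r" using nr by (intro eq_vecI) (auto simp: A_def)
    moreover have "unit_vec r n \<noteq> (0\<^sub>v r :: 'k vec)" using nr by (metis index_unit_vec(1) index_zero_vec(1) zero_neq_one)
    ultimately show ?thesis using det_0_iff_vec_prod_zero[OF carr(1)] by (metis unit_vec_carrier)
  qed
  ultimately show False by simp
qed

text \<open>The exchange bound. Restricting the functionals \<open>a i\<close> to the span of
  \<open>b'\<close> makes them dual to the coefficient vectors \<open>c i\<close> in dimension
  \<open>s\<close>, where \<open>dual_system_le\<close> applies.\<close>

lemma dual_system_le_of_span:
  assumes "dual_system n r a b" "dual_system n s a' b'"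
    "\<And>i. i < r \<Longrightarrow> b i = lin_comb n s (c i) b'"
  shows "r \<le> s"
proof -
  have "dual_system s r (\<lambda>i. vec s (\<lambda>j. a i \<bullet> b' j)) (\<lambda>i. vec s (c i))"
    unfolding dual_system_def
  proof (intro conjI allI impI)
    fix i j assume ij: "i < r" "j < r"
    have "vec s (\<lambda>j. a i \<bullet> b' j) \<bullet> vec s (c j) = (\<Sum>k<s. c j k * (a i \<bullet> b' k))"
      by (auto simp: scalar_prod_def lessThan_atLeast0 intro!: sum.cong)
    also have "\<dots> = a i \<bullet> lin_comb n s (c j) b'"
      using assms ij by (intro scalar_prod_lin_comb[symmetric]) (auto simp: dual_system_def)
    also have "\<dots> = (if i = j then 1 else 0)"
      using assms(1) ij by (simp add: dual_system_def assms(3)[OF ij(2), symmetric])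
    finally show "vec s (\<lambda>j. a i \<bullet> b' j) \<bullet> vec s (c j) = (if i = j then 1 else 0)" .
  qed auto
  then show ?thesis by (rule dual_system_le)
qed

lemma le_vdim:
  assumes "dual_system n r a b" "\<And>i. i < r \<Longrightarrow> b i \<in> W"
  shows "r \<le> vdim n W"
  unfolding vdim_def
  by (rule Greatest_le_nat[where b = n]) (use assms dual_system_le in blast)+

lemma vdim_attained:
  obtains a b where "dual_system n (vdim n W) a b" "\<And>i. i < vdim n W \<Longrightarrow> b i \<in> W"
proof -
  have "\<exists>a b. dual_system n (vdim n W) a b \<and> b ` {..<vdim n W} \<subseteq> W"
    unfolding vdim_def
    by (rule GreatestI_nat[where b = n and k = 0]) (use dual_system_le in \<open>auto simp: dual_system_def\<close>)
  then show thesis using that by (force simp: image_subset_iff)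
qed

lemma vdim_le: "vdim n W \<le> n"
  by (metis vdim_attained dual_system_le)

lemma vdim_mono: "W \<subseteq> W' \<Longrightarrow> vdim n W \<le> vdim n W'"
  by (metis vdim_attained le_vdim subsetD)

text \<open>Otherwise the remainder of \<open>w\<close>, which still lies in \<open>W\<close>, could
  be adjoined by \<open>dual_system_extend\<close>, giving more than \<open>vdim n W\<close>
  independent vectors.\<close>

lemma dual_system_max_spans:
  assumes "vec_subspace n W" "dual_system n r a b" "\<And>i. i < r \<Longrightarrow> b i \<in> W" "vdim n W \<le> r" "w \<in> W"
  shows "w = lin_comb n r (\<lambda>j. a j \<bullet> w) b"
proof (rule ccontr)
  assume nw: "w \<noteq> lin_comb n r (\<lambda>j. a j \<bullet> w) b"
  have w: "w \<in> carrier_vec n" using assms by (auto simp: vec_subspace_def)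
  define w' where "w' = w - lin_comb n r (\<lambda>j. a j \<bullet> w) b"
  obtain u where u: "dual_system n (Suc r) (a(r := u)) (b(r := w'))"
    using dual_system_extend[OF assms(2) w nw] unfolding w'_def by blast
  have "w' = w + (-1) \<cdot>\<^sub>v lin_comb n r (\<lambda>j. a j \<bullet> w) b"
    using w by (intro eq_vecI) (auto simp: w'_def)
  then have "w' \<in> W"
    using assms(1,5) lin_comb_in_subspace[OF assms(1,3), where c = "\<lambda>j. a j \<bullet> w"]
    by (auto simp: vec_subspace_def)
  then have "Suc r \<le> vdim n W" using u assms(3) by (intro le_vdim[OF u]) (auto simp: less_Suc_eq)
  then show False using assms(4) by simp
qed

text \<open>By \<open>dual_system_le_of_span\<close>, a system that is too short cannot expand all
  members of a maximal one, so some vector of \<open>W\<close> can be adjoined. The old pairs stay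
  unchanged, which allows a basis to be built up along a flag.\<close>

lemma dual_system_complete:
  assumes W: "vec_subspace n W"
  shows "dual_system n r a b \<Longrightarrow> (\<And>i. i < r \<Longrightarrow> b i \<in> W) \<Longrightarrow>
    \<exists>a' b'. dual_system n (vdim n W) a' b' \<and> (\<forall>i<vdim n W. b' i \<in> W) \<and> (\<forall>i<r. b' i = b i \<and> a' i = a i)"
proof (induction "vdim n W - r" arbitrary: r a b)
  case 0
  have "r = vdim n W" using le_vdim[OF 0(2,3)] 0(1) by simp
  then show ?case using 0 by blast
next
  case (Suc k)
  have lt: "r < vdim n W" using Suc(2) by simp
  obtain a1 b1 where ab1: "dual_system n (vdim n W) a1 b1" "\<And>i. i < vdim n W \<Longrightarrow> b1 i \<in> W"
    using vdim_attained[of n W] by blast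
  have "\<exists>w\<in>W. w \<noteq> lin_comb n r (\<lambda>j. a j \<bullet> w) b"
  proof (rule ccontr)
    assume "\<not> ?thesis"
    then have "b1 i = lin_comb n r (\<lambda>j. a j \<bullet> b1 i) b" if "i < vdim n W" for i using ab1(2)[OF that] by blast
    then show False using dual_system_le_of_span[OF ab1(1) Suc(3), where c = "\<lambda>i j. a j \<bullet> b1 i"] lt by auto
  qed
  then obtain w where w: "w \<in> W" "w \<noteq> lin_comb n r (\<lambda>j. a j \<bullet> w) b" by blast
  have wc: "w \<in> carrier_vec n" using w W by (auto simp: vec_subspace_def)
  define w' where "w' = w - lin_comb n r (\<lambda>j. a j \<bullet> w) b"
  obtain u where u: "dual_system n (Suc r) (a(r := u)) (b(r := w'))"
    using dual_system_extend[OF Suc(3) wc w(2)] unfolding w'_def by blast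
  have "w' = w + (-1) \<cdot>\<^sub>v lin_comb n r (\<lambda>j. a j \<bullet> w) b"
    using wc by (intro eq_vecI) (auto simp: w'_def)
  then have "w' \<in> W"
    using W w lin_comb_in_subspace[OF W Suc(4), where c = "\<lambda>j. a j \<bullet> w"]
    by (auto simp: vec_subspace_def)
  then have W': "(b(r := w')) i \<in> W" if "i < Suc r" for i
    using that Suc(4) by (auto simp: less_Suc_eq)
  have "k = vdim n W - Suc r" using Suc(2) by simp
  from Suc(1)[OF this u W'] obtain a' b' where "dual_system n (vdim n W) a' b'" "\<forall>i<vdim n W. b' i \<in> W"
    "\<forall>i<Suc r. b' i = (b(r := w')) i \<and> a' i = (a(r := u)) i" by blast
  then show ?case by (metis fun_upd_other less_Suc_eq less_irrefl)
qed

section \<open>Dual bases of the whole space and subspaces in coordinates\<close>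

lemma vec_subspace_carrier: "vec_subspace n (carrier_vec n)"
  by (auto simp: vec_subspace_def)

lemma vdim_carrier [simp]: "vdim n (carrier_vec n :: 'k :: field vec set) = n"
proof (rule antisym[OF vdim_le])
  have "dual_system n n (unit_vec n) (unit_vec n :: nat \<Rightarrow> 'k vec)"
    by (auto simp: dual_system_def)
  then show "n \<le> vdim n (carrier_vec n :: 'k vec set)" by (rule le_vdim) auto
qed

lemma dual_basis_expand:
  assumes "dual_system n n a b" "w \<in> carrier_vec n"
  shows "w = lin_comb n n (\<lambda>j. a j \<bullet> w) b"
  by (rule dual_system_max_spans[OF vec_subspace_carrier assms(1) _ _ assms(2)])
    (use assms in \<open>auto simp: dual_system_def\<close>)

text \<open>A maximal dual system in \<open>W\<close> is also maximal in \<open>W'\<close>, hence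
  spans it.\<close>

lemma vec_subspace_eqI:
  assumes "vec_subspace n W" "vec_subspace n W'" "W \<subseteq> W'" "vdim n W' \<le> vdim n W"
  shows "W = W'"
proof (intro subset_antisym assms subsetI)
  fix w assume w: "w \<in> W'"
  obtain a b where ab: "dual_system n (vdim n W) a b" "\<And>i. i < vdim n W \<Longrightarrow> b i \<in> W"
    using vdim_attained[of n W] by blast
  have "w = lin_comb n (vdim n W) (\<lambda>j. a j \<bullet> w) b"
    by (rule dual_system_max_spans[OF assms(2) ab(1) _ assms(4) w]) (use ab(2) assms(3) in blast)
  then show "w \<in> W" by (rule ssubst[of w]) (rule lin_comb_in_subspace[OF assms(1) ab(2)])
qed

text \<open>When \<open>a\<close> belongs to a dual basis, this is the span of its first
  \<open>r\<close> vectors. It is written by equations because arrow sums can then be tested one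
  functional at a time.\<close>

definition coord_subspace :: "nat \<Rightarrow> nat \<Rightarrow> (nat \<Rightarrow> 'k :: field vec) \<Rightarrow> 'k vec set" where
  "coord_subspace n r a = {w \<in> carrier_vec n. \<forall>i\<in>{r..<n}. a i \<bullet> w = 0}"

lemma vec_subspace_coord:
  assumes "\<And>i. i < n \<Longrightarrow> a i \<in> carrier_vec n"
  shows "vec_subspace n (coord_subspace n r a)"
  using assms by (auto simp: vec_subspace_def coord_subspace_def scalar_prod_add_distrib[of _ n])

lemma coord_subspace_mono: "r \<le> s \<Longrightarrow> coord_subspace n r a \<subseteq> coord_subspace n s a"
  by (auto simp: coord_subspace_def)

lemma dual_basis_mem_coord:
  assumes "dual_system n n a b" "i < r" "r \<le> n"
  shows "b i \<in> coord_subspace n r a"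
  using assms by (auto simp: dual_system_def coord_subspace_def)

lemma coord_subspace_expand:
  assumes ab: "dual_system n n a b" and r: "r \<le> n" and w: "w \<in> coord_subspace n r a"
  shows "w = lin_comb n r (\<lambda>j. a j \<bullet> w) b"
proof -
  have wc: "w \<in> carrier_vec n" using w by (auto simp: coord_subspace_def)
  have "w = lin_comb n n (\<lambda>j. a j \<bullet> w) b" by (rule dual_basis_expand[OF ab wc])
  also have "\<dots> = lin_comb n r (\<lambda>j. a j \<bullet> w) b"
    unfolding lin_comb_def
  proof (intro eq_vecI)
    fix i assume i: "i < dim_vec (vec n (\<lambda>i. \<Sum>j<r. a j \<bullet> w * b j $ i))"
    have "(\<Sum>j<n. a j \<bullet> w * b j $ i) = (\<Sum>j<r. a j \<bullet> w * b j $ i)"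
      using r w by (intro sum.mono_neutral_right) (auto simp: coord_subspace_def)
    then show "vec n (\<lambda>i. \<Sum>j<n. a j \<bullet> w * b j $ i) $ i = vec n (\<lambda>i. \<Sum>j<r. a j \<bullet> w * b j $ i) $ i"
      using i by simp
  qed auto
  finally show ?thesis .
qed

lemma vdim_coord_subspace:
  assumes ab: "dual_system n n a b" and r: "r \<le> n"
  shows "vdim n (coord_subspace n r a) = r"
proof (rule antisym)
  have ds: "dual_system n r a b" using ab r by (auto simp: dual_system_def)
  then show "r \<le> vdim n (coord_subspace n r a)"
    by (rule le_vdim) (use dual_basis_mem_coord[OF ab _ r] in blast)
  obtain a1 b1 where ab1: "dual_system n (vdim n (coord_subspace n r a)) a1 b1"
    "\<And>i. i < vdim n (coord_subspace n r a) \<Longrightarrow> b1 i \<in> coord_subspace n r a"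
    using vdim_attained by metis
  show "vdim n (coord_subspace n r a) \<le> r"
    by (rule dual_system_le_of_span[OF ab1(1) ds, where c = "\<lambda>i j. a j \<bullet> b1 i"])
      (use coord_subspace_expand[OF ab r] ab1(2) in blast)
qed

lemma dual_basis_coord_eq:
  assumes W: "vec_subspace n W" and ab: "dual_system n n a b" "\<And>i. i < vdim n W \<Longrightarrow> b i \<in> W"
  shows "coord_subspace n (vdim n W) a = W"
proof (rule vec_subspace_eqI)
  show "coord_subspace n (vdim n W) a \<subseteq> W"
  proof
    fix w assume "w \<in> coord_subspace n (vdim n W) a"
    then have "w = lin_comb n (vdim n W) (\<lambda>j. a j \<bullet> w) b"
      by (rule coord_subspace_expand[OF ab(1) vdim_le])
    then show "w \<in> W" by (rule ssubst[of w]) (rule lin_comb_in_subspace[OF W ab(2)])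
  qed
  show "vdim n W \<le> vdim n (coord_subspace n (vdim n W) a)"
    using vdim_coord_subspace[OF ab(1) vdim_le[of n W]] by simp
  show "vec_subspace n (coord_subspace n (vdim n W) a)"
    using ab(1) by (intro vec_subspace_coord) (auto simp: dual_system_def)
qed fact

text \<open>A maximal system of \<open>W\<close> is completed inside \<open>N\<close>, and the
  result inside the whole space. Initial segments survive each completion, so one basis exhibits
  both subspaces.\<close>

lemma adapted_dual_basis:
  assumes "vec_subspace n W" "vec_subspace n N" "W \<subseteq> N"
  obtains a b where "dual_system n n a b" "coord_subspace n (vdim n W) a = W"
    "coord_subspace n (vdim n N) a = N"
proof -
  obtain a0 b0 where ab0: "dual_system n (vdim n W) a0 b0" "\<And>i. i < vdim n W \<Longrightarrow> b0 i \<in> W"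
    using vdim_attained by metis
  then have "b0 i \<in> N" if "i < vdim n W" for i using that assms by blast
  from dual_system_complete[OF assms(2) ab0(1) this] obtain a1 b1 where
    ab1: "dual_system n (vdim n N) a1 b1" "\<And>i. i < vdim n N \<Longrightarrow> b1 i \<in> N"
    "\<And>i. i < vdim n W \<Longrightarrow> b1 i = b0 i" by blast
  then have "b1 i \<in> carrier_vec n" if "i < vdim n N" for i using that assms by (auto simp: vec_subspace_def)
  from dual_system_complete[OF vec_subspace_carrier ab1(1) this] obtain a b where
    ab: "dual_system n n a b" "\<And>i. i < vdim n N \<Longrightarrow> b i = b1 i" by auto
  have le: "vdim n W \<le> vdim n N" by (rule vdim_mono) fact
  show thesis
  proof (rule that[OF ab(1)])
    show "coord_subspace n (vdim n W) a = W"
      using ab1 ab0 ab le by (intro dual_basis_coord_eq assms) auto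
    show "coord_subspace n (vdim n N) a = N"
      using ab1 ab by (intro dual_basis_coord_eq assms) auto
  qed
qed

text \<open>Cut a basis adapted to the flag after \<open>k\<close> vectors. The dual basis is kept
  in the conclusion because the conjugation in \<open>conjugate_arrow_images\<close> is built from
  it.\<close>

lemma intermediate_subspace:
  assumes "vec_subspace n W" "vec_subspace n N" "W \<subseteq> N" "vdim n W \<le> k" "k \<le> vdim n N"
  obtains a b where "dual_system n n a b" "W \<subseteq> coord_subspace n k a" "coord_subspace n k a \<subseteq> N"
proof -
  obtain a b where ab: "dual_system n n a b" "coord_subspace n (vdim n W) a = W"
    "coord_subspace n (vdim n N) a = N"
    using adapted_dual_basis[OF assms(1-3)] by blast
  have "W \<subseteq> coord_subspace n k a" using coord_subspace_mono[OF assms(4)] ab(2) by metis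
  moreover have "coord_subspace n k a \<subseteq> N" using coord_subspace_mono[OF assms(5)] ab(3) by metis
  ultimately show thesis by (rule that[OF ab(1)])
qed

text \<open>The pairing is symmetric, so exchanging functionals and vectors of a dual basis adapted
  to \<open>R\<close> gives a dual basis again. In the exchanged one the orthogonal complement is a
  coordinate subspace.\<close>

lemma vdim_orthogonal:
  assumes R: "vec_subspace n R"
  shows "vdim n {w \<in> carrier_vec n. \<forall>u\<in>R. u \<bullet> w = 0} + vdim n R = n"
proof -
  define r where "r = vdim n R"
  obtain a b where ab: "dual_system n n a b" "coord_subspace n r a = R"
    unfolding r_def by (rule adapted_dual_basis[OF R R subset_refl])
  have r: "r \<le> n" by (simp add: r_def vdim_le)
  have a: "a i \<in> carrier_vec n" and b: "b i \<in> carrier_vec n" if "i < n" for i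
    using ab that by (auto simp: dual_system_def)
  \<comment> \<open>The order is reversed because \<open>coord_subspace\<close> imposes the last
    functionals, and the equations here come from the first \<open>r\<close> vectors
    \<open>b\<close>.\<close>
  define a' where "a' = (\<lambda>i. b (n - 1 - i))"
  define b' where "b' = (\<lambda>i. a (n - 1 - i))"
  have ds: "dual_system n n a' b'"
    using ab(1) unfolding dual_system_def a'_def b'_def
    by (auto simp: comm_scalar_prod[of "b _" n "a _"])
  have "{w \<in> carrier_vec n. \<forall>u\<in>R. u \<bullet> w = 0} = coord_subspace n (n - r) a'"
  proof (intro subset_antisym subsetI)
    fix w assume w: "w \<in> {w \<in> carrier_vec n. \<forall>u\<in>R. u \<bullet> w = 0}"
    have "a' i \<bullet> w = 0" if "i \<in> {n - r..<n}" for i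
    proof -
      have "n - 1 - i < r" using that by auto
      then have "a' i \<in> R" using dual_basis_mem_coord[OF ab(1) _ r] ab(2) by (auto simp: a'_def)
      then show ?thesis using w by blast
    qed
    then show "w \<in> coord_subspace n (n - r) a'" using w by (auto simp: coord_subspace_def)
  next
    fix w assume w: "w \<in> coord_subspace n (n - r) a'"
    have wc: "w \<in> carrier_vec n" using w by (simp add: coord_subspace_def)
    have bw: "w \<bullet> b i = 0" if "i < r" for i
    proof -
      have "n - 1 - i \<in> {n - r..<n}" "n - 1 - (n - 1 - i) = i" using that r by auto
      then have "b i \<bullet> w = 0" using w unfolding coord_subspace_def a'_def by force
      then show ?thesis using that r b[of i] wc by (simp add: comm_scalar_prod[of w n])
    qed
    have "u \<bullet> w = 0" if u: "u \<in> R" for u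
    proof -
      have uc: "u \<in> carrier_vec n" using u R by (auto simp: vec_subspace_def)
      have "u = lin_comb n r (\<lambda>j. a j \<bullet> u) b" using coord_subspace_expand[OF ab(1) r] u ab(2) by blast
      then have "w \<bullet> u = w \<bullet> lin_comb n r (\<lambda>j. a j \<bullet> u) b" by (rule arg_cong)
      also have "\<dots> = (\<Sum>j<r. (a j \<bullet> u) * (w \<bullet> b j))"
        using wc b r by (intro scalar_prod_lin_comb) auto
      also have "\<dots> = 0" using bw by (intro sum.neutral) auto
      finally show ?thesis using uc(1) wc by (simp add: comm_scalar_prod[of u n])
    qed
    then show "w \<in> {w \<in> carrier_vec n. \<forall>u\<in>R. u \<bullet> w = 0}" using wc by blast
  qed
  then have "vdim n {w \<in> carrier_vec n. \<forall>u\<in>R. u \<bullet> w = 0} = n - r"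
    using vdim_coord_subspace[OF ds, of "n - r"] by simp
  then show ?thesis using r by (simp add: r_def)
qed

section \<open>Linear maps: dimensions of images and kernels\<close>

lemma linear_lin_comb:
  assumes carr: "\<And>w. w \<in> carrier_vec n \<Longrightarrow> \<phi> w \<in> carrier_vec m"
    and add: "\<And>v w. v \<in> carrier_vec n \<Longrightarrow> w \<in> carrier_vec n \<Longrightarrow> \<phi> (v + w) = \<phi> v + \<phi> w"
    and smult: "\<And>c w. w \<in> carrier_vec n \<Longrightarrow> \<phi> (c \<cdot>\<^sub>v w) = c \<cdot>\<^sub>v \<phi> w"
    and b: "\<And>j. j < r \<Longrightarrow> b j \<in> carrier_vec n"
  shows "\<phi> (lin_comb n r c b) = lin_comb m r c (\<lambda>j. \<phi> (b j))"
  using b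
proof (induction r)
  case 0
  have eq: "lin_comb n 0 c b = 0 \<cdot>\<^sub>v 0\<^sub>v n" "lin_comb m 0 c (\<lambda>j. \<phi> (b j)) = 0 \<cdot>\<^sub>v \<phi> (0\<^sub>v n)"
    using carr[of "0\<^sub>v n"] by (auto simp: lin_comb_def)
  show ?case unfolding eq by (rule smult) simp
next
  case (Suc r)
  then show ?case by (simp add: lin_comb_Suc add smult carr)
qed

lemma lin_comb_unit_vec:
  assumes "w \<in> carrier_vec n"
  shows "w = lin_comb n n (\<lambda>j. w $ j) (unit_vec n)"
proof -
  have "w = lin_comb n n (\<lambda>j. unit_vec n j \<bullet> w) (unit_vec n)"
    by (rule dual_basis_expand[OF _ assms]) (auto simp: dual_system_def)
  also have "\<dots> = lin_comb n n (\<lambda>j. w $ j) (unit_vec n)"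
    using assms by (intro lin_comb_cong) auto
  finally show ?thesis .
qed

text \<open>The maps are functions, not matrices, since they will be components of module
  homomorphisms. A maximal dual system of the image is pulled back along \<psi>; by injectivity the
  pulled back vectors still span, so their number is \<open>u\<close>.\<close>

lemma vdim_image_of_injective:
  fixes \<psi> :: "'k :: field vec \<Rightarrow> 'k vec"
  assumes carr: "\<And>w. w \<in> carrier_vec u \<Longrightarrow> \<psi> w \<in> carrier_vec n"
    and add: "\<And>v w. v \<in> carrier_vec u \<Longrightarrow> w \<in> carrier_vec u \<Longrightarrow> \<psi> (v + w) = \<psi> v + \<psi> w"
    and smult: "\<And>c w. w \<in> carrier_vec u \<Longrightarrow> \<psi> (c \<cdot>\<^sub>v w) = c \<cdot>\<^sub>v \<psi> w"
    and inj: "inj_on \<psi> (carrier_vec u)"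
    and N: "vec_subspace n (\<psi> ` carrier_vec u)"
  shows "vdim n (\<psi> ` carrier_vec u) = u"
proof -
  define N where "N = \<psi> ` carrier_vec u"
  define r where "r = vdim n N"
  obtain a b where ab: "dual_system n r a b" "\<And>i. i < r \<Longrightarrow> b i \<in> N"
    using vdim_attained unfolding r_def by metis
  have "\<forall>i<r. \<exists>c\<in>carrier_vec u. b i = \<psi> c" using ab(2) by (auto simp: N_def)
  then obtain c where c: "\<And>i. i < r \<Longrightarrow> c i \<in> carrier_vec u" "\<And>i. i < r \<Longrightarrow> b i = \<psi> (c i)" by metis
  have expand: "\<psi> w = lin_comb n r (\<lambda>j. a j \<bullet> \<psi> w) b" if "w \<in> carrier_vec u" for w
    using that N by (intro dual_system_max_spans[OF _ ab]) (auto simp: N_def r_def)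
  \<comment> \<open>The vector representing the functional that sends \<open>w\<close> to
    \<open>a i \<bullet> \<psi> w\<close>.\<close>
  define A where "A = (\<lambda>i. vec u (\<lambda>j. a i \<bullet> \<psi> (unit_vec u j)))"
  have A: "A i \<bullet> w = a i \<bullet> \<psi> w" if i: "i < r" and w: "w \<in> carrier_vec u" for i w
  proof -
    have "a i \<bullet> \<psi> w = a i \<bullet> \<psi> (lin_comb u u (\<lambda>j. w $ j) (unit_vec u))"
      using lin_comb_unit_vec[OF w] by (rule arg_cong)
    also have "\<dots> = a i \<bullet> lin_comb n u (\<lambda>j. w $ j) (\<lambda>j. \<psi> (unit_vec u j))"
      by (subst linear_lin_comb[OF carr add smult]) auto
    also have "\<dots> = (\<Sum>j<u. w $ j * (a i \<bullet> \<psi> (unit_vec u j)))"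
      using ab(1) i carr by (intro scalar_prod_lin_comb) (auto simp: dual_system_def)
    also have "\<dots> = A i \<bullet> w" using w
      by (auto simp: A_def scalar_prod_def lessThan_atLeast0 mult.commute intro!: sum.cong)
    finally show ?thesis by simp
  qed
  have ds: "dual_system u r A c"
    using A c ab(1) by (auto simp: dual_system_def A_def)
  have span: "w = lin_comb u r (\<lambda>j. A j \<bullet> w) c" if w: "w \<in> carrier_vec u" for w
  proof -
    have "\<psi> (lin_comb u r (\<lambda>j. A j \<bullet> w) c) = lin_comb n r (\<lambda>j. A j \<bullet> w) (\<lambda>j. \<psi> (c j))"
      by (rule linear_lin_comb[OF carr add smult c(1)])
    also have "\<dots> = lin_comb n r (\<lambda>j. a j \<bullet> \<psi> w) b" using A w c by (intro lin_comb_cong) auto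
    also have "\<dots> = \<psi> w" using expand[OF w] by simp
    finally show ?thesis by (rule inj_onD[OF inj _ lin_comb_carrier w, symmetric])
  qed
  have "dual_system u u (unit_vec u) (unit_vec u :: nat \<Rightarrow> 'k vec)" by (auto simp: dual_system_def)
  then have "u \<le> r" by (rule dual_system_le_of_span[OF _ ds span]) simp
  moreover have "r \<le> u" by (rule dual_system_le[OF ds])
  ultimately show ?thesis by (simp add: r_def N_def)
qed

text \<open>Rank and nullity: in a basis adapted to the kernel, the vectors from number
  \<open>r\<close> on span a complement, which \<phi> maps bijectively onto the target. Then
  \<open>vdim_image_of_injective\<close> gives \<open>m = n - r\<close>.\<close>

lemma vdim_kernel_of_surjective:
  fixes \<phi> :: "'k :: field vec \<Rightarrow> 'k vec"
  assumes carr: "\<And>w. w \<in> carrier_vec n \<Longrightarrow> \<phi> w \<in> carrier_vec m"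
    and add: "\<And>v w. v \<in> carrier_vec n \<Longrightarrow> w \<in> carrier_vec n \<Longrightarrow> \<phi> (v + w) = \<phi> v + \<phi> w"
    and smult: "\<And>c w. w \<in> carrier_vec n \<Longrightarrow> \<phi> (c \<cdot>\<^sub>v w) = c \<cdot>\<^sub>v \<phi> w"
    and surj: "\<And>u. u \<in> carrier_vec m \<Longrightarrow> \<exists>w\<in>carrier_vec n. \<phi> w = u"
  shows "vdim n {w \<in> carrier_vec n. \<phi> w = 0\<^sub>v m} + m = n"
proof -
  define K where "K = {w \<in> carrier_vec n. \<phi> w = 0\<^sub>v m}"
  define r where "r = vdim n K"
  have r: "r \<le> n" by (simp add: r_def vdim_le)
  have zero: "0 \<cdot>\<^sub>v w = 0\<^sub>v l" if "w \<in> carrier_vec l" for w :: "'k vec" and l using that by (intro eq_vecI) auto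
  have \<phi>0: "\<phi> (0\<^sub>v n) = 0\<^sub>v m" 
    using smult[OF zero_carrier_vec, of 0] unfolding zero[OF zero_carrier_vec] zero[OF carr[OF zero_carrier_vec]] .
  have K: "vec_subspace n K"
    unfolding vec_subspace_def K_def using \<phi>0 by (auto simp: add smult)
  obtain a b where ab: "dual_system n n a b" "coord_subspace n r a = K"
    unfolding r_def by (rule adapted_dual_basis[OF K K subset_refl])
  \<comment> \<open>The embedding onto the complement spanned by \<open>b r\<close>, ...,
    \<open>b (n - 1)\<close>.\<close>
  define \<iota> where "\<iota> = (\<lambda>c. vec n (\<lambda>i. \<Sum>j<n - r. c $ j * b (r + j) $ i) :: 'k vec)"
  have \<iota>: "\<iota> c \<in> carrier_vec n" for c by (simp add: \<iota>_def)
  have \<iota>_comb: "\<iota> c = lin_comb n n (\<lambda>j. if j < r then 0 else c $ (j - r)) b" for c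
  proof (rule eq_vecI)
    fix i assume "i < dim_vec (lin_comb n n (\<lambda>j. if j < r then 0 else c $ (j - r)) b)"
    then have i: "i < n" by simp
    have "(\<Sum>j<n. (if j < r then 0 else c $ (j - r)) * b j $ i) = (\<Sum>j\<in>{r..<n}. c $ (j - r) * b j $ i)"
      by (intro sum.mono_neutral_cong_right) auto
    also have "\<dots> = (\<Sum>j<n - r. c $ j * b (r + j) $ i)"
      by (rule sum.reindex_bij_witness[of _ "\<lambda>j. r + j" "\<lambda>j. j - r"]) auto
    finally show "\<iota> c $ i = lin_comb n n (\<lambda>j. if j < r then 0 else c $ (j - r)) b $ i"
      using i by (simp add: \<iota>_def lin_comb_def)
  qed (simp add: \<iota>_def)
  have \<iota>_coeff: "a j \<bullet> \<iota> c = (if j < r then 0 else c $ (j - r))" if "j < n" for j c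
    unfolding \<iota>_comb by (rule dual_system_coeff[OF ab(1) that])
  have \<iota>_add: "\<iota> (c + c') = \<iota> c + \<iota> c'" if "c \<in> carrier_vec (n - r)" "c' \<in> carrier_vec (n - r)" for c c'
    using that by (intro eq_vecI) (auto simp: \<iota>_def distrib_right sum.distrib)
  have \<iota>_smult: "\<iota> (k \<cdot>\<^sub>v c) = k \<cdot>\<^sub>v \<iota> c" if "c \<in> carrier_vec (n - r)" for k c
    using that by (intro eq_vecI) (auto simp: \<iota>_def sum_distrib_left mult.assoc)
  have split: "\<exists>c\<in>carrier_vec (n - r). \<phi> (\<iota> c) = \<phi> w" if w: "w \<in> carrier_vec n" for w
  proof
    define c where "c = vec (n - r) (\<lambda>j. a (r + j) \<bullet> w)"
    show "c \<in> carrier_vec (n - r)" by (simp add: c_def)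
    have "w - \<iota> c \<in> coord_subspace n r a"
      using ab(1) w \<iota>[of c] \<iota>_coeff
      by (auto simp: coord_subspace_def dual_system_def scalar_prod_minus_distrib[of _ n] c_def)
    then have *: "w - \<iota> c \<in> carrier_vec n" "\<phi> (w - \<iota> c) = 0\<^sub>v m" by (simp_all add: ab(2) K_def)
    have "\<phi> w = \<phi> (\<iota> c + (w - \<iota> c))" using w \<iota>[of c] by (intro arg_cong[where f = \<phi>] eq_vecI) auto
    then show "\<phi> (\<iota> c) = \<phi> w" using add[OF \<iota> *(1), of c] *(2) carr[OF \<iota>, of c] by simp
  qed
  have image: "(\<lambda>c. \<phi> (\<iota> c)) ` carrier_vec (n - r) = carrier_vec m"
    using carr[OF \<iota>] split surj by (force simp: image_iff)
  have "vdim m ((\<lambda>c. \<phi> (\<iota> c)) ` carrier_vec (n - r)) = n - r"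
  proof (rule vdim_image_of_injective)
    show "inj_on (\<lambda>c. \<phi> (\<iota> c)) (carrier_vec (n - r))"
    proof (rule inj_onI)
      fix c c' :: "'k vec" assume c: "c \<in> carrier_vec (n - r)" "c' \<in> carrier_vec (n - r)" "\<phi> (\<iota> c) = \<phi> (\<iota> c')"
      define e where "e = c + (-1) \<cdot>\<^sub>v c'"
      have e: "e \<in> carrier_vec (n - r)" using c by (simp add: e_def)
      have "\<phi> (\<iota> e) = \<phi> (\<iota> c) + (-1) \<cdot>\<^sub>v \<phi> (\<iota> c')"
        using c \<iota> by (simp add: e_def \<iota>_add \<iota>_smult add smult)
      also have "\<dots> = 0\<^sub>v m" using c(3) carr[OF \<iota>, of c'] by (intro eq_vecI) auto
      finally have mem: "\<iota> e \<in> coord_subspace n r a" using \<iota> by (simp add: ab(2) K_def)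
      show "c = c'"
      proof (rule eq_vecI)
        fix j assume "j < dim_vec c'"
        then have j: "r + j < n" "j < n - r" using c r by auto
        have "a (r + j) \<bullet> \<iota> e = 0" using mem j by (simp add: coord_subspace_def)
        then show "c $ j = c' $ j" using \<iota>_coeff[OF j(1), of e] j c by (simp add: e_def)
      qed (use c in auto)
    qed
    show "vec_subspace m ((\<lambda>c. \<phi> (\<iota> c)) ` carrier_vec (n - r))"
      unfolding image by (rule vec_subspace_carrier)
  qed (use carr add smult \<iota> \<iota>_add \<iota>_smult in simp_all)
  then show ?thesis using r unfolding image by (simp add: r_def K_def)
qed

section \<open>Paths and matrices with vanishing products\<close>

text \<open>A coefficient is carried along because multiples of trivial paths recover the scalars of
  \<open>K\<close> inside the algebra, and because elements are taken apart term by term.\<close>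

definition mono_elem :: "('v, 'a) path \<Rightarrow> 'k \<Rightarrow> ('v, 'a) path \<Rightarrow> 'k :: field" where
  "mono_elem q c = (\<lambda>q'. if q' = q then c else 0)"

lemma path_elem_eq_mono: "path_elem q = mono_elem q 1"
  by (simp add: path_elem_def mono_elem_def)

context wf_digraph
begin

lemma is_path_Nil [simp]: "is_path G (u, []) \<longleftrightarrow> u \<in> verts G"
  by (simp add: is_path_def awalk_def)

lemma is_path_Cons [simp]: "is_path G (u, e # p) \<longleftrightarrow> e \<in> arcs G \<and> tail G e = u \<and> is_path G (head G e, p)"
  by (auto simp: is_path_def awalk_def)

lemma path_end_Nil [simp]: "path_end G (u, []) = u"
  by (simp add: path_end_def)

lemma path_end_Cons [simp]: "path_end G (u, e # p) = path_end G (head G e, p)"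
  by (simp add: path_end_def)

lemma is_path_append:
  "is_path G (u, p @ p') \<longleftrightarrow> is_path G (u, p) \<and> is_path G (path_end G (u, p), p')"
proof (induction p arbitrary: u)
  case Nil
  show ?case by (cases p') auto
qed auto

end

section \<open>Multiplication of monomials\<close>

lemma path_algebra_simps:
  "r \<in> carrier (path_algebra Q) \<longleftrightarrow> finite {q. r q \<noteq> 0} \<and> (\<forall>q. r q \<noteq> 0 \<longrightarrow> is_path Q q)"
  "(r \<otimes>\<^bsub>path_algebra Q\<^esub> s) (u, p) =
     (\<Sum>k\<le>length p. r (path_end Q (u, take k p), drop k p) * s (u, take k p))"
  "(r \<oplus>\<^bsub>path_algebra Q\<^esub> s) q = r q + s q"
  "\<zero>\<^bsub>path_algebra Q\<^esub> q = 0"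
  "\<one>\<^bsub>path_algebra Q\<^esub> (u, p) = (if u \<in> verts Q \<and> p = [] then 1 else 0)"
  by (simp_all add: path_algebra_def)

lemma mono_elem_carrier [simp]: "is_path Q q \<Longrightarrow> mono_elem q c \<in> carrier (path_algebra Q)"
  by (auto simp: path_algebra_simps mono_elem_def intro: finite_subset[of _ "{q}"])

text \<open>In the sum over all cuts, only the cut after \<open>length p\<close> arrows can match
  the right-hand factor.\<close>

lemma mono_elem_mult:
  "mono_elem (path_end Q (u, p), p') c' \<otimes>\<^bsub>path_algebra Q\<^esub> mono_elem (u, p) c = mono_elem (u, p @ p') (c' * c)"
proof
  fix q :: "('a, 'b) path"
  obtain u1 p1 where q: "q = (u1, p1)" by force
  have "(\<Sum>k\<le>length p1. mono_elem (path_end Q (u, p), p') c' (path_end Q (u1, take k p1), drop k p1) *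
      mono_elem (u, p) c (u1, take k p1)) =
      (\<Sum>k\<le>length p1. if k = length p then mono_elem (u, p @ p') (c' * c) (u1, p1) else 0)"
  proof (rule sum.cong)
    fix k assume k: "k \<in> {..length p1}"
    then have len: "length (take k p1) = k" by simp
    have split: "p1 = take k p1 @ drop k p1" by simp
    show "mono_elem (path_end Q (u, p), p') c' (path_end Q (u1, take k p1), drop k p1) *
      mono_elem (u, p) c (u1, take k p1) = (if k = length p then mono_elem (u, p @ p') (c' * c) (u1, p1) else 0)"
    proof (cases "u1 = u \<and> take k p1 = p")
      case True
      then have "k = length p" using len by auto
      moreover have "p1 = p @ p' \<longleftrightarrow> drop k p1 = p'"
        using True split by (metis same_append_eq)
      ultimately show ?thesis using True by (auto simp: mono_elem_def)
    next
      case False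
      have "mono_elem (u, p) c (u1, take k p1) = 0" using False by (auto simp: mono_elem_def)
      moreover have "mono_elem (u, p @ p') (c' * c) (u1, p1) = 0" if "k = length p"
        using False that by (auto simp: mono_elem_def)
      ultimately show ?thesis by simp
    qed
  qed simp
  also have "\<dots> = mono_elem (u, p @ p') (c' * c) (u1, p1)"
    by (auto simp: mono_elem_def)
  finally show "(mono_elem (path_end Q (u, p), p') c' \<otimes>\<^bsub>path_algebra Q\<^esub> mono_elem (u, p) c) q =
      mono_elem (u, p @ p') (c' * c) q"
    by (simp add: q path_algebra_simps)
qed

section \<open>Joint images and kernels of the arrows at a vertex\<close>

definition arrow_sum ::
    "('v, 'a) pre_digraph \<Rightarrow> ('v \<Rightarrow> nat) \<Rightarrow> ('a \<Rightarrow> 'k :: field mat) \<Rightarrow> 'v \<Rightarrow> ('a \<Rightarrow> 'k vec) \<Rightarrow> 'k vec" where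
  "arrow_sum Q d x v c = vec (d v) (\<lambda>i. \<Sum>e | e \<in> arcs Q \<and> head Q e = v. (x e *\<^sub>v c e) $ i)"

text \<open>The space W_v(x) of the overview, as the range of one joint linear map from the direct
  sum of the spaces at the tails. The family \<open>c\<close> is a parameter that does not depend on
  the point, which semicontinuity will exploit.\<close>

definition arrow_image ::
    "('v, 'a) pre_digraph \<Rightarrow> ('v \<Rightarrow> nat) \<Rightarrow> ('a \<Rightarrow> 'k :: field mat) \<Rightarrow> 'v \<Rightarrow> 'k vec set" where
  "arrow_image Q d x v =
     {arrow_sum Q d x v c | c. \<forall>e\<in>arcs Q. head Q e = v \<longrightarrow> c e \<in> carrier_vec (d (tail Q e))}"

definition arrow_kernel ::
    "('v, 'a) pre_digraph \<Rightarrow> ('v \<Rightarrow> nat) \<Rightarrow> ('a \<Rightarrow> 'k :: field mat) \<Rightarrow> 'v \<Rightarrow> 'k vec set" where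
  "arrow_kernel Q d x v =
     {w \<in> carrier_vec (d v). \<forall>e\<in>arcs Q. tail Q e = v \<longrightarrow> x e *\<^sub>v w = 0\<^sub>v (d (head Q e))}"

text \<open>The concrete form of the relations; \<open>Rep_iff\<close> identifies it with membership
  in the variety.\<close>

definition square_zero_rep ::
    "('v, 'a) pre_digraph \<Rightarrow> ('v \<Rightarrow> nat) \<Rightarrow> ('a \<Rightarrow> 'k :: field mat) \<Rightarrow> bool" where
  "square_zero_rep Q d x \<longleftrightarrow> x \<in> rep_affine_space Q d \<and>
     (\<forall>e\<in>arcs Q. \<forall>e'\<in>arcs Q. head Q e = tail Q e' \<longrightarrow>
        x e' * x e = 0\<^sub>m (d (head Q e')) (d (tail Q e)))"

lemma mult_mat_zero_vec: "A \<in> carrier_mat nr nc \<Longrightarrow> A *\<^sub>v 0\<^sub>v nc = (0\<^sub>v nr :: 'k :: field vec)"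
  by (intro eq_vecI) auto

lemma rep_affine_space_carrier:
  "x \<in> rep_affine_space Q d \<Longrightarrow> e \<in> arcs Q \<Longrightarrow> x e \<in> carrier_mat (d (head Q e)) (d (tail Q e))"
  by (auto simp: rep_affine_space_def)

lemma arrow_sum_carrier [simp]: "arrow_sum Q d x v c \<in> carrier_vec (d v)"
  by (simp add: arrow_sum_def)

lemma dim_arrow_sum [simp]: "dim_vec (arrow_sum Q d x v c) = d v"
  by (simp add: arrow_sum_def)

lemma arrow_sum_cong:
  "(\<And>e. e \<in> arcs Q \<Longrightarrow> head Q e = v \<Longrightarrow> c e = c' e) \<Longrightarrow> arrow_sum Q d x v c = arrow_sum Q d x v c'"
  unfolding arrow_sum_def by (intro eq_vecI) auto

lemma arrow_sum_add:
  assumes "x \<in> rep_affine_space Q d"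
    "\<And>e. e \<in> arcs Q \<Longrightarrow> head Q e = v \<Longrightarrow> c e \<in> carrier_vec (d (tail Q e))"
    "\<And>e. e \<in> arcs Q \<Longrightarrow> head Q e = v \<Longrightarrow> c' e \<in> carrier_vec (d (tail Q e))"
  shows "arrow_sum Q d x v (\<lambda>e. c e + c' e) = arrow_sum Q d x v c + arrow_sum Q d x v c'"
proof (rule eq_vecI)
  fix i assume "i < dim_vec (arrow_sum Q d x v c + arrow_sum Q d x v c')"
  then have i: "i < d v" by (simp add: arrow_sum_def)
  have "(x e *\<^sub>v (c e + c' e)) $ i = (x e *\<^sub>v c e) $ i + (x e *\<^sub>v c' e) $ i"
    if "e \<in> arcs Q" "head Q e = v" for e
    using rep_affine_space_carrier[OF assms(1) that(1)] assms(2,3)[OF that] i that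
    by (simp add: mult_add_distrib_mat_vec)
  then show "arrow_sum Q d x v (\<lambda>e. c e + c' e) $ i = (arrow_sum Q d x v c + arrow_sum Q d x v c') $ i"
    using i by (simp add: arrow_sum_def sum.distrib)
qed (simp add: arrow_sum_def)

lemma arrow_sum_smult:
  assumes "x \<in> rep_affine_space Q d"
    "\<And>e. e \<in> arcs Q \<Longrightarrow> head Q e = v \<Longrightarrow> c e \<in> carrier_vec (d (tail Q e))"
  shows "arrow_sum Q d x v (\<lambda>e. k \<cdot>\<^sub>v c e) = k \<cdot>\<^sub>v arrow_sum Q d x v c"
proof (rule eq_vecI)
  fix i assume "i < dim_vec (k \<cdot>\<^sub>v arrow_sum Q d x v c)"
  then have i: "i < d v" by (simp add: arrow_sum_def)
  have "(x e *\<^sub>v (k \<cdot>\<^sub>v c e)) $ i = k * (x e *\<^sub>v c e) $ i"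
    if "e \<in> arcs Q" "head Q e = v" for e
    using rep_affine_space_carrier[OF assms(1) that(1)] assms(2)[OF that] i that
    by (simp add: mult_mat_vec)
  then show "arrow_sum Q d x v (\<lambda>e. k \<cdot>\<^sub>v c e) $ i = (k \<cdot>\<^sub>v arrow_sum Q d x v c) $ i"
    using i by (simp add: arrow_sum_def sum_distrib_left)
qed (simp add: arrow_sum_def)

lemma vec_subspace_arrow_image:
  assumes x: "x \<in> rep_affine_space Q d"
  shows "vec_subspace (d v) (arrow_image Q d x v)"
  unfolding vec_subspace_def
proof (intro conjI ballI allI)
  show "arrow_image Q d x v \<subseteq> carrier_vec (d v)" by (auto simp: arrow_image_def)
  have "arrow_sum Q d x v (\<lambda>e. 0\<^sub>v (d (tail Q e))) = 0\<^sub>v (d v)"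
    unfolding arrow_sum_def
    by (intro eq_vecI) (auto simp: mult_mat_zero_vec[OF rep_affine_space_carrier[OF x]] intro!: sum.neutral)
  then show "0\<^sub>v (d v) \<in> arrow_image Q d x v"
    unfolding arrow_image_def by (intro CollectI exI[of _ "\<lambda>e. 0\<^sub>v (d (tail Q e))"]) auto
  fix u assume "u \<in> arrow_image Q d x v"
  then obtain c where c: "u = arrow_sum Q d x v c"
      "\<And>e. e \<in> arcs Q \<Longrightarrow> head Q e = v \<Longrightarrow> c e \<in> carrier_vec (d (tail Q e))"
    by (auto simp: arrow_image_def)
  show "k \<cdot>\<^sub>v u \<in> arrow_image Q d x v" for k
    unfolding arrow_image_def c(1)
    by (intro CollectI exI[of _ "\<lambda>e. k \<cdot>\<^sub>v c e"] conjI arrow_sum_smult[symmetric, OF x] c(2)) (use c(2) in auto)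
  fix w assume "w \<in> arrow_image Q d x v"
  then obtain c' where c': "w = arrow_sum Q d x v c'"
      "\<And>e. e \<in> arcs Q \<Longrightarrow> head Q e = v \<Longrightarrow> c' e \<in> carrier_vec (d (tail Q e))"
    by (auto simp: arrow_image_def)
  show "u + w \<in> arrow_image Q d x v"
    unfolding arrow_image_def c(1) c'(1)
    by (intro CollectI exI[of _ "\<lambda>e. c e + c' e"] conjI arrow_sum_add[symmetric, OF x] c(2) c'(2))
      (use c(2) c'(2) in auto)
qed

lemma vec_subspace_arrow_kernel:
  assumes x: "x \<in> rep_affine_space Q d"
  shows "vec_subspace (d v) (arrow_kernel Q d x v)"
proof -
  have carr: "x e \<in> carrier_mat (d (head Q e)) (d v)" if "e \<in> arcs Q" "tail Q e = v" for e
    using rep_affine_space_carrier[OF x that(1)] that(2) by simp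
  show ?thesis
    unfolding vec_subspace_def
  proof (intro conjI ballI allI)
    show "arrow_kernel Q d x v \<subseteq> carrier_vec (d v)" by (auto simp: arrow_kernel_def)
    show "0\<^sub>v (d v) \<in> arrow_kernel Q d x v"
      by (auto simp: arrow_kernel_def mult_mat_zero_vec[OF rep_affine_space_carrier[OF x]])
    fix u assume u: "u \<in> arrow_kernel Q d x v"
    show "k \<cdot>\<^sub>v u \<in> arrow_kernel Q d x v" for k
      using u by (auto simp: arrow_kernel_def mult_mat_vec[OF carr])
    fix w assume "w \<in> arrow_kernel Q d x v"
    then show "u + w \<in> arrow_kernel Q d x v"
      using u by (auto simp: arrow_kernel_def mult_add_distrib_mat_vec[OF carr])
  qed
qed

text \<open>This is the inclusion of W_v(x) in N_v(x): applying \<open>x e'\<close> to the sum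
  produces the products \<open>x e' * x e\<close>, and each of them is zero.\<close>

lemma arrow_kernel_arrow_sum:
  assumes fin: "finite (arcs Q)" and x: "square_zero_rep Q d x"
    and c: "\<And>e. e \<in> arcs Q \<Longrightarrow> head Q e = v \<Longrightarrow> c e \<in> carrier_vec (d (tail Q e))"
  shows "arrow_sum Q d x v c \<in> arrow_kernel Q d x v"
  unfolding arrow_kernel_def
proof (intro CollectI conjI ballI impI)
  fix e' assume e': "e' \<in> arcs Q" "tail Q e' = v"
  have x': "x \<in> rep_affine_space Q d" using x by (simp add: square_zero_rep_def)
  note carr = rep_affine_space_carrier[OF x']
  show "x e' *\<^sub>v arrow_sum Q d x v c = 0\<^sub>v (d (head Q e'))"
  proof (rule eq_vecI)
    fix i assume "i < dim_vec (0\<^sub>v (d (head Q e')))"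
    then have i: "i < d (head Q e')" by simp
    let ?A = "{e \<in> arcs Q. head Q e = v}"
    have "(x e' *\<^sub>v arrow_sum Q d x v c) $ i = (\<Sum>k<d v. x e' $$ (i, k) * (\<Sum>e\<in>?A. (x e *\<^sub>v c e) $ k))"
      using carr[OF e'(1)] e' i
      by (auto simp: arrow_sum_def scalar_prod_def lessThan_atLeast0 intro!: sum.cong)
    also have "\<dots> = (\<Sum>e\<in>?A. \<Sum>k<d v. x e' $$ (i, k) * (x e *\<^sub>v c e) $ k)"
      by (simp add: sum_distrib_left) (rule sum.swap)
    also have "\<dots> = (\<Sum>e\<in>?A. (x e' *\<^sub>v (x e *\<^sub>v c e)) $ i)"
    proof (rule sum.cong)
      fix e assume e: "e \<in> ?A"
      show "(\<Sum>k<d v. x e' $$ (i, k) * (x e *\<^sub>v c e) $ k) = (x e' *\<^sub>v (x e *\<^sub>v c e)) $ i"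
        using carr[OF e'(1)] carr[of e] e e' i
        by (auto simp: scalar_prod_def lessThan_atLeast0 intro!: sum.cong)
    qed simp
    also have "\<dots> = 0"
    proof (rule sum.neutral, intro ballI)
      fix e assume e: "e \<in> ?A"
      have "x e' *\<^sub>v (x e *\<^sub>v c e) = (x e' * x e) *\<^sub>v c e"
        using carr[OF e'(1)] carr[of e] c[of e] e e' by (intro assoc_mult_mat_vec[symmetric]) auto
      also have "x e' * x e = 0\<^sub>m (d (head Q e')) (d (tail Q e))"
        using x e e' by (simp add: square_zero_rep_def)
      finally show "(x e' *\<^sub>v (x e *\<^sub>v c e)) $ i = 0" using i c[of e] e by (simp add: scalar_prod_def)
    qed
    finally show "(x e' *\<^sub>v arrow_sum Q d x v c) $ i = 0\<^sub>v (d (head Q e')) $ i" using i by simp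
  qed (use carr[OF e'(1)] in auto)
qed simp

section \<open>The action of paths when consecutive arrows compose to zero\<close>

context wf_digraph
begin

lemma path_mat_carrier:
  fixes x :: "'b \<Rightarrow> 'k :: field mat"
  assumes x: "x \<in> rep_affine_space G d"
  shows "is_path G (u, p) \<Longrightarrow> path_mat G d x (u, p) \<in> carrier_mat (d (path_end G (u, p))) (d u)"
proof (induction p arbitrary: u)
  case (Cons e p)
  then show ?case using rep_affine_space_carrier[OF x, of e] by (auto intro!: mult_carrier_mat)
qed simp

text \<open>The first two arrows stand rightmost in the matrix product, and their product is already
  zero.\<close>

lemma path_mat_long:
  fixes x :: "'b \<Rightarrow> 'k :: field mat"
  assumes x: "square_zero_rep G d x" and p: "is_path G (u, p)" "2 \<le> length p"
  shows "path_mat G d x (u, p) = 0\<^sub>m (d (path_end G (u, p))) (d u)"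
proof -
  have x': "x \<in> rep_affine_space G d" using x by (simp add: square_zero_rep_def)
  note carr = rep_affine_space_carrier[OF x']
  obtain e e' p' where [simp]: "p = e # e' # p'" using p(2) by (metis Suc_le_length_iff numeral_2_eq_2)
  have arcs: "e \<in> arcs G" "e' \<in> arcs G" "tail G e = u" "tail G e' = head G e" "is_path G (head G e', p')"
    using p by auto
  have "path_mat G d x (u, p) = path_mat G d x (head G e', p') * (x e' * x e)"
    using path_mat_carrier[OF x' arcs(5)] carr[OF arcs(1)] carr[OF arcs(2)] arcs
    by (simp add: assoc_mult_mat[of _ _ "d (head G e')" _ "d (tail G e')"])
  also have "x e' * x e = 0\<^sub>m (d (head G e')) (d (tail G e))"
    using x arcs by (simp add: square_zero_rep_def)
  finally show ?thesis using path_mat_carrier[OF x' arcs(5)] arcs by simp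
qed

end

text \<open>Only paths of length 0 and 1 act, so an element enters only through its coefficients at
  trivial paths and arrows. Every later computation in a module starts from this formula.\<close>

lemma (in fin_digraph) path_algebra_act_square_zero:
  fixes x :: "'b \<Rightarrow> 'k :: field mat"
  assumes x: "square_zero_rep G d x" and r: "r \<in> carrier (path_algebra G)" and m: "m \<in> rep_vectors G d"
  shows "path_algebra_act G d x r m = (\<lambda>v\<in>verts G. r (v, []) \<cdot>\<^sub>v m v +
    arrow_sum G d x v (\<lambda>e. r (tail G e, [e]) \<cdot>\<^sub>v m (tail G e)))"
  unfolding path_algebra_act_def
proof (intro restrict_ext)
  fix v assume v: "v \<in> verts G"
  have x': "x \<in> rep_affine_space G d" using x by (simp add: square_zero_rep_def)
  note carr = rep_affine_space_carrier[OF x']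
  have mv: "m u \<in> carrier_vec (d u)" if "u \<in> verts G" for u using m that by (auto simp: rep_vectors_def)
  let ?A = "{e \<in> arcs G. head G e = v}"
  let ?a = "\<lambda>e. (tail G e, [e])"
  let ?S = "insert (v, []) (?a ` ?A)"
  have fin: "finite ?A" using finite_arcs by simp
  show "vec (d v) (\<lambda>i. \<Sum>q | r q \<noteq> 0 \<and> path_end G q = v. r q * (path_mat G d x q *\<^sub>v m (fst q)) $ i) =
    r (v, []) \<cdot>\<^sub>v m v + arrow_sum G d x v (\<lambda>e. r (?a e) \<cdot>\<^sub>v m (tail G e))" (is "vec _ ?f = ?rhs")
  proof (rule eq_vecI)
    fix i assume "i < dim_vec ?rhs"
    then have i: "i < d v" by (simp add: arrow_sum_def)
    let ?g = "\<lambda>q. r q * (path_mat G d x q *\<^sub>v m (fst q)) $ i"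
    \<comment> \<open>The index sets differ in both directions: outside \<open>?S\<close> the paths
      have length at least 2 and act as zero, while elements of \<open>?S\<close> outside the other
      set have coefficient zero.\<close>
    have "?f i = sum ?g ?S"
    proof (rule sum.mono_neutral_cong)
      show "finite {q. r q \<noteq> 0 \<and> path_end G q = v}" using r by (auto simp: path_algebra_simps)
      show "finite ?S" using fin by simp
      fix q assume "q \<in> ?S - {q. r q \<noteq> 0 \<and> path_end G q = v}"
      then show "?g q = 0" by auto
    next
      fix q assume q: "q \<in> {q. r q \<noteq> 0 \<and> path_end G q = v} - ?S"
      obtain u p where [simp]: "q = (u, p)" by force
      have p: "is_path G (u, p)" using q r by (auto simp: path_algebra_simps)
      have u: "u \<in> verts G" using p by (cases p) auto
      have "2 \<le> length p"
      proof (rule ccontr)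
        assume "\<not> ?thesis"
        then consider "p = []" | e where "p = [e]"
          by (metis One_nat_def Suc_1 length_0_conv length_Suc_conv less_2_cases not_less)
        then show False
        proof cases
          case 1
          then show False using q by auto
        next
          case 2
          then show False using q p by auto
        qed
      qed
      then show "?g q = 0" using path_mat_long[OF x p] q i mv[OF u] by auto
    qed auto
    also have "\<dots> = ?g (v, []) + sum ?g (?a ` ?A)"
      using fin by (intro sum.insert) auto
    also have "sum ?g (?a ` ?A) = (\<Sum>e\<in>?A. ?g (?a e))"
      by (subst sum.reindex) (auto simp: inj_on_def)
    also have "\<dots> = arrow_sum G d x v (\<lambda>e. r (?a e) \<cdot>\<^sub>v m (tail G e)) $ i"
    proof -
      have "?g (?a e) = (x e *\<^sub>v (r (?a e) \<cdot>\<^sub>v m (tail G e))) $ i" if "e \<in> ?A" for e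
      proof -
        have e: "e \<in> arcs G" "head G e = v" using that by auto
        show ?thesis using carr[OF e(1)] mv[OF tail_in_verts[OF e(1)]] e i
          by (simp add: mult_mat_vec[of _ "d v" "d (tail G e)"])
      qed
      then show ?thesis unfolding arrow_sum_def using i by simp
    qed
    also have "?g (v, []) = (r (v, []) \<cdot>\<^sub>v m v) $ i" using i mv[OF v] by simp
    finally show "vec (d v) ?f $ i = ?rhs $ i" using i mv[OF v] by simp
  qed (simp add: arrow_sum_def)
qed

section \<open>The Jacobson radical\<close>

lemma (in abelian_group) additive_subgroup_closedI:
  assumes "H \<subseteq> carrier G" "\<zero> \<in> H" "\<And>x y. x \<in> H \<Longrightarrow> y \<in> H \<Longrightarrow> x \<oplus> y \<in> H" "\<And>x. x \<in> H \<Longrightarrow> \<ominus> x \<in> H"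
  shows "additive_subgroup H G"
  using assms unfolding a_inv_def by (intro additive_subgroupI subgroup.intro) simp_all

text \<open>The \<open>N\<close>-th power of the arrow ideal, described by coefficients instead of
  generators, so that membership can be checked path by path.\<close>

definition path_filtration :: "('v, 'a) pre_digraph \<Rightarrow> nat \<Rightarrow> (('v, 'a) path \<Rightarrow> 'k :: field) set" where
  "path_filtration Q N = {r \<in> carrier (path_algebra Q). \<forall>q. length (snd q) < N \<longrightarrow> r q = 0}"

locale square_zero_quiver_algebra = fin_digraph Q for Q :: "('v, 'a) pre_digraph" +
  fixes I :: "(('v, 'a) path \<Rightarrow> 'k :: field) set"
  assumes admissible: "admissible_ideal Q I"
    and square_zero: "jacobson_radical_square_zero (bound_quiver_algebra Q I)"
begin

abbreviation KQ :: "(('v, 'a) path \<Rightarrow> 'k) ring" where "KQ \<equiv> path_algebra Q"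

abbreviation coset :: "(('v, 'a) path \<Rightarrow> 'k) \<Rightarrow> (('v, 'a) path \<Rightarrow> 'k) set" (\<open>\<pi> _\<close> [61] 60) where
  "\<pi> r \<equiv> I +>\<^bsub>KQ\<^esub> r"

abbreviation \<Lambda> :: "(('v, 'a) path \<Rightarrow> 'k) set ring" where "\<Lambda> \<equiv> bound_quiver_algebra Q I"

sublocale KQ: ideal I KQ
  using admissible by (simp add: admissible_ideal_def)

sublocale \<Lambda>: ring \<Lambda>
  by (rule KQ.quotient_is_ring)

section \<open>The filtration by path length\<close>

lemma KQ_minus: "r \<in> carrier KQ \<Longrightarrow> (\<ominus>\<^bsub>KQ\<^esub> r) q = - r q"
proof -
  assume "r \<in> carrier KQ"
  then have "r \<oplus>\<^bsub>KQ\<^esub> \<ominus>\<^bsub>KQ\<^esub> r = \<zero>\<^bsub>KQ\<^esub>" by (rule KQ.r_neg)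
  from fun_cong[OF this, of q] have "r q + (\<ominus>\<^bsub>KQ\<^esub> r) q = 0" by (simp only: path_algebra_simps(3,4))
  then show ?thesis by (simp add: eq_neg_iff_add_eq_0 add.commute)
qed

text \<open>However a path of length below \<open>i + j\<close> is cut, its initial segment is
  shorter than \<open>j\<close> or its final segment is shorter than \<open>i\<close>.\<close>

lemma path_filtration_mult:
  assumes r: "r \<in> path_filtration Q i" and s: "(s :: ('v, 'a) path \<Rightarrow> 'k) \<in> path_filtration Q j"
  shows "r \<otimes>\<^bsub>KQ\<^esub> s \<in> path_filtration Q (i + j)"
proof -
  have "(r \<otimes>\<^bsub>KQ\<^esub> s) (u, p) = 0" if "length p < i + j" for u p
    unfolding path_algebra_simps
  proof (rule sum.neutral, intro ballI)
    fix k assume k: "k \<in> {..length p}"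
    show "r (path_end Q (u, take k p), drop k p) * s (u, take k p) = 0"
    proof (cases "k < j")
      case True
      then have "s (u, take k p) = 0" using s by (simp add: path_filtration_def)
      then show ?thesis by simp
    next
      case False
      then have "length (drop k p) < i" using that k by auto
      then have "r (path_end Q (u, take k p), drop k p) = 0" using r by (simp add: path_filtration_def)
      then show ?thesis by simp
    qed
  qed
  then show ?thesis using r s by (simp add: path_filtration_def)
qed

lemma mono_elem_filtration:
  "is_path Q q \<Longrightarrow> N \<le> length (snd q) \<Longrightarrow> mono_elem q c \<in> (path_filtration Q N :: (_ \<Rightarrow> 'k) set)"
  by (auto simp: path_filtration_def) (auto simp: mono_elem_def)

lemma path_filtration_0: "path_filtration Q 0 = carrier KQ"
  by (simp add: path_filtration_def)

lemma path_filtration_ideal: "ideal (path_filtration Q N) KQ"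
proof (rule idealI)
  show "subgroup (path_filtration Q N) (add_monoid KQ)"
    by (intro additive_subgroup.a_subgroup KQ.additive_subgroup_closedI)
      (auto simp: path_filtration_def path_algebra_simps(3,4) KQ_minus)
  show "x \<otimes>\<^bsub>KQ\<^esub> a \<in> path_filtration Q N" "a \<otimes>\<^bsub>KQ\<^esub> x \<in> path_filtration Q N"
    if "a \<in> path_filtration Q N" "x \<in> carrier KQ" for a x
    using path_filtration_mult[of x 0 a N] path_filtration_mult[of a N x 0] that
    by (simp_all add: path_filtration_0)
qed (rule KQ.ring_axioms)

text \<open>A path of length at least \<open>N\<close> is a left multiple of its initial segment of
  length \<open>N\<close>, which is a generator. General elements follow by removing one monomial of
  the support at a time.\<close>

lemma path_filtration_subset_arrow_ideal_power: "path_filtration Q N \<subseteq> (arrow_ideal_power Q N :: (_ \<Rightarrow> 'k) set)"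
proof
  let ?S = "{path_elem q | q. is_path Q q \<and> length (snd q) = N} :: (_ \<Rightarrow> 'k) set"
  have sub: "?S \<subseteq> carrier KQ" by (auto simp: path_elem_eq_mono)
  interpret P: ideal "arrow_ideal_power Q N" KQ
    unfolding arrow_ideal_power_def by (rule KQ.genideal_ideal[OF sub])
  have mono: "mono_elem (u, p) c \<in> arrow_ideal_power Q N" if p: "is_path Q (u, p)" "N \<le> length p" for u p and c :: 'k
  proof -
    let ?p = "take N p" and ?p' = "drop N p"
    have path: "is_path Q (u, ?p)" "is_path Q (path_end Q (u, ?p), ?p')"
      using p(1) is_path_append[of u ?p ?p'] by simp_all
    have "mono_elem (u, ?p) 1 \<in> ?S" using path p(2) by (force simp: path_elem_eq_mono)
    then have "mono_elem (u, ?p) (1 :: 'k) \<in> arrow_ideal_power Q N"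
      unfolding arrow_ideal_power_def using KQ.genideal_self[OF sub] by blast
    then have "mono_elem (path_end Q (u, ?p), ?p') c \<otimes>\<^bsub>KQ\<^esub> mono_elem (u, ?p) 1 \<in> arrow_ideal_power Q N"
      using path by (intro P.I_l_closed) auto
    then show ?thesis by (simp add: mono_elem_mult)
  qed
  fix r :: "_ \<Rightarrow> 'k"
  assume "r \<in> path_filtration Q N"
  then show "r \<in> arrow_ideal_power Q N"
  proof (induction "card {q. r q \<noteq> 0}" arbitrary: r)
    case 0
    then have "r = \<zero>\<^bsub>KQ\<^esub>"
      by (auto simp: path_filtration_def path_algebra_simps fun_eq_iff)
    then show ?case by simp
  next
    case (Suc n)
    then have "{q. r q \<noteq> 0} \<noteq> {}" by (metis card.empty nat.distinct(1))
    then obtain u p where q: "r (u, p) \<noteq> 0" by auto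
    have fin: "finite {q. r q \<noteq> 0}" using Suc.prems by (simp add: path_filtration_def path_algebra_simps)
    define r' where "r' = r((u, p) := 0)"
    have supp: "{q. r' q \<noteq> 0} = {q. r q \<noteq> 0} - {(u, p)}" by (auto simp: r'_def)
    then have "card {q. r' q \<noteq> 0} = n" using Suc.hyps(2) q fin by (simp add: card_Diff_singleton)
    moreover have "r' \<in> path_filtration Q N"
    proof -
      have "finite {q. r' q \<noteq> 0}" using fin by (simp add: supp)
      moreover have "r' q = 0" if "r q = 0" for q using that by (simp add: r'_def)
      ultimately show ?thesis using Suc.prems unfolding path_filtration_def path_algebra_simps(1) by blast
    qed
    ultimately have "r' \<in> arrow_ideal_power Q N" using Suc.hyps(1) by simp
    moreover have "mono_elem (u, p) (r (u, p)) \<in> arrow_ideal_power Q N"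
    proof (rule mono)
      show "is_path Q (u, p)" using Suc.prems q by (auto simp: path_filtration_def path_algebra_simps)
      show "N \<le> length p" using Suc.prems q by (force simp: path_filtration_def not_less[symmetric])
    qed
    ultimately have "mono_elem (u, p) (r (u, p)) \<oplus>\<^bsub>KQ\<^esub> r' \<in> arrow_ideal_power Q N" by simp
    also have "mono_elem (u, p) (r (u, p)) \<oplus>\<^bsub>KQ\<^esub> r' = r"
      by (auto simp: fun_eq_iff path_algebra_simps mono_elem_def r'_def)
    finally show ?case .
  qed
qed

text \<open>Relations have no terms at vertices or arrows. Hence coefficients at paths of length
  below 2 are well defined on cosets, as used in \<open>coset_coeff\<close>.\<close>

lemma ideal_subset_filtration: "I \<subseteq> path_filtration Q 2"
proof -
  have "arrow_ideal_power Q 2 \<subseteq> (path_filtration Q 2 :: (_ \<Rightarrow> 'k) set)"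
    unfolding arrow_ideal_power_def
    by (rule KQ.genideal_minimal[OF path_filtration_ideal])
      (auto simp: path_elem_eq_mono mono_elem_filtration)
  then show ?thesis using admissible by (auto simp: admissible_ideal_def)
qed

text \<open>Sufficiently long paths vanish in \<Lambda>; this is the source of nilpotency in
  \<open>filtration_in_jacobson_radical\<close>.\<close>

lemma filtration_subset_ideal: "\<exists>N. path_filtration Q N \<subseteq> I"
  using admissible path_filtration_subset_arrow_ideal_power by (fastforce simp: admissible_ideal_def)

section \<open>Cosets, and the radical of the quotient algebra\<close>

lemma carrier_\<Lambda>: "C \<in> carrier \<Lambda> \<longleftrightarrow> (\<exists>r\<in>carrier KQ. C = \<pi> r)"
  by (auto simp: FactRing_def A_RCOSETS_def')

lemma coset_carrier [simp]: "r \<in> carrier KQ \<Longrightarrow> \<pi> r \<in> carrier \<Lambda>"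
  by (auto simp: carrier_\<Lambda>)

lemma coset_ops:
  assumes "r \<in> carrier KQ" "s \<in> carrier KQ"
  shows "(\<pi> r) \<oplus>\<^bsub>\<Lambda>\<^esub> (\<pi> s) = \<pi> (r \<oplus>\<^bsub>KQ\<^esub> s)"
    "(\<pi> r) \<otimes>\<^bsub>\<Lambda>\<^esub> (\<pi> s) = \<pi> (r \<otimes>\<^bsub>KQ\<^esub> s)"
  using ring_hom_add[OF KQ.rcos_ring_hom assms] ring_hom_mult[OF KQ.rcos_ring_hom assms] by simp_all

lemma zero_\<Lambda>: "\<zero>\<^bsub>\<Lambda>\<^esub> = I"
  by (simp add: FactRing_def)

lemma coset_of_mem: "i \<in> I \<Longrightarrow> \<pi> i = I"
  by (rule KQ.a_rcos_zero[OF KQ.is_ideal])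

lemma zero_in_I: "\<zero>\<^bsub>KQ\<^esub> \<in> I"
  by (rule additive_subgroup.zero_closed[OF KQ.is_additive_subgroup])

lemma coset_minus:
  assumes "r \<in> carrier KQ"
  shows "\<ominus>\<^bsub>\<Lambda>\<^esub> (\<pi> r) = \<pi> (\<ominus>\<^bsub>KQ\<^esub> r)"
  using assms by (intro \<Lambda>.minus_equality) (simp_all add: coset_ops KQ.l_neg zero_\<Lambda> coset_of_mem zero_in_I)

lemma coset_mem_carrier: "r \<in> carrier KQ \<Longrightarrow> s \<in> \<pi> r \<Longrightarrow> s \<in> carrier KQ"
  by (auto simp: a_r_coset_def')

lemma coset_coeff:
  assumes "s \<in> \<pi> r" "length (snd q) < 2"
  shows "s q = r q"
proof -
  obtain i where i: "i \<in> I" "s = i \<oplus>\<^bsub>KQ\<^esub> r" using assms(1) by (auto simp: a_r_coset_def')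
  have "i q = 0" using subsetD[OF ideal_subset_filtration i(1)] assms(2)
    by (cases q) (simp add: path_filtration_def)
  then show ?thesis by (simp add: i(2) path_algebra_simps)
qed

lemma mult_vertex_coeff: "(r \<otimes>\<^bsub>KQ\<^esub> s) (v, []) = r (v, []) * s (v, [])"
  by (simp add: path_algebra_simps)

text \<open>Taking the coefficient at the trivial path of \<open>v\<close> is a character of
  \<Lambda> with values in \<open>K\<close>, by \<open>mult_vertex_coeff\<close>. The set is its
  kernel, which has codimension one.\<close>

lemma maximal_left_ideal_vertex:
  assumes v: "v \<in> verts Q"
  shows "maximal_left_ideal {C \<in> carrier \<Lambda>. \<forall>r\<in>C. r (v, []) = 0} \<Lambda>"
    (is "maximal_left_ideal ?L _")
  unfolding maximal_left_ideal_def
proof (intro conjI allI impI)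
  have mem: "\<pi> r \<in> ?L \<longleftrightarrow> r (v, []) = 0" if "r \<in> carrier KQ" for r
  proof
    show "r (v, []) = 0" if "\<pi> r \<in> ?L"
      using that KQ.a_rcos_self[OF \<open>r \<in> carrier KQ\<close>] by blast
    assume r: "r (v, []) = 0"
    have "s (v, []) = 0" if "s \<in> \<pi> r" for s using coset_coeff[OF that, of "(v, [])"] r by simp
    then show "\<pi> r \<in> ?L" using coset_carrier[OF that] by blast
  qed
  show "left_ideal ?L \<Lambda>"
    unfolding left_ideal_def
  proof (intro conjI ballI \<Lambda>.additive_subgroup_closedI)
    show "?L \<subseteq> carrier \<Lambda>" by auto
    have "\<pi> \<zero>\<^bsub>KQ\<^esub> \<in> ?L" by (subst mem) (simp_all add: path_algebra_simps(4))
    then show "\<zero>\<^bsub>\<Lambda>\<^esub> \<in> ?L" by (simp add: zero_\<Lambda> coset_of_mem zero_in_I)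
    fix y assume y: "y \<in> ?L"
    then have "y \<in> carrier \<Lambda>" by blast
    then obtain s where s: "s \<in> carrier KQ" "y = \<pi> s" by (auto simp: carrier_\<Lambda>)
    have sv: "s (v, []) = 0" using y mem[OF s(1)] s(2) by blast
    show "\<ominus>\<^bsub>\<Lambda>\<^esub> y \<in> ?L"
      unfolding s(2) coset_minus[OF s(1)] using s sv by (subst mem) (simp_all add: KQ_minus)
    fix x
    show "x \<oplus>\<^bsub>\<Lambda>\<^esub> y \<in> ?L" if x: "x \<in> ?L"
    proof -
      have "x \<in> carrier \<Lambda>" using x by blast
      then obtain r where r: "r \<in> carrier KQ" "x = \<pi> r" by (auto simp: carrier_\<Lambda>)
      have rv: "r (v, []) = 0" using x mem[OF r(1)] r(2) by blast
      show ?thesis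
        unfolding s(2) r(2) coset_ops(1)[OF r(1) s(1)]
        using s sv r rv by (subst mem) (simp_all add: path_algebra_simps(3))
    qed
    show "x \<otimes>\<^bsub>\<Lambda>\<^esub> y \<in> ?L" if x: "x \<in> carrier \<Lambda>"
    proof -
      obtain r where r: "r \<in> carrier KQ" "x = \<pi> r" using x by (auto simp: carrier_\<Lambda>)
      show ?thesis
        unfolding s(2) r(2) coset_ops(2)[OF r(1) s(1)]
        using s sv r by (subst mem) (simp_all add: mult_vertex_coeff)
    qed
  qed
  have e: "mono_elem (v, []) c \<in> carrier KQ" for c using v by simp
  have "\<pi> mono_elem (v, []) 1 \<notin> ?L" unfolding mem[OF e] by (simp add: mono_elem_def)
  then show "?L \<noteq> carrier \<Lambda>" using coset_carrier[OF e] by blast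
  fix L' assume "left_ideal L' \<Lambda> \<and> ?L \<subseteq> L'"
  then have L': "additive_subgroup L' \<Lambda>" "\<And>a b. a \<in> carrier \<Lambda> \<Longrightarrow> b \<in> L' \<Longrightarrow> a \<otimes>\<^bsub>\<Lambda>\<^esub> b \<in> L'" "?L \<subseteq> L'"
    by (auto simp: left_ideal_def)
  interpret L': additive_subgroup L' \<Lambda> by (rule L')
  show "L' = ?L \<or> L' = carrier \<Lambda>"
  proof (rule disjCI)
    assume ne: "L' \<noteq> carrier \<Lambda>"
    have "L' \<subseteq> ?L"
    proof
      fix C assume C: "C \<in> L'"
      then have "C \<in> carrier \<Lambda>" using L'.a_subset by blast
      then obtain r where r: "r \<in> carrier KQ" "C = \<pi> r" by (auto simp: carrier_\<Lambda>)
      have "r (v, []) = 0"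
      proof (rule ccontr)
        assume nz: "r (v, []) \<noteq> 0"
        have "D \<in> L'" if D: "D \<in> carrier \<Lambda>" for D
        proof -
          obtain s where s: "s \<in> carrier KQ" "D = \<pi> s" using D by (auto simp: carrier_\<Lambda>)
          \<comment> \<open>A left multiple of \<open>r\<close> with the same coefficient at
            \<open>v\<close> as \<open>s\<close>; the difference \<open>s - t\<close> then lies in
            the kernel, hence in \<open>L'\<close>.\<close>
          define t where "t = mono_elem (v, []) (s (v, []) / r (v, [])) \<otimes>\<^bsub>KQ\<^esub> r"
          have t: "t \<in> carrier KQ" "t (v, []) = s (v, [])"
            using e r(1) nz by (simp_all add: t_def mult_vertex_coeff) (simp add: mono_elem_def)
          have tL: "\<pi> t \<in> L'"
            using L'(2)[OF coset_carrier[OF e] C] r e by (simp add: coset_ops t_def)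
          define u where "u = s \<oplus>\<^bsub>KQ\<^esub> \<ominus>\<^bsub>KQ\<^esub> t"
          have u: "u \<in> carrier KQ" "u (v, []) = 0" using s t by (simp_all add: u_def path_algebra_simps(3) KQ_minus)
          then have "\<pi> u \<in> L'" using L'(3) mem by blast
          then have "(\<pi> u) \<oplus>\<^bsub>\<Lambda>\<^esub> (\<pi> t) \<in> L'" using tL by simp
          also have "(\<pi> u) \<oplus>\<^bsub>\<Lambda>\<^esub> (\<pi> t) = D"
            using u t s by (simp add: coset_ops u_def KQ.a_assoc KQ.l_neg)
          finally show ?thesis .
        qed
        then show False using ne L'.a_subset by blast
      qed
      then show "C \<in> ?L" using r mem by blast
    qed
    then show "L' = ?L" using L'(3) by blast
  qed
qed

lemma jacobson_radical_vertex_coeff: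
  assumes "\<pi> r \<in> jacobson_radical \<Lambda>" "r \<in> carrier KQ" "v \<in> verts Q"
  shows "r (v, []) = 0"
proof -
  have "\<pi> r \<in> {C \<in> carrier \<Lambda>. \<forall>r\<in>C. r (v, []) = 0}"
    using assms(1) maximal_left_ideal_vertex[OF assms(3)] unfolding jacobson_radical_def by blast
  then show ?thesis using KQ.a_rcos_self[OF assms(2)] by blast
qed

text \<open>Left multiples of an element of the arrow ideal are nilpotent in \<Lambda>. If a maximal
  left ideal \<open>L\<close> missed the element \<open>a\<close>, then \<open>1 = l + b a\<close>
  with \<open>l\<close> in \<open>L\<close>, and nilpotency of \<open>b a\<close> would force 1 into
  \<open>L\<close>.\<close>

lemma filtration_in_jacobson_radical:
  assumes r: "r \<in> path_filtration Q 1"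
  shows "\<pi> r \<in> jacobson_radical \<Lambda>"
  unfolding jacobson_radical_def
proof (intro CollectI conjI allI impI)
  have rc: "r \<in> carrier KQ" using r by (simp add: path_filtration_def)
  then show "\<pi> r \<in> carrier \<Lambda>" by simp
  define a where "a = \<pi> r"
  have a: "a \<in> carrier \<Lambda>" using rc by (simp add: a_def)
  fix L assume "maximal_left_ideal L \<Lambda>"
  then have L: "additive_subgroup L \<Lambda>" "\<And>a b. a \<in> carrier \<Lambda> \<Longrightarrow> b \<in> L \<Longrightarrow> a \<otimes>\<^bsub>\<Lambda>\<^esub> b \<in> L"
      "L \<noteq> carrier \<Lambda>" "\<And>L'. left_ideal L' \<Lambda> \<Longrightarrow> L \<subseteq> L' \<Longrightarrow> L' = L \<or> L' = carrier \<Lambda>"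
    by (auto simp: maximal_left_ideal_def left_ideal_def)
  interpret L: additive_subgroup L \<Lambda> by (rule L)
  have Lc: "x \<in> carrier \<Lambda>" if "x \<in> L" for x using that L.a_subset by blast
  \<comment> \<open>The left ideal generated by \<open>L\<close> and \<open>a\<close>; maximality
    leaves only \<open>L\<close> and the whole ring.\<close>
  define L' where "L' = {l \<oplus>\<^bsub>\<Lambda>\<^esub> b \<otimes>\<^bsub>\<Lambda>\<^esub> a | l b. l \<in> L \<and> b \<in> carrier \<Lambda>}"
  have "left_ideal L' \<Lambda>"
    unfolding left_ideal_def
  proof (intro conjI ballI \<Lambda>.additive_subgroup_closedI)
    show "L' \<subseteq> carrier \<Lambda>" using a Lc by (auto simp: L'_def)
    show "x \<oplus>\<^bsub>\<Lambda>\<^esub> y \<in> L'" if xy: "x \<in> L'" "y \<in> L'" for x y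
    proof -
      obtain l b l' b' where *: "x = l \<oplus>\<^bsub>\<Lambda>\<^esub> b \<otimes>\<^bsub>\<Lambda>\<^esub> a" "l \<in> L" "b \<in> carrier \<Lambda>"
        "y = l' \<oplus>\<^bsub>\<Lambda>\<^esub> b' \<otimes>\<^bsub>\<Lambda>\<^esub> a" "l' \<in> L" "b' \<in> carrier \<Lambda>" using xy by (auto simp: L'_def)
      have "x \<oplus>\<^bsub>\<Lambda>\<^esub> y = (l \<oplus>\<^bsub>\<Lambda>\<^esub> l') \<oplus>\<^bsub>\<Lambda>\<^esub> (b \<oplus>\<^bsub>\<Lambda>\<^esub> b') \<otimes>\<^bsub>\<Lambda>\<^esub> a"
        using * a Lc by (simp add: \<Lambda>.l_distr \<Lambda>.a_ac)
      then show ?thesis using * by (auto simp: L'_def)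
    qed
    have "\<zero>\<^bsub>\<Lambda>\<^esub> = \<zero>\<^bsub>\<Lambda>\<^esub> \<oplus>\<^bsub>\<Lambda>\<^esub> \<zero>\<^bsub>\<Lambda>\<^esub> \<otimes>\<^bsub>\<Lambda>\<^esub> a" using a by simp
    then show "\<zero>\<^bsub>\<Lambda>\<^esub> \<in> L'" unfolding L'_def using L.zero_closed \<Lambda>.zero_closed by blast
    show "\<ominus>\<^bsub>\<Lambda>\<^esub> x \<in> L'" if x: "x \<in> L'" for x
    proof -
      obtain l b where *: "x = l \<oplus>\<^bsub>\<Lambda>\<^esub> b \<otimes>\<^bsub>\<Lambda>\<^esub> a" "l \<in> L" "b \<in> carrier \<Lambda>" using x by (auto simp: L'_def)
      have "\<ominus>\<^bsub>\<Lambda>\<^esub> x = \<ominus>\<^bsub>\<Lambda>\<^esub> l \<oplus>\<^bsub>\<Lambda>\<^esub> (\<ominus>\<^bsub>\<Lambda>\<^esub> b) \<otimes>\<^bsub>\<Lambda>\<^esub> a"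
        using * a Lc by (simp add: \<Lambda>.l_minus \<Lambda>.minus_add)
      moreover have "\<ominus>\<^bsub>\<Lambda>\<^esub> l \<in> L" "\<ominus>\<^bsub>\<Lambda>\<^esub> b \<in> carrier \<Lambda>" using * by simp_all
      ultimately show ?thesis unfolding L'_def by blast
    qed
    fix c x assume c: "c \<in> carrier \<Lambda>" and x: "x \<in> L'"
    obtain l b where *: "x = l \<oplus>\<^bsub>\<Lambda>\<^esub> b \<otimes>\<^bsub>\<Lambda>\<^esub> a" "l \<in> L" "b \<in> carrier \<Lambda>" using x by (auto simp: L'_def)
    have "c \<otimes>\<^bsub>\<Lambda>\<^esub> x = c \<otimes>\<^bsub>\<Lambda>\<^esub> l \<oplus>\<^bsub>\<Lambda>\<^esub> (c \<otimes>\<^bsub>\<Lambda>\<^esub> b) \<otimes>\<^bsub>\<Lambda>\<^esub> a"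
      using * a c Lc by (simp add: \<Lambda>.r_distr \<Lambda>.m_assoc)
    then show "c \<otimes>\<^bsub>\<Lambda>\<^esub> x \<in> L'" unfolding L'_def using * c L(2) \<Lambda>.m_closed by blast
  qed
  moreover have "L \<subseteq> L'"
  proof
    fix l assume l: "l \<in> L"
    then have "l = l \<oplus>\<^bsub>\<Lambda>\<^esub> \<zero>\<^bsub>\<Lambda>\<^esub> \<otimes>\<^bsub>\<Lambda>\<^esub> a" using a Lc by simp
    then show "l \<in> L'" unfolding L'_def using l \<Lambda>.zero_closed by blast
  qed
  ultimately consider "L' = L" | "L' = carrier \<Lambda>" using L(4) by blast
  then show "\<pi> r \<in> L"
  proof cases
    case 1
    have "a = \<zero>\<^bsub>\<Lambda>\<^esub> \<oplus>\<^bsub>\<Lambda>\<^esub> \<one>\<^bsub>\<Lambda>\<^esub> \<otimes>\<^bsub>\<Lambda>\<^esub> a" using a by simp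
    then have "a \<in> L'" unfolding L'_def using L.zero_closed \<Lambda>.one_closed by blast
    then show ?thesis using 1 by (simp add: a_def)
  next
    case 2
    then have "\<one>\<^bsub>\<Lambda>\<^esub> \<in> L'" by simp
    then obtain l b where lb: "\<one>\<^bsub>\<Lambda>\<^esub> = l \<oplus>\<^bsub>\<Lambda>\<^esub> b \<otimes>\<^bsub>\<Lambda>\<^esub> a" "l \<in> L" "b \<in> carrier \<Lambda>"
      unfolding L'_def by auto
    obtain s where s: "s \<in> carrier KQ" "b = \<pi> s" using lb(3) by (auto simp: carrier_\<Lambda>)
    define y where "y = b \<otimes>\<^bsub>\<Lambda>\<^esub> a"
    have y: "y \<in> carrier \<Lambda>" using lb a by (simp add: y_def)
    \<comment> \<open>Each factor \<open>y\<close> raises the length of the paths by at least one,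
      so a power with large exponent is represented by an element of \<open>I\<close>.\<close>
    have y_pow: "\<exists>t\<in>path_filtration Q k. y [^]\<^bsub>\<Lambda>\<^esub> k = \<pi> t" for k :: nat
    proof (induction k)
      case 0
      have "\<one>\<^bsub>\<Lambda>\<^esub> = \<pi> \<one>\<^bsub>KQ\<^esub>" by (simp add: FactRing_def)
      then show ?case unfolding path_filtration_0 by (intro bexI[of _ "\<one>\<^bsub>KQ\<^esub>"]) simp_all
    next
      case (Suc k)
      then obtain t where t: "t \<in> path_filtration Q k" "y [^]\<^bsub>\<Lambda>\<^esub> k = \<pi> t" by blast
      have sr: "s \<otimes>\<^bsub>KQ\<^esub> r \<in> path_filtration Q 1"
        using path_filtration_mult[of s 0 r 1] s r by (simp add: path_filtration_0)
      have tc: "t \<in> carrier KQ" using t(1) by (simp add: path_filtration_def)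
      have y_eq: "y = \<pi> (s \<otimes>\<^bsub>KQ\<^esub> r)" using rc s by (simp add: y_def a_def coset_ops)
      have "y [^]\<^bsub>\<Lambda>\<^esub> Suc k = y [^]\<^bsub>\<Lambda>\<^esub> k \<otimes>\<^bsub>\<Lambda>\<^esub> y" by simp
      also have "\<dots> = \<pi> (t \<otimes>\<^bsub>KQ\<^esub> (s \<otimes>\<^bsub>KQ\<^esub> r))"
        unfolding t(2) unfolding y_eq using tc rc s by (intro coset_ops) auto
      finally show ?case using path_filtration_mult[OF t(1) sr] by auto
    qed
    obtain N where N: "path_filtration Q N \<subseteq> I" using filtration_subset_ideal by blast
    have "y [^]\<^bsub>\<Lambda>\<^esub> N = \<zero>\<^bsub>\<Lambda>\<^esub>"
      using y_pow[of N] N KQ.a_rcos_zero[OF KQ.is_ideal] unfolding zero_\<Lambda> by blast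
    then have "y [^]\<^bsub>\<Lambda>\<^esub> N \<in> L" by simp
    \<comment> \<open>Multiplying \<open>1 = l + y\<close> from the left by a power of
      \<open>y\<close> brings membership in \<open>L\<close> from exponent \<open>k + 1\<close> down
      to \<open>k\<close>, and finally to exponent 0.\<close>
    moreover have "y [^]\<^bsub>\<Lambda>\<^esub> k \<in> L" if "y [^]\<^bsub>\<Lambda>\<^esub> Suc k \<in> L" for k :: nat
    proof -
      have yk: "y [^]\<^bsub>\<Lambda>\<^esub> k \<in> carrier \<Lambda>" using y by simp
      have "y [^]\<^bsub>\<Lambda>\<^esub> k = y [^]\<^bsub>\<Lambda>\<^esub> k \<otimes>\<^bsub>\<Lambda>\<^esub> (l \<oplus>\<^bsub>\<Lambda>\<^esub> y)"
        using yk lb(1) unfolding y_def by (metis \<Lambda>.r_one)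
      also have "\<dots> = y [^]\<^bsub>\<Lambda>\<^esub> k \<otimes>\<^bsub>\<Lambda>\<^esub> l \<oplus>\<^bsub>\<Lambda>\<^esub> y [^]\<^bsub>\<Lambda>\<^esub> Suc k"
        using yk y Lc[OF lb(2)] by (simp add: \<Lambda>.r_distr)
      finally show ?thesis using L(2)[OF yk lb(2)] that by (metis L.a_closed)
    qed
    ultimately have "y [^]\<^bsub>\<Lambda>\<^esub> (0 :: nat) \<in> L" by (induction N) auto
    then have "\<one>\<^bsub>\<Lambda>\<^esub> \<in> L" by simp
    then have "x \<in> L" if "x \<in> carrier \<Lambda>" for x using L(2)[OF that] that by (metis \<Lambda>.r_one)
    then have "L = carrier \<Lambda>" using L.a_subset by blast
    then show ?thesis using L(3) by blast
  qed
qed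

text \<open>Both arrows represent elements of the radical, so their product is zero in \<Lambda>.
  This is where the hypothesis on the square of the radical enters.\<close>

lemma path_length_two_in_ideal:
  assumes "e \<in> arcs Q" "e' \<in> arcs Q" "head Q e = tail Q e'"
  shows "path_elem (tail Q e, [e, e']) \<in> I"
proof -
  let ?a = "mono_elem (tail Q e, [e]) (1 :: 'k)" and ?b = "mono_elem (tail Q e', [e']) (1 :: 'k)"
  have carr: "?a \<in> carrier KQ" "?b \<in> carrier KQ" using assms by simp_all
  have "\<pi> ?a \<in> jacobson_radical \<Lambda>" "\<pi> ?b \<in> jacobson_radical \<Lambda>"
    using assms by (auto intro!: filtration_in_jacobson_radical mono_elem_filtration)
  then have "\<pi> (?b \<otimes>\<^bsub>KQ\<^esub> ?a) = I"
    using square_zero carr unfolding jacobson_radical_square_zero_def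
    by (metis coset_ops(2) zero_\<Lambda>)
  then have "?b \<otimes>\<^bsub>KQ\<^esub> ?a \<in> I" using carr by (intro KQ.rcos_const_imp_mem) auto
  also have "?b \<otimes>\<^bsub>KQ\<^esub> ?a = path_elem (tail Q e, [e, e'])"
    using mono_elem_mult[of Q "tail Q e" "[e]" "[e']" "1 :: 'k" 1] assms by (simp add: path_elem_eq_mono)
  finally show ?thesis .
qed

end

section \<open>Submodules of a representation\<close>

lemma singleton_eqI: "(\<And>y. y \<in> A \<Longrightarrow> y = z) \<Longrightarrow> z \<in> A \<Longrightarrow> A = {z}"
  by blast

lemma arrow_sum_zero:
  assumes "\<And>e. e \<in> arcs Q \<Longrightarrow> head Q e = v \<Longrightarrow> x e *\<^sub>v c e = 0\<^sub>v (d v)"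
  shows "arrow_sum Q d x v c = 0\<^sub>v (d v)"
  unfolding arrow_sum_def using assms by (intro eq_vecI) (auto intro!: sum.neutral)

lemma arrow_sum_single:
  assumes fin: "finite (arcs Q)" and e: "e \<in> arcs Q" "head Q e = v"
    and x: "x \<in> rep_affine_space Q d"
    and c: "\<And>e'. e' \<in> arcs Q \<Longrightarrow> e' \<noteq> e \<Longrightarrow> head Q e' = v \<Longrightarrow> x e' *\<^sub>v c e' = 0\<^sub>v (d v)"
  shows "arrow_sum Q d x v c = x e *\<^sub>v c e"
proof (rule eq_vecI)
  have r: "dim_row (x e) = d v" using rep_affine_space_carrier[OF x e(1)] e(2) by simp
  show "dim_vec (arrow_sum Q d x v c) = dim_vec (x e *\<^sub>v c e)" by (simp add: r)
  fix i assume "i < dim_vec (x e *\<^sub>v c e)"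
  then have i: "i < d v" by (simp add: r)
  have "(\<Sum>e' | e' \<in> arcs Q \<and> head Q e' = v. (x e' *\<^sub>v c e') $ i) = (\<Sum>e'\<in>{e}. (x e' *\<^sub>v c e') $ i)"
    using fin e c i by (intro sum.mono_neutral_right) auto
  then show "arrow_sum Q d x v c $ i = (x e *\<^sub>v c e) $ i" using i by (simp add: arrow_sum_def)
qed

lemma rep_vectors_carrier: "m \<in> rep_vectors Q d \<Longrightarrow> v \<in> verts Q \<Longrightarrow> m v \<in> carrier_vec (d v)"
  by (auto simp: rep_vectors_def)

lemma (in wf_digraph) arrow_sum_in_image:
  assumes "m \<in> rep_vectors G d"
  shows "arrow_sum G d x v (\<lambda>e. r e \<cdot>\<^sub>v m (tail G e)) \<in> arrow_image G d x v"
  using rep_vectors_carrier[OF assms tail_in_verts]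
  unfolding arrow_image_def by (intro CollectI exI conjI[OF refl]) auto

lemma (in wf_digraph) arrow_sum_coeff_zero:
  assumes x: "x \<in> rep_affine_space G d" and m: "m \<in> rep_vectors G d"
    and r: "\<And>e. e \<in> arcs G \<Longrightarrow> head G e = v \<Longrightarrow> r e = 0"
  shows "arrow_sum G d x v (\<lambda>e. r e \<cdot>\<^sub>v m (tail G e)) = 0\<^sub>v (d v)"
proof (rule arrow_sum_zero)
  fix e assume e: "e \<in> arcs G" "head G e = v"
  have "r e \<cdot>\<^sub>v m (tail G e) = 0\<^sub>v (d (tail G e))"
    using rep_vectors_carrier[OF m tail_in_verts[OF e(1)]] r[OF e] by auto
  then show "x e *\<^sub>v (r e \<cdot>\<^sub>v m (tail G e)) = 0\<^sub>v (d v)"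
    using mult_mat_zero_vec[OF rep_affine_space_carrier[OF x e(1)]] e(2) by simp
qed

lemma rep_vectors_eqI:
  "m \<in> rep_vectors Q d \<Longrightarrow> m' \<in> rep_vectors Q d \<Longrightarrow> (\<And>v. v \<in> verts Q \<Longrightarrow> m v = m' v) \<Longrightarrow> m = m'"
  unfolding rep_vectors_def by (rule PiE_ext)

lemma restrict_rep_vectors:
  "(\<And>v. v \<in> verts Q \<Longrightarrow> f v \<in> carrier_vec (d v)) \<Longrightarrow> (\<lambda>v\<in>verts Q. f v) \<in> rep_vectors Q d"
  by (auto simp: rep_vectors_def)

definition single_vec :: "('v, 'a) pre_digraph \<Rightarrow> ('v \<Rightarrow> nat) \<Rightarrow> 'v \<Rightarrow> 'k :: field vec \<Rightarrow> 'v \<Rightarrow> 'k vec" where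
  "single_vec Q d v a = (\<lambda>w\<in>verts Q. if w = v then a else 0\<^sub>v (d w))"

lemma single_vec_in [simp]: "a \<in> carrier_vec (d v) \<Longrightarrow> single_vec Q d v a \<in> rep_vectors Q d"
  unfolding single_vec_def by (intro restrict_rep_vectors) auto

lemma single_vec_apply: "w \<in> verts Q \<Longrightarrow> single_vec Q d v a w = (if w = v then a else 0\<^sub>v (d w))"
  by (simp add: single_vec_def)

lemma rep_module_simps:
  "carrier (rep_module Q d x) = rep_vectors Q d"
  "\<zero>\<^bsub>rep_module Q d x\<^esub> = (\<lambda>v\<in>verts Q. 0\<^sub>v (d v))"
  "m \<oplus>\<^bsub>rep_module Q d x\<^esub> m' = (\<lambda>v\<in>verts Q. m v + m' v)"
  by (simp_all add: rep_module_def)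

lemma rep_module_abelian_group:
  fixes x :: "'a \<Rightarrow> 'k :: field mat"
  shows "abelian_group (rep_module Q d x)"
proof (rule abelian_groupI, unfold rep_module_simps)
  show "(\<lambda>v\<in>verts Q. 0\<^sub>v (d v)) \<in> rep_vectors Q d" by (intro restrict_rep_vectors) auto
   fix m m' m'' :: "'b \<Rightarrow> 'k vec" assume m: "m \<in> rep_vectors Q d"
  have carr: "m v \<in> carrier_vec (d v)" if "v \<in> verts Q" for v using m that by (rule rep_vectors_carrier)
  show "(\<lambda>v\<in>verts Q. (\<lambda>v\<in>verts Q. 0\<^sub>v (d v)) v + m v) = m"
    using carr by (intro rep_vectors_eqI[OF _ m] restrict_rep_vectors) auto
  show "\<exists>y\<in>rep_vectors Q d. (\<lambda>v\<in>verts Q. y v + m v) = (\<lambda>v\<in>verts Q. 0\<^sub>v (d v))"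
    using carr
    by (intro bexI[of _ "\<lambda>v\<in>verts Q. - m v"] restrict_rep_vectors restrict_ext) auto
  assume m': "m' \<in> rep_vectors Q d"
  have carr': "m' v \<in> carrier_vec (d v)" if "v \<in> verts Q" for v using m' that by (rule rep_vectors_carrier)
  show "(\<lambda>v\<in>verts Q. m v + m' v) \<in> rep_vectors Q d"
    using carr carr' by (intro restrict_rep_vectors) auto
  show "(\<lambda>v\<in>verts Q. m v + m' v) = (\<lambda>v\<in>verts Q. m' v + m v)"
    using carr carr' by (intro restrict_ext comm_add_vec[of _ "d _"]) auto
  assume m'': "m'' \<in> rep_vectors Q d"
  have carr'': "m'' v \<in> carrier_vec (d v)" if "v \<in> verts Q" for v using m'' that by (rule rep_vectors_carrier)
  show "(\<lambda>v\<in>verts Q. (\<lambda>v\<in>verts Q. m v + m' v) v + m'' v) = (\<lambda>v\<in>verts Q. m v + (\<lambda>v\<in>verts Q. m' v + m'' v) v)"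
    using carr carr' carr'' by (intro restrict_ext) (simp add: assoc_add_vec[OF carr carr' carr''])
qed

context square_zero_quiver_algebra
begin

text \<open>If consecutive products vanish, a relation acts as zero, since it has no terms of length
  below 2. Conversely, each path of length 2 is itself a relation; applying it to unit vectors
  placed at its start yields the entries of the product.\<close>

lemma Rep_iff: "x \<in> Rep Q I d \<longleftrightarrow> square_zero_rep Q d x"
proof
  assume x: "square_zero_rep Q d x"
  have "path_algebra_act Q d x r m = (\<lambda>v\<in>verts Q. 0\<^sub>v (d v))" if r: "r \<in> I" and m: "m \<in> rep_vectors Q d" for r m
  proof -
    have rf: "r \<in> path_filtration Q 2" using r ideal_subset_filtration by blast
    then have rc: "r \<in> carrier KQ" by (simp add: path_filtration_def)
    have r0: "r (u, p) = 0" if "length p < 2" for u p using rf that by (simp add: path_filtration_def)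
    have x': "x \<in> rep_affine_space Q d" using x by (simp add: square_zero_rep_def)
    show ?thesis
      unfolding path_algebra_act_square_zero[OF x rc m]
    proof (intro restrict_ext)
      fix v assume v: "v \<in> verts Q"
      have "arrow_sum Q d x v (\<lambda>e. r (tail Q e, [e]) \<cdot>\<^sub>v m (tail Q e)) = 0\<^sub>v (d v)"
        by (rule arrow_sum_coeff_zero[OF x' m]) (simp add: r0)
      then show "r (v, []) \<cdot>\<^sub>v m v + arrow_sum Q d x v (\<lambda>e. r (tail Q e, [e]) \<cdot>\<^sub>v m (tail Q e)) = 0\<^sub>v (d v)"
        using rep_vectors_carrier[OF m v] by (auto simp: r0)
    qed
  qed
  then show "x \<in> Rep Q I d" using x by (simp add: Rep_def square_zero_rep_def)
next
  assume "x \<in> Rep Q I d"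
  then have x: "x \<in> rep_affine_space Q d"
    and act: "\<And>r m. r \<in> I \<Longrightarrow> m \<in> rep_vectors Q d \<Longrightarrow> path_algebra_act Q d x r m = (\<lambda>v\<in>verts Q. 0\<^sub>v (d v))"
    by (auto simp: Rep_def)
  note carr = rep_affine_space_carrier[OF x]
  show "square_zero_rep Q d x"
    unfolding square_zero_rep_def
  proof (intro conjI ballI impI x)
    fix e e' assume arcs': "e \<in> arcs Q" "e' \<in> arcs Q" "head Q e = tail Q e'"
    let ?q = "(tail Q e, [e, e'])"
    have xx: "x e' * x e \<in> carrier_mat (d (head Q e')) (d (tail Q e))"
      using carr[OF arcs'(1)] carr[OF arcs'(2)] arcs'(3) by auto
    show "x e' * x e = 0\<^sub>m (d (head Q e')) (d (tail Q e))"
    proof (rule eq_matI)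
      fix i j assume "i < dim_row (0\<^sub>m (d (head Q e')) (d (tail Q e)))"
        "j < dim_col (0\<^sub>m (d (head Q e')) (d (tail Q e)))"
      then have ij: "i < d (head Q e')" "j < d (tail Q e)" by auto
      define m where "m = single_vec Q d (tail Q e) (unit_vec (d (tail Q e)) j :: 'k vec)"
      have m: "m \<in> rep_vectors Q d" by (simp add: m_def)
      have mt: "m (tail Q e) = unit_vec (d (tail Q e)) j"
        using tail_in_verts[OF arcs'(1)] by (simp add: m_def single_vec_apply)
      have mat: "path_mat Q d x ?q = x e' * x e" using carr[OF arcs'(2)] by simp
      have "{q. path_elem ?q q \<noteq> (0 :: 'k) \<and> path_end Q q = head Q e'} = {?q}"
        using arcs' by (auto simp: path_elem_def)
      then have "path_algebra_act Q d x (path_elem ?q) m (head Q e') $ i = ((x e' * x e) *\<^sub>v m (tail Q e)) $ i"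
        using head_in_verts[OF arcs'(2)] ij mat
        by (simp add: path_algebra_act_def del: path_mat.simps) (simp add: path_elem_def)
      also have "\<dots> = (x e' * x e) $$ (i, j)" using carrier_matD[OF xx] ij by (simp add: mt del: index_mult_mat)
      finally show "(x e' * x e) $$ (i, j) = 0\<^sub>m (d (head Q e')) (d (tail Q e)) $$ (i, j)"
        using act[OF path_length_two_in_ideal[OF arcs'] m] head_in_verts[OF arcs'(2)] ij by simp
    qed (use xx in auto)
  qed
qed

section \<open>The action of cosets and the submodules it preserves\<close>

lemma Rep_affine: "x \<in> Rep Q I d \<Longrightarrow> x \<in> rep_affine_space Q d"
  by (simp add: Rep_def)

text \<open>The representative picked by \<open>SOME\<close> agrees with \<open>r\<close> at all
  paths of length below 2, and only these coefficients enter the action.\<close>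

lemma smult_coset:
  assumes x: "x \<in> Rep Q I d" and r: "r \<in> carrier KQ" and m: "m \<in> rep_vectors Q d"
  shows "(\<pi> r) \<odot>\<^bsub>rep_module Q d x\<^esub> m = (\<lambda>v\<in>verts Q. r (v, []) \<cdot>\<^sub>v m v +
    arrow_sum Q d x v (\<lambda>e. r (tail Q e, [e]) \<cdot>\<^sub>v m (tail Q e)))"
proof -
  define s where "s = (SOME s. s \<in> \<pi> r)"
  have s: "s \<in> \<pi> r" unfolding s_def using KQ.a_rcos_self[OF r] by (rule someI[of "\<lambda>s. s \<in> \<pi> r"])
  have coeff: "s q = r q" if "length (snd q) < 2" for q using coset_coeff[OF s that] .
  have "(\<pi> r) \<odot>\<^bsub>rep_module Q d x\<^esub> m = path_algebra_act Q d x s m"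
    by (simp add: rep_module_def s_def)
  also have "\<dots> = (\<lambda>v\<in>verts Q. s (v, []) \<cdot>\<^sub>v m v +
    arrow_sum Q d x v (\<lambda>e. s (tail Q e, [e]) \<cdot>\<^sub>v m (tail Q e)))"
    by (rule path_algebra_act_square_zero[OF _ coset_mem_carrier[OF r s] m]) (use x Rep_iff in blast)
  finally show ?thesis by (simp add: coeff)
qed

lemma smult_closed:
  assumes "x \<in> Rep Q I d" "C \<in> carrier \<Lambda>" "m \<in> rep_vectors Q d"
  shows "C \<odot>\<^bsub>rep_module Q d x\<^esub> m \<in> rep_vectors Q d"
proof -
  obtain r where "r \<in> carrier KQ" "C = \<pi> r" using assms(2) by (auto simp: carrier_\<Lambda>)
  then show ?thesis using assms rep_vectors_carrier[OF assms(3)]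
    by (auto simp: smult_coset intro!: restrict_rep_vectors)
qed

lemma vertex_coset: "v \<in> verts Q \<Longrightarrow> \<pi> mono_elem (v, []) c \<in> carrier \<Lambda>"
  by simp

text \<open>Multiples of the idempotent at \<open>v\<close> recover from the action of \<Lambda>
  both the grading by vertices and the scalars of \<open>K\<close>.\<close>

lemma smult_vertex:
  assumes x: "x \<in> Rep Q I d" and v: "v \<in> verts Q" and m: "m \<in> rep_vectors Q d"
  shows "(\<pi> mono_elem (v, []) c) \<odot>\<^bsub>rep_module Q d x\<^esub> m = single_vec Q d v (c \<cdot>\<^sub>v m v)"
  unfolding smult_coset[OF x mono_elem_carrier[OF is_path_Nil[THEN iffD2, OF v]] m] single_vec_def
proof (intro restrict_ext)
  fix w assume w: "w \<in> verts Q"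
  note mw = rep_vectors_carrier[OF m w]
  have "arrow_sum Q d x w (\<lambda>e. mono_elem (v, []) c (tail Q e, [e]) \<cdot>\<^sub>v m (tail Q e)) = 0\<^sub>v (d w)"
    by (rule arrow_sum_coeff_zero[OF Rep_affine[OF x] m]) (simp add: mono_elem_def)
  then show "mono_elem (v, []) c (w, []) \<cdot>\<^sub>v m w +
      arrow_sum Q d x w (\<lambda>e. mono_elem (v, []) c (tail Q e, [e]) \<cdot>\<^sub>v m (tail Q e)) =
      (if w = v then c \<cdot>\<^sub>v m v else 0\<^sub>v (d w))"
    using mw by (auto simp: mono_elem_def)
qed

lemma smult_arrow:
  assumes x: "x \<in> Rep Q I d" and e: "e \<in> arcs Q" and m: "m \<in> rep_vectors Q d"
  shows "(\<pi> mono_elem (tail Q e, [e]) 1) \<odot>\<^bsub>rep_module Q d x\<^esub> m =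
    single_vec Q d (head Q e) (x e *\<^sub>v m (tail Q e))"
proof -
  have carr: "mono_elem (tail Q e, [e]) 1 \<in> carrier KQ" using e by simp
  note xc = rep_affine_space_carrier[OF Rep_affine[OF x]]
  show ?thesis
    unfolding smult_coset[OF x carr m] single_vec_def
  proof (intro restrict_ext)
    fix w assume w: "w \<in> verts Q"
    note mw = rep_vectors_carrier[OF m w]
    have zero: "x e' *\<^sub>v (mono_elem (tail Q e, [e]) 1 (tail Q e', [e']) \<cdot>\<^sub>v m (tail Q e')) = 0\<^sub>v (d (head Q e'))"
      if e': "e' \<in> arcs Q" "e' \<noteq> e" for e'
    proof -
      have "mono_elem (tail Q e, [e]) 1 (tail Q e', [e']) \<cdot>\<^sub>v m (tail Q e') = 0\<^sub>v (d (tail Q e'))"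
        using rep_vectors_carrier[OF m tail_in_verts[OF e'(1)]] e'(2) by (auto simp: mono_elem_def)
      then show ?thesis using mult_mat_zero_vec[OF xc[OF e'(1)]] by simp
    qed
    have "arrow_sum Q d x w (\<lambda>e'. mono_elem (tail Q e, [e]) 1 (tail Q e', [e']) \<cdot>\<^sub>v m (tail Q e')) =
      (if w = head Q e then x e *\<^sub>v m (tail Q e) else 0\<^sub>v (d w))"
    proof (cases "w = head Q e")
      case True
      have "arrow_sum Q d x w (\<lambda>e'. mono_elem (tail Q e, [e]) 1 (tail Q e', [e']) \<cdot>\<^sub>v m (tail Q e')) =
        x e *\<^sub>v (mono_elem (tail Q e, [e]) 1 (tail Q e, [e]) \<cdot>\<^sub>v m (tail Q e))"
        by (rule arrow_sum_single) (use True e zero x Rep_affine in auto)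
      then show ?thesis using True by (simp add: mono_elem_def)
    next
      case False
      then have "arrow_sum Q d x w (\<lambda>e'. mono_elem (tail Q e, [e]) 1 (tail Q e', [e']) \<cdot>\<^sub>v m (tail Q e')) = 0\<^sub>v (d w)"
        using zero by (intro arrow_sum_zero) auto
      then show ?thesis using False by simp
    qed
    moreover have "mono_elem (tail Q e, [e]) 1 (w, []) \<cdot>\<^sub>v m w = 0\<^sub>v (d w)"
      using mw by (auto simp: mono_elem_def)
    ultimately show "mono_elem (tail Q e, [e]) 1 (w, []) \<cdot>\<^sub>v m w +
        arrow_sum Q d x w (\<lambda>e'. mono_elem (tail Q e, [e]) 1 (tail Q e', [e']) \<cdot>\<^sub>v m (tail Q e')) =
        (if w = head Q e then x e *\<^sub>v m (tail Q e) else 0\<^sub>v (d w))"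
      using xc[OF e] by (auto split: if_splits)
  qed
qed

text \<open>Closure under negatives follows from closure under the action, because negation is the
  action of an element of \<Lambda>.\<close>

lemma rep_submoduleI:
  assumes x: "x \<in> Rep Q I d" and sub: "N \<subseteq> rep_vectors Q d" and zero: "(\<lambda>v\<in>verts Q. 0\<^sub>v (d v)) \<in> N"
    and add: "\<And>m m'. m \<in> N \<Longrightarrow> m' \<in> N \<Longrightarrow> (\<lambda>v\<in>verts Q. m v + m' v) \<in> N"
    and smult: "\<And>C m. C \<in> carrier \<Lambda> \<Longrightarrow> m \<in> N \<Longrightarrow> C \<odot>\<^bsub>rep_module Q d x\<^esub> m \<in> N"
  shows "submodule N \<Lambda> (rep_module Q d x)"
proof -
  interpret M: abelian_group "rep_module Q d x" by (rule rep_module_abelian_group)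
  \<comment> \<open>The negative of the unit: minus the sum of all trivial paths.\<close>
  define s where "s = (\<lambda>(u, p :: 'a list). if u \<in> verts Q \<and> p = [] then - 1 else 0 :: 'k)"
  have "{q. s q \<noteq> 0} = (\<lambda>u. (u, [])) ` verts Q" by (auto simp: s_def split: if_splits)
  then have s: "s \<in> carrier KQ"
  proof -
    have "is_path Q q" if "s q \<noteq> 0" for q using that by (cases q) (auto simp: s_def split: if_splits)
    then show ?thesis
      unfolding path_algebra_simps \<open>{q. s q \<noteq> 0} = _\<close> using finite_verts by blast
  qed
  have neg: "\<ominus>\<^bsub>rep_module Q d x\<^esub> m = (\<pi> s) \<odot>\<^bsub>rep_module Q d x\<^esub> m" if m: "m \<in> rep_vectors Q d" for m
  proof (rule M.minus_equality)
    note carr = rep_vectors_carrier[OF m]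
    have "(\<pi> s) \<odot>\<^bsub>rep_module Q d x\<^esub> m = (\<lambda>v\<in>verts Q. - m v)"
      unfolding smult_coset[OF x s m]
    proof (intro restrict_ext)
      fix v assume v: "v \<in> verts Q"
      have "arrow_sum Q d x v (\<lambda>e. s (tail Q e, [e]) \<cdot>\<^sub>v m (tail Q e)) = 0\<^sub>v (d v)"
        by (rule arrow_sum_coeff_zero[OF Rep_affine[OF x] m]) (simp add: s_def)
      then show "s (v, []) \<cdot>\<^sub>v m v + arrow_sum Q d x v (\<lambda>e. s (tail Q e, [e]) \<cdot>\<^sub>v m (tail Q e)) = - m v"
        using v carr[OF v] by (auto simp: s_def)
    qed
    then show "(\<pi> s) \<odot>\<^bsub>rep_module Q d x\<^esub> m \<oplus>\<^bsub>rep_module Q d x\<^esub> m = \<zero>\<^bsub>rep_module Q d x\<^esub>"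
      using carr by (auto simp: rep_module_simps intro!: restrict_ext)
  qed (use m smult_closed[OF x coset_carrier[OF s]] in \<open>simp_all add: rep_module_simps\<close>)
  have "additive_subgroup N (rep_module Q d x)"
    using sub zero add smult coset_carrier[OF s] neg
    by (intro M.additive_subgroup_closedI) (auto simp: rep_module_simps)
  then show ?thesis
    using smult by (simp add: submodule_def submodule_axioms_def additive_subgroup_def)
qed

lemma rep_submoduleD:
  assumes "submodule N \<Lambda> (rep_module Q d x)"
  shows "N \<subseteq> rep_vectors Q d" "(\<lambda>v\<in>verts Q. 0\<^sub>v (d v)) \<in> N"
    "m \<in> N \<Longrightarrow> m' \<in> N \<Longrightarrow> (\<lambda>v\<in>verts Q. m v + m' v) \<in> N"
    "C \<in> carrier \<Lambda> \<Longrightarrow> m \<in> N \<Longrightarrow> C \<odot>\<^bsub>rep_module Q d x\<^esub> m \<in> N"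
proof -
  interpret N: submodule N \<Lambda> "rep_module Q d x" by (rule assms)
  show "N \<subseteq> rep_vectors Q d" using N.subset by (simp add: rep_module_simps)
  show "(\<lambda>v\<in>verts Q. 0\<^sub>v (d v)) \<in> N" using N.one_closed by (simp add: rep_module_simps)
  show "m \<in> N \<Longrightarrow> m' \<in> N \<Longrightarrow> (\<lambda>v\<in>verts Q. m v + m' v) \<in> N"
    using N.m_closed[of m m'] by (simp add: rep_module_simps)
  show "C \<in> carrier \<Lambda> \<Longrightarrow> m \<in> N \<Longrightarrow> C \<odot>\<^bsub>rep_module Q d x\<^esub> m \<in> N" by (rule N.smult_closed)
qed

text \<open>At each vertex the action is a scalar multiple of \<open>m v\<close> plus an arrow sum,
  so it is enough that the chosen subspaces absorb arrow sums. This covers both the radical and the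
  socle.\<close>

lemma graded_submodule:
  assumes x: "x \<in> Rep Q I d" and W: "\<And>v. v \<in> verts Q \<Longrightarrow> vec_subspace (d v) (W v)"
    and arrow: "\<And>r m v. m \<in> rep_vectors Q d \<Longrightarrow> (\<forall>v\<in>verts Q. m v \<in> W v) \<Longrightarrow> v \<in> verts Q \<Longrightarrow>
      arrow_sum Q d x v (\<lambda>e. r (tail Q e, [e]) \<cdot>\<^sub>v m (tail Q e)) \<in> W v"
  shows "submodule {m \<in> rep_vectors Q d. \<forall>v\<in>verts Q. m v \<in> W v} \<Lambda> (rep_module Q d x)"
proof (rule rep_submoduleI[OF x])
  show "(\<lambda>v\<in>verts Q. 0\<^sub>v (d v)) \<in> {m \<in> rep_vectors Q d. \<forall>v\<in>verts Q. m v \<in> W v}"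
    using W by (auto simp: vec_subspace_def intro: restrict_rep_vectors)
  show "(\<lambda>v\<in>verts Q. m v + m' v) \<in> {m \<in> rep_vectors Q d. \<forall>v\<in>verts Q. m v \<in> W v}"
    if "m \<in> {m \<in> rep_vectors Q d. \<forall>v\<in>verts Q. m v \<in> W v}"
      "m' \<in> {m \<in> rep_vectors Q d. \<forall>v\<in>verts Q. m v \<in> W v}" for m m'
    using that W rep_vectors_carrier[of m Q d] rep_vectors_carrier[of m' Q d]
    by (auto simp: vec_subspace_def intro!: restrict_rep_vectors)
  show "C \<odot>\<^bsub>rep_module Q d x\<^esub> m \<in> {m \<in> rep_vectors Q d. \<forall>v\<in>verts Q. m v \<in> W v}"
    if C: "C \<in> carrier \<Lambda>" and m: "m \<in> {m \<in> rep_vectors Q d. \<forall>v\<in>verts Q. m v \<in> W v}" for C m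
  proof -
    obtain r where r: "r \<in> carrier KQ" "C = \<pi> r" using C by (auto simp: carrier_\<Lambda>)
    have m': "m \<in> rep_vectors Q d" using m by simp
    have "(C \<odot>\<^bsub>rep_module Q d x\<^esub> m) v \<in> W v" if v: "v \<in> verts Q" for v
      unfolding r(2) smult_coset[OF x r(1) m']
      using W[OF v] arrow[OF m' _ v, of r] m v by (simp add: vec_subspace_def)
    then show ?thesis using smult_closed[OF x C m'] by simp
  qed
qed auto

text \<open>Arrows annihilate such vectors, so \<Lambda> acts through its quotient by the radical, a
  product of copies of \<open>K\<close>.\<close>

lemma smult_arrow_kernel:
  assumes x: "x \<in> Rep Q I d" and r: "r \<in> carrier KQ" and m: "m \<in> rep_vectors Q d"
    and ker: "\<And>v. v \<in> verts Q \<Longrightarrow> m v \<in> arrow_kernel Q d x v"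
  shows "(\<pi> r) \<odot>\<^bsub>rep_module Q d x\<^esub> m = (\<lambda>v\<in>verts Q. r (v, []) \<cdot>\<^sub>v m v)"
proof -
  have "arrow_sum Q d x v (\<lambda>e. r (tail Q e, [e]) \<cdot>\<^sub>v m (tail Q e)) = 0\<^sub>v (d v)" if "v \<in> verts Q" for v
  proof (rule arrow_sum_zero)
    fix e assume e: "e \<in> arcs Q" "head Q e = v"
    have "x e *\<^sub>v (r (tail Q e, [e]) \<cdot>\<^sub>v m (tail Q e)) = r (tail Q e, [e]) \<cdot>\<^sub>v (x e *\<^sub>v m (tail Q e))"
      using rep_affine_space_carrier[OF Rep_affine[OF x] e(1)] rep_vectors_carrier[OF m tail_in_verts[OF e(1)]]
      by (rule mult_mat_vec)
    also have "x e *\<^sub>v m (tail Q e) = 0\<^sub>v (d v)"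
      using ker[OF tail_in_verts[OF e(1)]] e by (auto simp: arrow_kernel_def)
    finally show "x e *\<^sub>v (r (tail Q e, [e]) \<cdot>\<^sub>v m (tail Q e)) = 0\<^sub>v (d v)" by auto
  qed
  then show ?thesis
    unfolding smult_coset[OF x r m] using rep_vectors_carrier[OF m] by (intro restrict_ext) auto
qed

text \<open>Elements of the radical have no coefficients at vertices, so they act by arrow sums
  alone. Conversely, arrows lie in the radical, and a vector with components in the images is a
  finite sum of vectors, each moved there by one arrow.\<close>

lemma radical_submodule_eq:
  assumes x: "x \<in> Rep Q I d"
  shows "radical_submodule \<Lambda> (rep_module Q d x) = {m \<in> rep_vectors Q d. \<forall>v\<in>verts Q. m v \<in> arrow_image Q d x v}"
    (is "_ = ?D")
proof
  note xa = Rep_affine[OF x]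
  have D: "submodule ?D \<Lambda> (rep_module Q d x)"
    by (intro graded_submodule[OF x] vec_subspace_arrow_image[OF xa] arrow_sum_in_image)
  have "{a \<odot>\<^bsub>rep_module Q d x\<^esub> m | a m. a \<in> jacobson_radical \<Lambda> \<and> m \<in> carrier (rep_module Q d x)} \<subseteq> ?D"
  proof clarify
    fix a m assume a: "a \<in> jacobson_radical \<Lambda>" and "m \<in> carrier (rep_module Q d x)"
    then have m: "m \<in> rep_vectors Q d" by (simp add: rep_module_simps)
    have ac: "a \<in> carrier \<Lambda>" using a by (simp add: jacobson_radical_def)
    then obtain r where r: "r \<in> carrier KQ" "a = \<pi> r" by (auto simp: carrier_\<Lambda>)
    have "(a \<odot>\<^bsub>rep_module Q d x\<^esub> m) v \<in> arrow_image Q d x v" if v: "v \<in> verts Q" for v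
    proof -
      have "r (v, []) = 0" using jacobson_radical_vertex_coeff[of r v] a r v by simp
      then have "(a \<odot>\<^bsub>rep_module Q d x\<^esub> m) v = arrow_sum Q d x v (\<lambda>e. r (tail Q e, [e]) \<cdot>\<^sub>v m (tail Q e))"
        unfolding r(2) smult_coset[OF x r(1) m] using v rep_vectors_carrier[OF m v] by auto
      then show ?thesis using arrow_sum_in_image[OF m] by simp
    qed
    then show "a \<odot>\<^bsub>rep_module Q d x\<^esub> m \<in> rep_vectors Q d \<and>
        (\<forall>v\<in>verts Q. (a \<odot>\<^bsub>rep_module Q d x\<^esub> m) v \<in> arrow_image Q d x v)"
      using smult_closed[OF x ac m] by blast
  qed
  then show "radical_submodule \<Lambda> (rep_module Q d x) \<subseteq> ?D"
    using D unfolding radical_submodule_def submodule_generated_def by blast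
  show "?D \<subseteq> radical_submodule \<Lambda> (rep_module Q d x)"
    unfolding radical_submodule_def submodule_generated_def
  proof (intro subsetI InterI)
    fix m N assume m: "m \<in> ?D" and "N \<in> {N. submodule N \<Lambda> (rep_module Q d x) \<and>
      {a \<odot>\<^bsub>rep_module Q d x\<^esub> m | a m. a \<in> jacobson_radical \<Lambda> \<and> m \<in> carrier (rep_module Q d x)} \<subseteq> N}"
    then have N: "submodule N \<Lambda> (rep_module Q d x)"
      and gen: "\<And>a m. a \<in> jacobson_radical \<Lambda> \<Longrightarrow> m \<in> rep_vectors Q d \<Longrightarrow> a \<odot>\<^bsub>rep_module Q d x\<^esub> m \<in> N"
      by (auto simp: rep_module_simps)
    have "\<forall>v\<in>verts Q. \<exists>c. m v = arrow_sum Q d x v c \<and>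
        (\<forall>e\<in>arcs Q. head Q e = v \<longrightarrow> c e \<in> carrier_vec (d (tail Q e)))"
      using m by (auto simp: arrow_image_def)
    then obtain c where c: "\<And>v. v \<in> verts Q \<Longrightarrow> m v = arrow_sum Q d x v (c v)"
        "\<And>v e. v \<in> verts Q \<Longrightarrow> e \<in> arcs Q \<Longrightarrow> head Q e = v \<Longrightarrow> c v e \<in> carrier_vec (d (tail Q e))"
      by metis
    \<comment> \<open>Each arrow ends in exactly one vertex, so the families chosen for the separate
      vertices glue to a single family.\<close>
    define u where "u = (\<lambda>e. c (head Q e) e)"
    have u: "u e \<in> carrier_vec (d (tail Q e))" if "e \<in> arcs Q" for e
      using c(2)[OF head_in_verts[OF that] that] by (simp add: u_def)
    \<comment> \<open>Partial sums over a set of arrows, prepared for an induction that adjoins one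
      arrow at a time.\<close>
    define s where "s = (\<lambda>F. \<lambda>v\<in>verts Q. vec (d v) (\<lambda>i. \<Sum>e | e \<in> F \<and> head Q e = v. (x e *\<^sub>v u e) $ i))"
    have "m v = s (arcs Q) v" if v: "v \<in> verts Q" for v
      unfolding c(1)[OF v] s_def arrow_sum_def using v by (auto simp: u_def intro!: eq_vecI sum.cong)
    then have "m = s (arcs Q)"
      using m by (intro rep_vectors_eqI[of m]) (auto simp: s_def intro!: restrict_rep_vectors)
    moreover have "s F \<in> N" if "finite F" "F \<subseteq> arcs Q" for F
      using that
    proof (induction F)
      case empty
      have "s {} = (\<lambda>v\<in>verts Q. 0\<^sub>v (d v))" by (auto simp: s_def intro!: restrict_ext)
      then show ?case using rep_submoduleD(2)[OF N] by (simp only:)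
    next
      case (insert e F)
      have e: "e \<in> arcs Q" using insert by simp
      note carr = rep_affine_space_carrier[OF xa e]
      have gen_arrow: "single_vec Q d (head Q e) (x e *\<^sub>v u e) \<in> N"
      proof -
        have "\<pi> mono_elem (tail Q e, [e]) 1 \<in> jacobson_radical \<Lambda>"
          using e by (intro filtration_in_jacobson_radical mono_elem_filtration) auto
        from gen[OF this single_vec_in[of "u e" d "tail Q e" Q]]
        show ?thesis
          using u[OF e] tail_in_verts[OF e] by (simp add: smult_arrow[OF x e] single_vec_apply)
      qed
      have "s (insert e F) = (\<lambda>v\<in>verts Q. s F v + single_vec Q d (head Q e) (x e *\<^sub>v u e) v)"
        unfolding s_def
      proof (intro restrict_ext eq_vecI)
        fix v i assume v: "v \<in> verts Q"
          and "i < dim_vec ((\<lambda>v\<in>verts Q. vec (d v) (\<lambda>i. \<Sum>e | e \<in> F \<and> head Q e = v. (x e *\<^sub>v u e) $ i)) v +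
            single_vec Q d (head Q e) (x e *\<^sub>v u e) v)"
        then have i: "i < d v" using carr by (auto simp: single_vec_apply split: if_splits)
        have "{e'. e' \<in> insert e F \<and> head Q e' = v} =
          (if head Q e = v then insert e {e'. e' \<in> F \<and> head Q e' = v} else {e'. e' \<in> F \<and> head Q e' = v})"
          by auto
        then show "vec (d v) (\<lambda>i. \<Sum>e' | e' \<in> insert e F \<and> head Q e' = v. (x e' *\<^sub>v u e') $ i) $ i =
          ((\<lambda>v\<in>verts Q. vec (d v) (\<lambda>i. \<Sum>e | e \<in> F \<and> head Q e = v. (x e *\<^sub>v u e) $ i)) v +
            single_vec Q d (head Q e) (x e *\<^sub>v u e) v) $ i"
          using i v insert.hyps carr by (auto simp: single_vec_apply add.commute)
      next
        fix v assume v: "v \<in> verts Q"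
        show "dim_vec (vec (d v) (\<lambda>i. \<Sum>e' | e' \<in> insert e F \<and> head Q e' = v. (x e' *\<^sub>v u e') $ i)) =
          dim_vec ((\<lambda>v\<in>verts Q. vec (d v) (\<lambda>i. \<Sum>e | e \<in> F \<and> head Q e = v. (x e *\<^sub>v u e) $ i)) v +
            single_vec Q d (head Q e) (x e *\<^sub>v u e) v)"
          using v carr by (auto simp: single_vec_apply)
      qed
      then show ?case using rep_submoduleD(3)[OF N insert.IH gen_arrow] insert.prems by (simp only: insert_subset)
    qed
    ultimately show "m \<in> N" using finite_arcs by simp
  qed
qed

text \<open>A simple submodule meets the submodule of vectors killed by arrows in zero or in itself,
  and both cases put it inside. Conversely, a vector killed by arrows is the sum of its components,
  and each nonzero component spans a simple submodule.\<close>

lemma socle_eq: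
  assumes x: "x \<in> Rep Q I d"
  shows "socle \<Lambda> (rep_module Q d x) = {m \<in> rep_vectors Q d. \<forall>v\<in>verts Q. m v \<in> arrow_kernel Q d x v}"
    (is "_ = ?S")
proof
  note xa = Rep_affine[OF x]
  have x0: "square_zero_rep Q d x" using x Rep_iff by blast
  have im: "arrow_sum Q d x v (\<lambda>e. r (tail Q e, [e]) \<cdot>\<^sub>v m (tail Q e)) \<in> arrow_kernel Q d x v"
    if "m \<in> rep_vectors Q d" for r :: "_ \<Rightarrow> 'k" and m v
    using rep_vectors_carrier[OF that tail_in_verts]
    by (intro arrow_kernel_arrow_sum[OF _ x0]) auto
  have S: "submodule ?S \<Lambda> (rep_module Q d x)"
    using im by (intro graded_submodule[OF x] vec_subspace_arrow_kernel[OF xa])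
  have "N \<subseteq> ?S" if simple: "simple_submodule N \<Lambda> (rep_module Q d x)" for N
  proof -
    have N: "submodule N \<Lambda> (rep_module Q d x)" using simple by (simp add: simple_submodule_def)
    have sub: "submodule (N \<inter> ?S) \<Lambda> (rep_module Q d x)"
    proof (rule rep_submoduleI[OF x])
      show "N \<inter> ?S \<subseteq> rep_vectors Q d" by (rule le_infI1[OF rep_submoduleD(1)[OF N]])
      show "(\<lambda>v\<in>verts Q. 0\<^sub>v (d v)) \<in> N \<inter> ?S"
        by (rule IntI[OF rep_submoduleD(2)[OF N] rep_submoduleD(2)[OF S]])
      show "(\<lambda>v\<in>verts Q. m v + m' v) \<in> N \<inter> ?S" if "m \<in> N \<inter> ?S" "m' \<in> N \<inter> ?S" for m m'
        using that by (elim IntE) (rule IntI[OF rep_submoduleD(3)[OF N] rep_submoduleD(3)[OF S]])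
      show "C \<odot>\<^bsub>rep_module Q d x\<^esub> m \<in> N \<inter> ?S" if "C \<in> carrier \<Lambda>" "m \<in> N \<inter> ?S" for C m
        using that by (elim IntE) (rule IntI[OF rep_submoduleD(4)[OF N] rep_submoduleD(4)[OF S]])
    qed
    have "\<forall>P. submodule P \<Lambda> (rep_module Q d x) \<and> P \<subseteq> N \<longrightarrow>
        P = {\<lambda>v\<in>verts Q. 0\<^sub>v (d v)} \<or> P = N"
      using simple unfolding simple_submodule_def rep_module_simps(2) by (elim conjE)
    from mp[OF spec[OF this] conjI[OF sub Int_lower1]] consider "N \<inter> ?S = N" | "N \<inter> ?S = {\<lambda>v\<in>verts Q. 0\<^sub>v (d v)}"
      by (elim disjE)
    then show ?thesis
    proof cases
      \<comment> \<open>An arrow sends \<open>m\<close> into \<open>N\<close>, and also into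
        \<open>?S\<close> because images lie in kernels. The result is therefore zero, so
        \<open>m\<close> already belongs to \<open>?S\<close>.\<close>
      case 2
      show ?thesis
      proof
        fix m assume m: "m \<in> N"
        have mr: "m \<in> rep_vectors Q d" using m rep_submoduleD(1)[OF N] by blast
        have "x e *\<^sub>v m (tail Q e) = 0\<^sub>v (d (head Q e))" if e: "e \<in> arcs Q" for e
        proof -
          let ?a = "\<pi> mono_elem (tail Q e, [e]) 1"
          have a: "mono_elem (tail Q e, [e]) 1 \<in> carrier KQ" using e by simp
          have "?a \<odot>\<^bsub>rep_module Q d x\<^esub> m \<in> N" using rep_submoduleD(4)[OF N coset_carrier[OF a] m] .
          moreover have "?a \<odot>\<^bsub>rep_module Q d x\<^esub> m \<in> ?S"
          proof (intro CollectI conjI ballI smult_closed[OF x coset_carrier[OF a] mr])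
            fix v assume v: "v \<in> verts Q"
            have "0 \<cdot>\<^sub>v m v + w = w" if "w \<in> carrier_vec (d v)" for w
              using rep_vectors_carrier[OF mr v] that by auto
            then show "(?a \<odot>\<^bsub>rep_module Q d x\<^esub> m) v \<in> arrow_kernel Q d x v"
            proof -
              have "mono_elem (tail Q e, [e]) 1 (v, []) = (0 :: 'k)" by (simp add: mono_elem_def)
              then show ?thesis
                unfolding smult_coset[OF x a mr] using v im[OF mr, of v] \<open>\<And>w. w \<in> carrier_vec (d v) \<Longrightarrow> 0 \<cdot>\<^sub>v m v + w = w\<close>
                by simp
            qed
          qed
          ultimately have "single_vec Q d (head Q e) (x e *\<^sub>v m (tail Q e)) = (\<lambda>v\<in>verts Q. 0\<^sub>v (d v))"
            using 2 unfolding smult_arrow[OF x e mr] by blast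
          from fun_cong[OF this, of "head Q e"] show ?thesis
            using head_in_verts[OF e] by (simp add: single_vec_apply)
        qed
        then show "m \<in> ?S" using mr rep_vectors_carrier[OF mr] by (auto simp: arrow_kernel_def)
      qed
    qed blast
  qed
  then show "socle \<Lambda> (rep_module Q d x) \<subseteq> ?S"
    using S unfolding socle_def submodule_generated_def by blast
  show "?S \<subseteq> socle \<Lambda> (rep_module Q d x)"
    unfolding socle_def submodule_generated_def
  proof (intro subsetI InterI)
    fix m N assume m: "m \<in> ?S" and "N \<in> {N. submodule N \<Lambda> (rep_module Q d x) \<and>
      \<Union> {N. simple_submodule N \<Lambda> (rep_module Q d x)} \<subseteq> N}"
    then have N: "submodule N \<Lambda> (rep_module Q d x)"
      and simple: "\<And>P. simple_submodule P \<Lambda> (rep_module Q d x) \<Longrightarrow> P \<subseteq> N" by auto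
    have single: "single_vec Q d v (m v) \<in> N" if v: "v \<in> verts Q" for v
    proof (cases "m v = 0\<^sub>v (d v)")
      case True
      then have "single_vec Q d v (m v) = (\<lambda>v\<in>verts Q. 0\<^sub>v (d v))" by (auto simp: single_vec_def)
      then show ?thesis using rep_submoduleD(2)[OF N] by (simp only:)
    next
      case False
      have mv: "m v \<in> carrier_vec (d v)" "m v \<in> arrow_kernel Q d x v" using m v rep_vectors_carrier by auto
      have zero_smult: "0 \<cdot>\<^sub>v m v = 0\<^sub>v (d v)" using mv(1) by (intro eq_vecI) auto
      \<comment> \<open>The line through the component of \<open>m\<close> at \<open>v\<close>. On
        it \<Lambda> acts by the coefficient at the trivial path of \<open>v\<close>, so any nonzero
        element generates it.\<close>
      define P where "P = {single_vec Q d v (c \<cdot>\<^sub>v m v) | c. True}"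
      have Pc: "single_vec Q d v (c \<cdot>\<^sub>v m v) \<in> rep_vectors Q d" for c using mv by simp
      have act: "C \<odot>\<^bsub>rep_module Q d x\<^esub> single_vec Q d v (c \<cdot>\<^sub>v m v) = single_vec Q d v ((r (v, []) * c) \<cdot>\<^sub>v m v)"
        if r: "r \<in> carrier KQ" "C = \<pi> r" for C r c
      proof -
        have "single_vec Q d v (c \<cdot>\<^sub>v m v) w \<in> arrow_kernel Q d x w" if w: "w \<in> verts Q" for w
          using vec_subspace_arrow_kernel[OF xa, of w] mv(2) w by (auto simp: single_vec_apply vec_subspace_def)
        from smult_arrow_kernel[OF x r(1) Pc this]
        have "C \<odot>\<^bsub>rep_module Q d x\<^esub> single_vec Q d v (c \<cdot>\<^sub>v m v) =
            (\<lambda>w\<in>verts Q. r (w, []) \<cdot>\<^sub>v single_vec Q d v (c \<cdot>\<^sub>v m v) w)" unfolding r(2) .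
        also have "\<dots> = single_vec Q d v ((r (v, []) * c) \<cdot>\<^sub>v m v)"
          by (subst (2) single_vec_def, intro restrict_ext) (auto simp: single_vec_apply smult_smult_assoc)
        finally show ?thesis .
      qed
      have "simple_submodule P \<Lambda> (rep_module Q d x)"
        unfolding simple_submodule_def rep_module_simps
      proof (intro conjI allI impI)
        show "submodule P \<Lambda> (rep_module Q d x)"
        proof (rule rep_submoduleI[OF x])
          show "P \<subseteq> rep_vectors Q d" using Pc by (auto simp: P_def)
          have "(\<lambda>w\<in>verts Q. 0\<^sub>v (d w)) = single_vec Q d v (0 \<cdot>\<^sub>v m v)"
            using zero_smult by (auto simp: single_vec_def intro!: restrict_ext)
          then show "(\<lambda>w\<in>verts Q. 0\<^sub>v (d w)) \<in> P" unfolding P_def by blast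
          show "(\<lambda>w\<in>verts Q. m1 w + m2 w) \<in> P" if m12: "m1 \<in> P" "m2 \<in> P" for m1 m2
          proof -
            obtain c1 c2 where *: "m1 = single_vec Q d v (c1 \<cdot>\<^sub>v m v)" "m2 = single_vec Q d v (c2 \<cdot>\<^sub>v m v)"
              using m12 unfolding P_def by blast
            have "(\<lambda>w\<in>verts Q. m1 w + m2 w) = single_vec Q d v ((c1 + c2) \<cdot>\<^sub>v m v)"
              unfolding * using mv by (auto simp: single_vec_def add_smult_distrib_vec intro!: restrict_ext)
            then show ?thesis unfolding P_def by blast
          qed
          show "C \<odot>\<^bsub>rep_module Q d x\<^esub> m1 \<in> P" if C: "C \<in> carrier \<Lambda>" and m1: "m1 \<in> P" for C m1
            using C m1 act unfolding carrier_\<Lambda> P_def by blast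
        qed
        show "P \<noteq> {\<lambda>v\<in>verts Q. 0\<^sub>v (d v)}"
        proof
          assume "P = {\<lambda>v\<in>verts Q. 0\<^sub>v (d v)}"
          then have "single_vec Q d v (1 \<cdot>\<^sub>v m v) = (\<lambda>v\<in>verts Q. 0\<^sub>v (d v))" unfolding P_def by blast
          from fun_cong[OF this, of v] show False using v False by (simp add: single_vec_apply)
        qed
        fix N' assume N': "submodule N' \<Lambda> (rep_module Q d x) \<and> N' \<subseteq> P"
        show "N' = {\<lambda>v\<in>verts Q. 0\<^sub>v (d v)} \<or> N' = P"
        proof (rule disjCI)
          assume ne: "N' \<noteq> P"
          have "c = 0" if c: "single_vec Q d v (c \<cdot>\<^sub>v m v) \<in> N'" for c
          proof (rule ccontr)
            assume nz: "c \<noteq> 0"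
            have "P \<subseteq> N'"
            proof
              fix p assume "p \<in> P"
              then obtain c' where c': "p = single_vec Q d v (c' \<cdot>\<^sub>v m v)" by (auto simp: P_def)
              let ?r = "mono_elem (v, [] :: 'a list) (c' / c)"
              have r: "?r \<in> carrier KQ" using v by simp
              have "?r (v, []) * c = c'" using nz by (simp add: mono_elem_def)
              then have "(\<pi> ?r) \<odot>\<^bsub>rep_module Q d x\<^esub> single_vec Q d v (c \<cdot>\<^sub>v m v) = p"
                using act[OF r refl, of c] c' by simp
              then show "p \<in> N'"
                using rep_submoduleD(4)[OF conjunct1[OF N'] coset_carrier[OF r] c] by simp
            qed
            then show False using ne N' by blast
          qed
          note c0 = this
          have zero: "(\<lambda>w\<in>verts Q. 0\<^sub>v (d w)) = single_vec Q d v (0 \<cdot>\<^sub>v m v)"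
            using zero_smult by (auto simp: single_vec_def intro!: restrict_ext)
          have "p = (\<lambda>v\<in>verts Q. 0\<^sub>v (d v))" if p: "p \<in> N'" for p
          proof -
            have "p \<in> P" using p N' by (elim conjE) (rule subsetD)
            then obtain c where c: "p = single_vec Q d v (c \<cdot>\<^sub>v m v)" unfolding P_def by blast
            then show ?thesis using c0[of c] p zero by simp
          qed
          moreover have "(\<lambda>v\<in>verts Q. 0\<^sub>v (d v)) \<in> N'" by (rule rep_submoduleD(2)[OF conjunct1[OF N']])
          ultimately show "N' = {\<lambda>v\<in>verts Q. 0\<^sub>v (d v)}" by (rule singleton_eqI)
        qed
      qed
      moreover have "single_vec Q d v (m v) = single_vec Q d v (1 \<cdot>\<^sub>v m v)" by simp
      ultimately show ?thesis using simple unfolding P_def by blast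
    qed
    \<comment> \<open>Truncations of \<open>m\<close> to a set of vertices, for an induction that
      adds one component at a time.\<close>
    define s where "s = (\<lambda>F. \<lambda>v\<in>verts Q. if v \<in> F then m v else 0\<^sub>v (d v))"
    have "m = s (verts Q)"
      using m rep_vectors_carrier[of m Q d]
      by (intro rep_vectors_eqI[of m]) (auto simp: s_def intro!: restrict_rep_vectors)
    moreover have "s F \<in> N" if "finite F" "F \<subseteq> verts Q" for F
      using that
    proof (induction F)
      case empty
      have "s {} = (\<lambda>v\<in>verts Q. 0\<^sub>v (d v))" by (simp add: s_def)
      then show ?case using rep_submoduleD(2)[OF N] by (simp only:)
    next
      case (insert v F)
      have "s (insert v F) = (\<lambda>w\<in>verts Q. s F w + single_vec Q d v (m v) w)"
        unfolding s_def
      proof (intro restrict_ext)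
        fix w assume w: "w \<in> verts Q"
        have "m w \<in> carrier_vec (d w)" using m w rep_vectors_carrier[of m Q d w] by simp
        then show "(if w \<in> insert v F then m w else 0\<^sub>v (d w)) =
          (\<lambda>v\<in>verts Q. if v \<in> F then m v else 0\<^sub>v (d v)) w + single_vec Q d v (m v) w"
          using w insert.hyps by (auto simp: single_vec_apply)
      qed
      then show ?case using rep_submoduleD(3)[OF N insert.IH single] insert.prems by (simp only: insert_subset)
    qed
    ultimately show "m \<in> N" using finite_verts by simp
  qed
qed

text \<open>A semisimple module equals its socle, so all its arrows act as zero. Its isomorphism
  type is therefore visible in the dimension vector.\<close>

lemma semisimple_arrow_kernel:
  assumes "semisimple_fd_module Q I T" "v \<in> verts Q" "w \<in> carrier_vec (fst T v)"
  shows "w \<in> arrow_kernel Q (fst T) (snd T) v"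
proof -
  have T: "snd T \<in> Rep Q I (fst T)"
    "socle \<Lambda> (module_of Q T) = rep_vectors Q (fst T)"
    using assms(1) by (auto simp: semisimple_fd_module_def semisimple_module_def rep_module_simps)
  have "single_vec Q (fst T) v w \<in> socle \<Lambda> (module_of Q T)" unfolding T(2) using assms(3) by simp
  then have "single_vec Q (fst T) v w v \<in> arrow_kernel Q (fst T) (snd T) v"
    unfolding socle_eq[OF T(1)] using assms(2) by blast
  then show ?thesis using assms(2) by (simp add: single_vec_apply)
qed

end

section \<open>Tops, socles and dimensions\<close>

context square_zero_quiver_algebra
begin

lemma smult_add:
  assumes x: "x \<in> Rep Q I d" and C: "C \<in> carrier \<Lambda>" and m: "m \<in> rep_vectors Q d" and m': "m' \<in> rep_vectors Q d"
  shows "C \<odot>\<^bsub>rep_module Q d x\<^esub> (m \<oplus>\<^bsub>rep_module Q d x\<^esub> m') =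
    C \<odot>\<^bsub>rep_module Q d x\<^esub> m \<oplus>\<^bsub>rep_module Q d x\<^esub> C \<odot>\<^bsub>rep_module Q d x\<^esub> m'"
proof -
  interpret M: abelian_group "rep_module Q d x" by (rule rep_module_abelian_group)
  obtain r where r: "r \<in> carrier KQ" "C = \<pi> r" using C by (auto simp: carrier_\<Lambda>)
  have mm: "m \<oplus>\<^bsub>rep_module Q d x\<^esub> m' \<in> rep_vectors Q d"
    using M.a_closed[of m m'] m m' by (simp add: rep_module_simps(1))
  note c = rep_vectors_carrier[OF m] and c' = rep_vectors_carrier[OF m']
  have eq: "(m \<oplus>\<^bsub>rep_module Q d x\<^esub> m') v = m v + m' v" if "v \<in> verts Q" for v
    using that by (simp add: rep_module_simps)
  show ?thesis
    unfolding r(2) smult_coset[OF x r(1) mm] smult_coset[OF x r(1) m] smult_coset[OF x r(1) m'] rep_module_simps(3)[of _ _ _ "restrict _ _"]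
  proof (intro restrict_ext)
    fix v assume v: "v \<in> verts Q"
    let ?s = "\<lambda>m. arrow_sum Q d x v (\<lambda>e. r (tail Q e, [e]) \<cdot>\<^sub>v m (tail Q e))"
    have "?s (m \<oplus>\<^bsub>rep_module Q d x\<^esub> m') =
      arrow_sum Q d x v (\<lambda>e. r (tail Q e, [e]) \<cdot>\<^sub>v m (tail Q e) + r (tail Q e, [e]) \<cdot>\<^sub>v m' (tail Q e))"
    proof (rule arrow_sum_cong)
      fix e assume e: "e \<in> arcs Q"
      show "r (tail Q e, [e]) \<cdot>\<^sub>v (m \<oplus>\<^bsub>rep_module Q d x\<^esub> m') (tail Q e) =
          r (tail Q e, [e]) \<cdot>\<^sub>v m (tail Q e) + r (tail Q e, [e]) \<cdot>\<^sub>v m' (tail Q e)"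
        unfolding eq[OF tail_in_verts[OF e]]
        by (rule smult_add_distrib_vec[OF c c']) (use tail_in_verts[OF e] in auto)
    qed
    also have "\<dots> = ?s m + ?s m'"
      using c[OF tail_in_verts] c'[OF tail_in_verts] by (intro arrow_sum_add Rep_affine[OF x]) auto
    finally have s: "?s (m \<oplus>\<^bsub>rep_module Q d x\<^esub> m') = ?s m + ?s m'" .
    have "r (v, []) \<cdot>\<^sub>v (m \<oplus>\<^bsub>rep_module Q d x\<^esub> m') v = r (v, []) \<cdot>\<^sub>v m v + r (v, []) \<cdot>\<^sub>v m' v"
      unfolding eq[OF v] by (rule smult_add_distrib_vec[OF c[OF v] c'[OF v]])
    then show "r (v, []) \<cdot>\<^sub>v (m \<oplus>\<^bsub>rep_module Q d x\<^esub> m') v + ?s (m \<oplus>\<^bsub>rep_module Q d x\<^esub> m') =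
        (\<lambda>v\<in>verts Q. r (v, []) \<cdot>\<^sub>v m v + arrow_sum Q d x v (\<lambda>e. r (tail Q e, [e]) \<cdot>\<^sub>v m (tail Q e))) v +
        (\<lambda>v\<in>verts Q. r (v, []) \<cdot>\<^sub>v m' v + arrow_sum Q d x v (\<lambda>e. r (tail Q e, [e]) \<cdot>\<^sub>v m' (tail Q e))) v"
      unfolding s using v c[OF v] c'[OF v]
      by (intro eq_vecI) (auto simp: add.assoc add.left_commute)
  qed
qed

text \<open>A homomorphism commutes with the idempotents, hence splits into maps between the spaces
  at each vertex. Multiples of the idempotents make these maps linear over \<open>K\<close>,
  although only compatibility with \<Lambda> is assumed.\<close>

lemma rep_hom_components:
  assumes x: "x \<in> Rep Q I d" and y: "y \<in> Rep Q I d'"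
    and F: "\<And>m. m \<in> rep_vectors Q d \<Longrightarrow> F m \<in> rep_vectors Q d'"
    and add: "\<And>m m'. m \<in> rep_vectors Q d \<Longrightarrow> m' \<in> rep_vectors Q d \<Longrightarrow>
      F (m \<oplus>\<^bsub>rep_module Q d x\<^esub> m') = F m \<oplus>\<^bsub>rep_module Q d' y\<^esub> F m'"
    and smult: "\<And>C m. C \<in> carrier \<Lambda> \<Longrightarrow> m \<in> rep_vectors Q d \<Longrightarrow>
      F (C \<odot>\<^bsub>rep_module Q d x\<^esub> m) = C \<odot>\<^bsub>rep_module Q d' y\<^esub> F m"
    and v: "v \<in> verts Q"
  defines "\<phi> \<equiv> \<lambda>a. F (single_vec Q d v a) v"
  shows "a \<in> carrier_vec (d v) \<Longrightarrow> \<phi> a \<in> carrier_vec (d' v)"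
    and "a \<in> carrier_vec (d v) \<Longrightarrow> b \<in> carrier_vec (d v) \<Longrightarrow> \<phi> (a + b) = \<phi> a + \<phi> b"
    and "a \<in> carrier_vec (d v) \<Longrightarrow> \<phi> (c \<cdot>\<^sub>v a) = c \<cdot>\<^sub>v \<phi> a"
    and "a \<in> carrier_vec (d v) \<Longrightarrow> F (single_vec Q d v a) = single_vec Q d' v (\<phi> a)"
    and "m \<in> rep_vectors Q d \<Longrightarrow> F m v = \<phi> (m v)"
proof -
  have proj: "F (single_vec Q d v (c \<cdot>\<^sub>v m v)) = single_vec Q d' v (c \<cdot>\<^sub>v F m v)" if m: "m \<in> rep_vectors Q d" for c m
    using smult[OF vertex_coset[OF v, of c] m] unfolding smult_vertex[OF x v m] smult_vertex[OF y v F[OF m]] .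
  show "\<phi> a \<in> carrier_vec (d' v)" if a: "a \<in> carrier_vec (d v)"
    unfolding \<phi>_def using rep_vectors_carrier[OF F[OF single_vec_in[of _ d v, OF a]] v] .
  show "\<phi> (a + b) = \<phi> a + \<phi> b" if a: "a \<in> carrier_vec (d v)" "b \<in> carrier_vec (d v)"
  proof -
    have "single_vec Q d v (a + b) = single_vec Q d v a \<oplus>\<^bsub>rep_module Q d x\<^esub> single_vec Q d v b"
      unfolding rep_module_simps single_vec_def using a by (intro restrict_ext) auto
    then have "\<phi> (a + b) = (F (single_vec Q d v a) \<oplus>\<^bsub>rep_module Q d' y\<^esub> F (single_vec Q d v b)) v"
      unfolding \<phi>_def using add[OF single_vec_in[of _ d v, OF a(1)] single_vec_in[of _ d v, OF a(2)]] by simp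
    then show ?thesis using v by (simp add: rep_module_simps \<phi>_def)
  qed
  show "\<phi> (c \<cdot>\<^sub>v a) = c \<cdot>\<^sub>v \<phi> a" if a: "a \<in> carrier_vec (d v)"
    using fun_cong[OF proj[OF single_vec_in[of _ d v, OF a], of c], of v] v by (simp add: single_vec_apply \<phi>_def)
  show "F (single_vec Q d v a) = single_vec Q d' v (\<phi> a)" if a: "a \<in> carrier_vec (d v)"
    using proj[OF single_vec_in[of _ d v, OF a], of 1] v by (simp add: single_vec_apply \<phi>_def)
  show "F m v = \<phi> (m v)" if m: "m \<in> rep_vectors Q d"
    using fun_cong[OF proj[OF m, of 1], of v] v by (simp add: single_vec_apply \<phi>_def)
qed

section \<open>Translating tops into dimensions\<close>

lemma radical_abelian_subgroup:
  assumes x: "x \<in> Rep Q I d"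
  shows "abelian_subgroup (radical_submodule \<Lambda> (rep_module Q d x)) (rep_module Q d x)"
proof (rule abelian_subgroupI3[OF additive_subgroupI rep_module_abelian_group])
  have "submodule (radical_submodule \<Lambda> (rep_module Q d x)) \<Lambda> (rep_module Q d x)"
    unfolding radical_submodule_eq[OF x]
    by (intro graded_submodule[OF x] vec_subspace_arrow_image[OF Rep_affine[OF x]] arrow_sum_in_image)
  then show "subgroup (radical_submodule \<Lambda> (rep_module Q d x)) (add_monoid (rep_module Q d x))"
    by (rule submodule.axioms(1))
qed

lemma radical_submodule_smult:
  assumes x: "x \<in> Rep Q I d" and C: "C \<in> carrier \<Lambda>" and n: "n \<in> radical_submodule \<Lambda> (rep_module Q d x)"
  shows "C \<odot>\<^bsub>rep_module Q d x\<^esub> n \<in> radical_submodule \<Lambda> (rep_module Q d x)"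
proof -
  obtain r where r: "r \<in> carrier KQ" "C = \<pi> r" using C by (auto simp: carrier_\<Lambda>)
  have n': "n \<in> rep_vectors Q d" using n by (simp add: radical_submodule_eq[OF x])
  have "(C \<odot>\<^bsub>rep_module Q d x\<^esub> n) v \<in> arrow_image Q d x v" if "v \<in> verts Q" for v
    unfolding r(2) smult_coset[OF x r(1) n']
    using n that vec_subspace_arrow_image[OF Rep_affine[OF x], of v] arrow_sum_in_image[OF n', of x v]
    by (simp add: radical_submodule_eq[OF x] vec_subspace_def)
  then show ?thesis using smult_closed[OF x C n'] by (simp add: radical_submodule_eq[OF x])
qed

text \<open>Scalar multiplication on the quotient is a union over all representatives; all members
  of this union coincide because the radical submodule absorbs the action.\<close>

lemma top_module_ops:
  assumes x: "x \<in> Rep Q I d" and m: "m \<in> rep_vectors Q d"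
  defines "M \<equiv> rep_module Q d x" and "N \<equiv> radical_submodule \<Lambda> (rep_module Q d x)"
  shows "m' \<in> rep_vectors Q d \<Longrightarrow>
      (N +>\<^bsub>M\<^esub> m) \<oplus>\<^bsub>top_module \<Lambda> M\<^esub> (N +>\<^bsub>M\<^esub> m') = N +>\<^bsub>M\<^esub> (m \<oplus>\<^bsub>M\<^esub> m')"
    and "C \<in> carrier \<Lambda> \<Longrightarrow> C \<odot>\<^bsub>top_module \<Lambda> M\<^esub> (N +>\<^bsub>M\<^esub> m) = N +>\<^bsub>M\<^esub> (C \<odot>\<^bsub>M\<^esub> m)"
proof -
  interpret N: abelian_subgroup N M unfolding N_def M_def by (rule radical_abelian_subgroup[OF x])
  have carr: "carrier M = rep_vectors Q d" by (simp add: M_def rep_module_simps)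
  show "(N +>\<^bsub>M\<^esub> m) \<oplus>\<^bsub>top_module \<Lambda> M\<^esub> (N +>\<^bsub>M\<^esub> m') = N +>\<^bsub>M\<^esub> (m \<oplus>\<^bsub>M\<^esub> m')" if "m' \<in> rep_vectors Q d"
    using N.a_rcos_sum[of m m'] m that by (simp add: top_module_def quotient_module_def N_def M_def carr[unfolded M_def])
  assume C: "C \<in> carrier \<Lambda>"
  have Cm: "C \<odot>\<^bsub>M\<^esub> m \<in> carrier M" using smult_closed[OF x C m] unfolding carr unfolding M_def .
  have eq: "N +>\<^bsub>M\<^esub> (C \<odot>\<^bsub>M\<^esub> m1) = N +>\<^bsub>M\<^esub> (C \<odot>\<^bsub>M\<^esub> m)" if m1: "m1 \<in> N +>\<^bsub>M\<^esub> m" for m1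
  proof -
    obtain n where n: "n \<in> N" "m1 = n \<oplus>\<^bsub>M\<^esub> m" using m1 by (auto simp: a_r_coset_def')
    have nc: "n \<in> rep_vectors Q d" using n(1) N.a_subset carr by blast
    have "C \<odot>\<^bsub>M\<^esub> m1 = C \<odot>\<^bsub>M\<^esub> n \<oplus>\<^bsub>M\<^esub> C \<odot>\<^bsub>M\<^esub> m"
      unfolding n(2) M_def by (rule smult_add[OF x C nc m])
    moreover have "C \<odot>\<^bsub>M\<^esub> n \<in> N"
      using radical_submodule_smult[OF x C] n(1) unfolding N_def M_def by blast
    ultimately have "C \<odot>\<^bsub>M\<^esub> m1 \<in> N +>\<^bsub>M\<^esub> (C \<odot>\<^bsub>M\<^esub> m)" by (auto simp: a_r_coset_def')
    then show ?thesis using N.a_repr_independence'[OF _ Cm] by simp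
  qed
  have "C \<odot>\<^bsub>top_module \<Lambda> M\<^esub> (N +>\<^bsub>M\<^esub> m) = (\<Union>m1\<in>N +>\<^bsub>M\<^esub> m. N +>\<^bsub>M\<^esub> (C \<odot>\<^bsub>M\<^esub> m1))"
    by (simp add: top_module_def quotient_module_def N_def M_def)
  also have "\<dots> = (\<Union>m1\<in>N +>\<^bsub>M\<^esub> m. N +>\<^bsub>M\<^esub> (C \<odot>\<^bsub>M\<^esub> m))" using eq by (intro SUP_cong) auto
  also have "\<dots> = N +>\<^bsub>M\<^esub> (C \<odot>\<^bsub>M\<^esub> m)" using N.a_rcos_self[of m] m carr by auto
  finally show "C \<odot>\<^bsub>top_module \<Lambda> M\<^esub> (N +>\<^bsub>M\<^esub> m) = N +>\<^bsub>M\<^esub> (C \<odot>\<^bsub>M\<^esub> m)" .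
qed

lemma top_module_carrier:
  "carrier (top_module \<Lambda> (rep_module Q d x)) =
    (\<lambda>m. radical_submodule \<Lambda> (rep_module Q d x) +>\<^bsub>rep_module Q d x\<^esub> m) ` rep_vectors Q d"
  by (auto simp: top_module_def quotient_module_def A_RCOSETS_def' rep_module_simps)

text \<open>Follow the projection onto the top by the given isomorphism. At \<open>v\<close> this is
  a surjective linear map whose kernel is the component of the radical, so rank and nullity give the
  equation.\<close>

lemma Rep_top_imp_vdim:
  assumes T: "semisimple_fd_module Q I T" and x: "x \<in> Rep_top Q I d T" and v: "v \<in> verts Q"
  shows "vdim (d v) (arrow_image Q d x v) + fst T v = d v"
proof -
  define M where "M = rep_module Q d x"
  define N where "N = radical_submodule \<Lambda> (rep_module Q d x)"
  have x': "x \<in> Rep Q I d" and iso: "module_isomorphic \<Lambda> (top_module \<Lambda> M) (module_of Q T)"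
    using x by (auto simp: Rep_top_def M_def)
  have y: "snd T \<in> Rep Q I (fst T)" using T by (simp add: semisimple_fd_module_def)
  interpret N: abelian_subgroup N M unfolding N_def M_def by (rule radical_abelian_subgroup[OF x'])
  interpret E: abelian_group "module_of Q T" by (rule rep_module_abelian_group)
  note ops = top_module_ops[OF x', folded M_def N_def]
  have carr: "carrier M = rep_vectors Q d" by (simp add: M_def rep_module_simps)
  have carrE: "carrier (module_of Q T) = rep_vectors Q (fst T)" by (simp add: rep_module_simps)
  have tcarr: "carrier (top_module \<Lambda> M) = (\<lambda>m. N +>\<^bsub>M\<^esub> m) ` rep_vectors Q d"
    unfolding M_def N_def by (rule top_module_carrier)
  obtain f where f: "bij_betw f (carrier (top_module \<Lambda> M)) (rep_vectors Q (fst T))"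
    "\<And>m m'. m \<in> carrier (top_module \<Lambda> M) \<Longrightarrow> m' \<in> carrier (top_module \<Lambda> M) \<Longrightarrow>
      f (m \<oplus>\<^bsub>top_module \<Lambda> M\<^esub> m') = f m \<oplus>\<^bsub>module_of Q T\<^esub> f m'"
    "\<And>a m. a \<in> carrier \<Lambda> \<Longrightarrow> m \<in> carrier (top_module \<Lambda> M) \<Longrightarrow>
      f (a \<odot>\<^bsub>top_module \<Lambda> M\<^esub> m) = a \<odot>\<^bsub>module_of Q T\<^esub> f m"
    using iso unfolding module_isomorphic_def carrE by blast
  define F where "F = (\<lambda>m. f (N +>\<^bsub>M\<^esub> m))"
  have F: "F m \<in> rep_vectors Q (fst T)" if "m \<in> rep_vectors Q d" for m
    unfolding F_def using bij_betwE[OF f(1)] that tcarr by blast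
  have F_add: "F (m \<oplus>\<^bsub>M\<^esub> m') = F m \<oplus>\<^bsub>module_of Q T\<^esub> F m'"
    if m: "m \<in> rep_vectors Q d" and m': "m' \<in> rep_vectors Q d" for m m'
    unfolding F_def ops(1)[OF m m', symmetric] using m m' tcarr by (intro f(2)) auto
  have F_smult: "F (C \<odot>\<^bsub>M\<^esub> m) = C \<odot>\<^bsub>module_of Q T\<^esub> F m"
    if C: "C \<in> carrier \<Lambda>" and m: "m \<in> rep_vectors Q d" for C m
    unfolding F_def ops(2)[OF m C, symmetric] using m C tcarr by (intro f(3)) auto
  have F_surj: "\<exists>m\<in>rep_vectors Q d. F m = w" if "w \<in> rep_vectors Q (fst T)" for w
  proof -
    have "w \<in> (\<lambda>m. F m) ` rep_vectors Q d"
      using f(1) that unfolding F_def bij_betw_def tcarr image_image by simp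
    then show ?thesis by blast
  qed
  have zero: "\<zero>\<^bsub>M\<^esub> \<in> rep_vectors Q d" by (simp add: M_def rep_module_simps restrict_rep_vectors)
  have "F \<zero>\<^bsub>M\<^esub> \<oplus>\<^bsub>module_of Q T\<^esub> F \<zero>\<^bsub>M\<^esub> = F \<zero>\<^bsub>M\<^esub>"
    using F_add[OF zero zero] by (simp add: N.l_zero zero carr)
  then have F0: "F \<zero>\<^bsub>M\<^esub> = \<zero>\<^bsub>module_of Q T\<^esub>"
    using E.add.l_cancel_one[of "F \<zero>\<^bsub>M\<^esub>" "F \<zero>\<^bsub>M\<^esub>"] F[OF zero] carrE by simp
  have F_kernel: "F m = \<zero>\<^bsub>module_of Q T\<^esub> \<longleftrightarrow> m \<in> N" if m: "m \<in> rep_vectors Q d" for m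
  proof -
    have coset0: "N +>\<^bsub>M\<^esub> \<zero>\<^bsub>M\<^esub> = N" using N.a_coset_add_zero[of N] N.a_subset by simp
    have "F m = F \<zero>\<^bsub>M\<^esub> \<longleftrightarrow> N +>\<^bsub>M\<^esub> m = N +>\<^bsub>M\<^esub> \<zero>\<^bsub>M\<^esub>"
      unfolding F_def using bij_betw_imp_inj_on[OF f(1)] m zero tcarr by (intro inj_on_eq_iff) auto
    also have "\<dots> \<longleftrightarrow> m \<in> N"
      unfolding coset0 using N.a_rcos_self[of m] N.a_rcos_const[of m] m carr by auto
    finally show ?thesis by (simp add: F0)
  qed
  define \<phi> where "\<phi> = (\<lambda>a. F (single_vec Q d v a) v)"
  have comp:
    "a \<in> carrier_vec (d v) \<Longrightarrow> \<phi> a \<in> carrier_vec (fst T v)"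
    "a \<in> carrier_vec (d v) \<Longrightarrow> b \<in> carrier_vec (d v) \<Longrightarrow> \<phi> (a + b) = \<phi> a + \<phi> b"
    "a \<in> carrier_vec (d v) \<Longrightarrow> \<phi> (c \<cdot>\<^sub>v a) = c \<cdot>\<^sub>v \<phi> a"
    "a \<in> carrier_vec (d v) \<Longrightarrow> F (single_vec Q d v a) = single_vec Q (fst T) v (\<phi> a)"
    "m \<in> rep_vectors Q d \<Longrightarrow> F m v = \<phi> (m v)" for a b c m
    unfolding \<phi>_def
    by (rule rep_hom_components[OF x' y _ _ _ v, where F = F, folded M_def];
        (rule F F_add F_smult)?; assumption)+
  have "{a \<in> carrier_vec (d v). \<phi> a = 0\<^sub>v (fst T v)} = arrow_image Q d x v"
  proof -
    have "\<phi> a = 0\<^sub>v (fst T v) \<longleftrightarrow> a \<in> arrow_image Q d x v" if a: "a \<in> carrier_vec (d v)" for a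
    proof -
      have "\<phi> a = 0\<^sub>v (fst T v) \<longleftrightarrow> single_vec Q (fst T) v (\<phi> a) = \<zero>\<^bsub>module_of Q T\<^esub>"
      proof
        assume "single_vec Q (fst T) v (\<phi> a) = \<zero>\<^bsub>module_of Q T\<^esub>"
        from fun_cong[OF this, of v] show "\<phi> a = 0\<^sub>v (fst T v)"
          using v by (simp add: single_vec_apply rep_module_simps)
      qed (auto simp: single_vec_def rep_module_simps)
      also have "\<dots> \<longleftrightarrow> single_vec Q d v a \<in> N"
        unfolding comp(4)[OF a, symmetric] by (rule F_kernel[OF single_vec_in[of _ d v, OF a]])
      also have "\<dots> \<longleftrightarrow> a \<in> arrow_image Q d x v"
      proof
        assume "a \<in> arrow_image Q d x v"
        then show "single_vec Q d v a \<in> N"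
          using a vec_subspace_arrow_image[OF Rep_affine[OF x']]
          by (auto simp: N_def radical_submodule_eq[OF x'] single_vec_apply vec_subspace_def)
      next
        assume "single_vec Q d v a \<in> N"
        then have "single_vec Q d v a v \<in> arrow_image Q d x v"
          using v by (simp add: N_def radical_submodule_eq[OF x'])
        then show "a \<in> arrow_image Q d x v" using v by (simp add: single_vec_apply)
      qed
      finally show ?thesis .
    qed
    moreover have "arrow_image Q d x v \<subseteq> carrier_vec (d v)"
      using vec_subspace_arrow_image[OF Rep_affine[OF x']] by (simp add: vec_subspace_def)
    ultimately show ?thesis by blast
  qed
  moreover have "vdim (d v) {a \<in> carrier_vec (d v). \<phi> a = 0\<^sub>v (fst T v)} + fst T v = d v"
  proof (rule vdim_kernel_of_surjective[OF comp(1-3)])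
    fix b :: "'k vec" assume b: "b \<in> carrier_vec (fst T v)"
    obtain m where m: "m \<in> rep_vectors Q d" "F m = single_vec Q (fst T) v b"
      using F_surj[OF single_vec_in[of _ "fst T" v, OF b]] by blast
    have "\<phi> (m v) = b" unfolding comp(5)[OF m(1), symmetric] m(2) using v by (simp add: single_vec_apply)
    then show "\<exists>w\<in>carrier_vec (d v). \<phi> w = b" using rep_vectors_carrier[OF m(1) v] by blast
  qed
  ultimately show ?thesis by simp
qed

text \<open>The equality of dimensions allows a surjection onto \<open>T\<close> with kernel the
  radical to be assembled from coordinates at each vertex. It respects the action because it kills
  arrow sums, while arrows act as zero on \<open>T\<close>.\<close>

lemma Rep_top_if_vdim:
  assumes T: "semisimple_fd_module Q I T" and x: "x \<in> Rep Q I d"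
    and dim: "\<And>v. v \<in> verts Q \<Longrightarrow> vdim (d v) (arrow_image Q d x v) + fst T v = d v"
  shows "x \<in> Rep_top Q I d T"
proof -
  define M where "M = rep_module Q d x"
  define N where "N = radical_submodule \<Lambda> (rep_module Q d x)"
  have y: "snd T \<in> Rep Q I (fst T)" using T by (simp add: semisimple_fd_module_def)
  interpret N: abelian_subgroup N M unfolding N_def M_def by (rule radical_abelian_subgroup[OF x])
  note ops = top_module_ops[OF x, folded M_def N_def]
  have carr: "carrier M = rep_vectors Q d" by (simp add: M_def rep_module_simps)
  have tcarr: "carrier (top_module \<Lambda> M) = (\<lambda>m. N +>\<^bsub>M\<^esub> m) ` rep_vectors Q d"
    unfolding M_def N_def by (rule top_module_carrier)
  define r where "r = (\<lambda>v. vdim (d v) (arrow_image Q d x v))"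
  have sub: "vec_subspace (d v) (arrow_image Q d x v)" for v
    by (rule vec_subspace_arrow_image[OF Rep_affine[OF x]])
  have "\<exists>a b. dual_system (d v) (d v) a b \<and> coord_subspace (d v) (r v) a = arrow_image Q d x v" for v
    using adapted_dual_basis[OF sub[of v] sub[of v] subset_refl] unfolding r_def by metis
  then obtain a b where ab: "\<And>v. dual_system (d v) (d v) (a v) (b v)"
    "\<And>v. coord_subspace (d v) (r v) (a v) = arrow_image Q d x v" by metis
  have ac: "a v i \<in> carrier_vec (d v)" if "i < d v" for v i using ab(1)[of v] that by (simp add: dual_system_def)
  \<comment> \<open>The last \<open>fst T v\<close> coordinates in a basis adapted to the image of
    the arrows; they vanish simultaneously exactly on that image.\<close>
  define \<phi> where "\<phi> = (\<lambda>v w. vec (fst T v) (\<lambda>i. a v (r v + i) \<bullet> w))"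
  have rd: "r v + fst T v = d v" if "v \<in> verts Q" for v using dim[OF that] by (simp add: r_def)
  have \<phi>_carr: "\<phi> v w \<in> carrier_vec (fst T v)" for v w by (simp add: \<phi>_def)
  have \<phi>_add: "\<phi> v (w + w') = \<phi> v w + \<phi> v w'"
    if "v \<in> verts Q" "w \<in> carrier_vec (d v)" "w' \<in> carrier_vec (d v)" for v w w'
    using that ac rd[OF that(1)] by (intro eq_vecI) (auto simp: \<phi>_def scalar_prod_add_distrib[of _ "d v"])
  have \<phi>_smult: "\<phi> v (c \<cdot>\<^sub>v w) = c \<cdot>\<^sub>v \<phi> v w"
    if "v \<in> verts Q" "w \<in> carrier_vec (d v)" for v w c
    using that ac rd[OF that(1)] by (intro eq_vecI) (auto simp: \<phi>_def)
  have \<phi>_kernel: "\<phi> v w = 0\<^sub>v (fst T v) \<longleftrightarrow> w \<in> arrow_image Q d x v"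
    if v: "v \<in> verts Q" and w: "w \<in> carrier_vec (d v)" for v w
  proof -
    have "\<phi> v w = 0\<^sub>v (fst T v) \<longleftrightarrow> (\<forall>i<fst T v. a v (r v + i) \<bullet> w = 0)"
      by (auto simp: \<phi>_def vec_eq_iff)
    also have "\<dots> \<longleftrightarrow> (\<forall>i\<in>{r v..<d v}. a v i \<bullet> w = 0)"
    proof (intro iffI allI impI ballI)
      fix i assume "\<forall>i<fst T v. a v (r v + i) \<bullet> w = 0" "i \<in> {r v..<d v}"
      moreover have "i - r v < fst T v" "r v + (i - r v) = i" using calculation(2) rd[OF v] by auto
      ultimately show "a v i \<bullet> w = 0" by metis
    next
      fix i assume "\<forall>i\<in>{r v..<d v}. a v i \<bullet> w = 0" "i < fst T v"
      then show "a v (r v + i) \<bullet> w = 0" using rd[OF v] by simp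
    qed
    also have "\<dots> \<longleftrightarrow> w \<in> arrow_image Q d x v"
      using w by (simp add: coord_subspace_def flip: ab(2))
    finally show ?thesis .
  qed
  define \<Phi> where "\<Phi> = (\<lambda>m. \<lambda>v\<in>verts Q. \<phi> v (m v))"
  have \<Phi>_carr: "\<Phi> m \<in> rep_vectors Q (fst T)" for m
    unfolding \<Phi>_def by (intro restrict_rep_vectors \<phi>_carr)
  have N_iff: "n \<in> N \<longleftrightarrow> n \<in> rep_vectors Q d \<and> (\<forall>v\<in>verts Q. n v \<in> arrow_image Q d x v)" for n
    by (simp add: N_def radical_submodule_eq[OF x])
  have \<Phi>_coset: "\<Phi> m1 = \<Phi> m" if m: "m \<in> rep_vectors Q d" and m1: "m1 \<in> N +>\<^bsub>M\<^esub> m" for m m1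
  proof -
    obtain n where n: "n \<in> N" "m1 = n \<oplus>\<^bsub>M\<^esub> m" using m1 by (auto simp: a_r_coset_def')
    show ?thesis unfolding \<Phi>_def
    proof (intro restrict_ext)
      fix v assume v: "v \<in> verts Q"
      have nv: "n v \<in> carrier_vec (d v)" "n v \<in> arrow_image Q d x v"
        using n(1) v rep_vectors_carrier[of n Q d v] by (auto simp: N_iff)
      have "m1 v = n v + m v" using v by (simp add: n(2) M_def rep_module_simps)
      then have "\<phi> v (m1 v) = \<phi> v (n v) + \<phi> v (m v)"
        using \<phi>_add[OF v nv(1) rep_vectors_carrier[OF m v]] by simp
      also have "\<phi> v (n v) = 0\<^sub>v (fst T v)" using \<phi>_kernel[OF v nv(1)] nv(2) by simp
      finally show "\<phi> v (m1 v) = \<phi> v (m v)" using \<phi>_carr by simp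
    qed
  qed
  define f where "f = (\<lambda>C. \<Phi> (SOME m. m \<in> C))"
  have f: "f (N +>\<^bsub>M\<^esub> m) = \<Phi> m" if m: "m \<in> rep_vectors Q d" for m
  proof -
    have "m \<in> N +>\<^bsub>M\<^esub> m" using N.a_rcos_self[of m] m carr by simp
    then have "(SOME m1. m1 \<in> N +>\<^bsub>M\<^esub> m) \<in> N +>\<^bsub>M\<^esub> m" by (rule someI[of "\<lambda>m1. m1 \<in> N +>\<^bsub>M\<^esub> m"])
    then show ?thesis unfolding f_def by (rule \<Phi>_coset[OF m])
  qed
  have "bij_betw f (carrier (top_module \<Lambda> M)) (rep_vectors Q (fst T))"
    unfolding bij_betw_def
  proof
    show "inj_on f (carrier (top_module \<Lambda> M))"
    proof (rule inj_onI)
      fix C C' assume C: "C \<in> carrier (top_module \<Lambda> M)" "C' \<in> carrier (top_module \<Lambda> M)" "f C = f C'"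
      obtain m m' where m: "m \<in> rep_vectors Q d" "C = N +>\<^bsub>M\<^esub> m" "m' \<in> rep_vectors Q d" "C' = N +>\<^bsub>M\<^esub> m'"
        using C unfolding tcarr by blast
      have eq: "\<Phi> m = \<Phi> m'" using C(3) f m by simp
      define n where "n = (\<lambda>v\<in>verts Q. m v - m' v)"
      note mc = rep_vectors_carrier[OF m(1)] rep_vectors_carrier[OF m(3)]
      have mn: "n v + m' v = m v" "n v \<in> carrier_vec (d v)" if "v \<in> verts Q" for v
        using mc[OF that] that by (auto simp: n_def)
      have "n \<in> N"
        unfolding N_iff
      proof (intro conjI ballI)
        show "n \<in> rep_vectors Q d" unfolding n_def using mc by (intro restrict_rep_vectors) auto
        fix v assume v: "v \<in> verts Q"
        have "\<phi> v (n v) + \<phi> v (m' v) = \<phi> v (m v)"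
          using \<phi>_add[OF v mn(2)[OF v] mc(2)[OF v]] mn(1)[OF v] by simp
        also have "\<dots> = \<phi> v (m' v)" using fun_cong[OF eq, of v] v by (simp add: \<Phi>_def)
        finally have "\<phi> v (n v) = 0\<^sub>v (fst T v)"
          using \<phi>_carr[of v "n v"] \<phi>_carr[of v "m' v"] by (auto simp: vec_eq_iff)
        then show "n v \<in> arrow_image Q d x v" using \<phi>_kernel[OF v mn(2)[OF v]] by simp
      qed
      moreover have "m = n \<oplus>\<^bsub>M\<^esub> m'"
        using mn m(1) by (intro rep_vectors_eqI[OF m(1)])
          (auto simp: M_def rep_module_simps intro!: restrict_rep_vectors mc)
      ultimately have "m \<in> N +>\<^bsub>M\<^esub> m'" by (auto simp: a_r_coset_def')
      then show "C = C'" unfolding m using N.a_repr_independence'[of m m'] m carr by simp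
    qed
    show "f ` carrier (top_module \<Lambda> M) = rep_vectors Q (fst T)"
    proof (intro subset_antisym subsetI)
      fix w assume "w \<in> f ` carrier (top_module \<Lambda> M)"
      then show "w \<in> rep_vectors Q (fst T)" using \<Phi>_carr unfolding f_def by blast
    next
      fix w :: "'v \<Rightarrow> 'k vec" assume w: "w \<in> rep_vectors Q (fst T)"
      \<comment> \<open>A preimage of \<open>w\<close>: its entries become the coordinates from
        number \<open>r v\<close> on, and the earlier coordinates are zero.\<close>
      define m where "m = (\<lambda>v\<in>verts Q. lin_comb (d v) (d v) (\<lambda>j. if j < r v then 0 else w v $ (j - r v)) (b v))"
      have m: "m \<in> rep_vectors Q d" unfolding m_def by (intro restrict_rep_vectors) auto
      have "\<Phi> m = w"
      proof (rule rep_vectors_eqI[OF \<Phi>_carr w])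
        fix v assume v: "v \<in> verts Q"
        have "a v (r v + i) \<bullet> m v = w v $ i" if "i < fst T v" for i
          using dual_system_coeff[OF ab(1), of "r v + i" v] rd[OF v] that v by (simp add: m_def)
        then show "\<Phi> m v = w v"
          using v rep_vectors_carrier[OF w v] by (auto simp: \<Phi>_def \<phi>_def intro!: eq_vecI)
      qed
      then have "w = f (N +>\<^bsub>M\<^esub> m)" using f[OF m] by simp
      then show "w \<in> f ` carrier (top_module \<Lambda> M)" unfolding tcarr using m by blast
    qed
  qed
  moreover have "f (C \<oplus>\<^bsub>top_module \<Lambda> M\<^esub> C') = f C \<oplus>\<^bsub>module_of Q T\<^esub> f C'"
    if C: "C \<in> carrier (top_module \<Lambda> M)" "C' \<in> carrier (top_module \<Lambda> M)" for C C'
  proof -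
    obtain m m' where m: "m \<in> rep_vectors Q d" "C = N +>\<^bsub>M\<^esub> m" "m' \<in> rep_vectors Q d" "C' = N +>\<^bsub>M\<^esub> m'"
      using C unfolding tcarr by blast
    have mm: "m \<oplus>\<^bsub>M\<^esub> m' \<in> rep_vectors Q d" using N.a_closed[of m m'] m N.abelian_group_axioms carr
      by (metis abelian_groupE(1))
    show ?thesis
      unfolding m(2,4) ops(1)[OF m(1,3)] f[OF mm] f[OF m(1)] f[OF m(3)]
      unfolding M_def rep_module_simps(3) \<Phi>_def
      using \<phi>_add rep_vectors_carrier[OF m(1)] rep_vectors_carrier[OF m(3)] by (intro restrict_ext) simp
  qed
  moreover have "f (C \<odot>\<^bsub>top_module \<Lambda> M\<^esub> D) = C \<odot>\<^bsub>module_of Q T\<^esub> f D"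
    if C: "C \<in> carrier \<Lambda>" and D: "D \<in> carrier (top_module \<Lambda> M)" for C D
  proof -
    obtain m where m: "m \<in> rep_vectors Q d" "D = N +>\<^bsub>M\<^esub> m" using D unfolding tcarr by blast
    obtain s where s: "s \<in> carrier KQ" "C = \<pi> s" using C by (auto simp: carrier_\<Lambda>)
    have Cm: "C \<odot>\<^bsub>M\<^esub> m \<in> rep_vectors Q d" unfolding M_def by (rule smult_closed[OF x C m(1)])
    have "C \<odot>\<^bsub>module_of Q T\<^esub> \<Phi> m = (\<lambda>v\<in>verts Q. s (v, []) \<cdot>\<^sub>v \<Phi> m v)"
      unfolding s(2)
      by (rule smult_arrow_kernel[OF y s(1) \<Phi>_carr])
        (use semisimple_arrow_kernel[OF T] rep_vectors_carrier[OF \<Phi>_carr] in blast)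
    also have "\<dots> = \<Phi> (C \<odot>\<^bsub>M\<^esub> m)"
      unfolding \<Phi>_def M_def s(2) smult_coset[OF x s(1) m(1)]
    proof (intro restrict_ext)
      fix v assume v: "v \<in> verts Q"
      let ?s = "arrow_sum Q d x v (\<lambda>e. s (tail Q e, [e]) \<cdot>\<^sub>v m (tail Q e))"
      have "?s \<in> arrow_image Q d x v" by (rule arrow_sum_in_image[OF m(1)])
      then have "\<phi> v ?s = 0\<^sub>v (fst T v)" using \<phi>_kernel[OF v] by simp
      then have "\<phi> v (s (v, []) \<cdot>\<^sub>v m v + ?s) = s (v, []) \<cdot>\<^sub>v \<phi> v (m v)"
        using \<phi>_add[OF v, of "s (v, []) \<cdot>\<^sub>v m v" ?s] \<phi>_smult[OF v] rep_vectors_carrier[OF m(1) v] \<phi>_carr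
        by simp
      then show "s (v, []) \<cdot>\<^sub>v (\<lambda>v\<in>verts Q. \<phi> v (m v)) v =
        \<phi> v ((\<lambda>v\<in>verts Q. s (v, []) \<cdot>\<^sub>v m v + arrow_sum Q d x v (\<lambda>e. s (tail Q e, [e]) \<cdot>\<^sub>v m (tail Q e))) v)"
        using v by simp
    qed
    finally show ?thesis unfolding m(2) ops(2)[OF m(1) C] f[OF Cm] f[OF m(1)] by simp
  qed
  ultimately have "module_isomorphic \<Lambda> (top_module \<Lambda> M) (module_of Q T)"
    unfolding module_isomorphic_def by (auto simp: rep_module_simps(1))
  then show ?thesis using x by (simp add: Rep_top_def M_def)
qed

text \<open>The inverse isomorphism embeds \<open>U\<close> into the module with image the socle.
  Its component at \<open>v\<close> is an injective linear map onto the joint kernel of the arrows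
  there.\<close>

lemma socle_iso_imp_vdim:
  assumes U: "semisimple_fd_module Q I U" and x: "x \<in> Rep Q I d"
    and iso: "module_isomorphic \<Lambda> (socle_module \<Lambda> (rep_module Q d x)) (module_of Q U)"
    and v: "v \<in> verts Q"
  shows "vdim (d v) (arrow_kernel Q d x v) = fst U v"
proof -
  define M where "M = rep_module Q d x"
  define S where "S = socle \<Lambda> (rep_module Q d x)"
  have y: "snd U \<in> Rep Q I (fst U)" using U by (simp add: semisimple_fd_module_def)
  have S_iff: "m \<in> S \<longleftrightarrow> m \<in> rep_vectors Q d \<and> (\<forall>v\<in>verts Q. m v \<in> arrow_kernel Q d x v)" for m
    by (simp add: S_def socle_eq[OF x])
  have sub: "vec_subspace (d v) (arrow_kernel Q d x v)" for v
    by (rule vec_subspace_arrow_kernel[OF Rep_affine[OF x]])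
  have S_add: "m \<oplus>\<^bsub>M\<^esub> m' \<in> S" if "m \<in> S" "m' \<in> S" for m m'
    using that sub rep_vectors_carrier[of m Q d] rep_vectors_carrier[of m' Q d]
    by (auto simp: S_iff M_def rep_module_simps vec_subspace_def intro!: restrict_rep_vectors)
  have S_smult: "C \<odot>\<^bsub>M\<^esub> m \<in> S" if C: "C \<in> carrier \<Lambda>" and m: "m \<in> S" for C m
  proof -
    obtain r where r: "r \<in> carrier KQ" "C = \<pi> r" using C by (auto simp: carrier_\<Lambda>)
    have "C \<odot>\<^bsub>M\<^esub> m = (\<lambda>v\<in>verts Q. r (v, []) \<cdot>\<^sub>v m v)"
      unfolding r(2) M_def by (rule smult_arrow_kernel[OF x r(1)]) (use m in \<open>auto simp: S_iff\<close>)
    then show ?thesis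
      using m sub rep_vectors_carrier[of m Q d]
      by (auto simp: S_iff vec_subspace_def intro!: restrict_rep_vectors)
  qed
  have ops: "carrier (socle_module \<Lambda> M) = S"
    "m \<oplus>\<^bsub>socle_module \<Lambda> M\<^esub> m' = m \<oplus>\<^bsub>M\<^esub> m'" "C \<odot>\<^bsub>socle_module \<Lambda> M\<^esub> m = C \<odot>\<^bsub>M\<^esub> m" for m m' C
    by (simp_all add: socle_module_def S_def M_def)
  obtain f where f: "bij_betw f S (rep_vectors Q (fst U))"
    "\<And>m m'. m \<in> S \<Longrightarrow> m' \<in> S \<Longrightarrow> f (m \<oplus>\<^bsub>M\<^esub> m') = f m \<oplus>\<^bsub>module_of Q U\<^esub> f m'"
    "\<And>C m. C \<in> carrier \<Lambda> \<Longrightarrow> m \<in> S \<Longrightarrow> f (C \<odot>\<^bsub>M\<^esub> m) = C \<odot>\<^bsub>module_of Q U\<^esub> f m"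
    using iso unfolding module_isomorphic_def M_def[symmetric] ops rep_module_simps(1)[of Q "fst U" "snd U"] by blast
  \<comment> \<open>Passing to the inverse makes the source a full space of representation vectors,
    as \<open>rep_hom_components\<close> requires.\<close>
  define G where "G = inv_into S f"
  have G: "G w \<in> S" "f (G w) = w" if "w \<in> rep_vectors Q (fst U)" for w
    using bij_betw_apply[OF bij_betw_inv_into[OF f(1)] that] bij_betw_inv_into_right[OF f(1) that]
    unfolding G_def by simp_all
  have Gf: "G (f m) = m" if "m \<in> S" for m
    unfolding G_def by (rule bij_betw_inv_into_left[OF f(1) that])
  have G': "G w \<in> rep_vectors Q d" if "w \<in> rep_vectors Q (fst U)" for w using G(1)[OF that] by (simp add: S_iff)
  have G_add: "G (w \<oplus>\<^bsub>module_of Q U\<^esub> w') = G w \<oplus>\<^bsub>M\<^esub> G w'"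
    if "w \<in> rep_vectors Q (fst U)" "w' \<in> rep_vectors Q (fst U)" for w w'
    using Gf[OF S_add[OF G(1)[OF that(1)] G(1)[OF that(2)]]] f(2)[OF G(1)[OF that(1)] G(1)[OF that(2)]] G(2) that
    by simp
  have G_smult: "G (C \<odot>\<^bsub>module_of Q U\<^esub> w) = C \<odot>\<^bsub>M\<^esub> G w"
    if "C \<in> carrier \<Lambda>" "w \<in> rep_vectors Q (fst U)" for C w
    using Gf[OF S_smult[OF that(1) G(1)[OF that(2)]]] f(3)[OF that(1) G(1)[OF that(2)]] G(2) that by simp
  define \<psi> where "\<psi> = (\<lambda>a. G (single_vec Q (fst U) v a) v)"
  have comp:
    "a \<in> carrier_vec (fst U v) \<Longrightarrow> \<psi> a \<in> carrier_vec (d v)"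
    "a \<in> carrier_vec (fst U v) \<Longrightarrow> b \<in> carrier_vec (fst U v) \<Longrightarrow> \<psi> (a + b) = \<psi> a + \<psi> b"
    "a \<in> carrier_vec (fst U v) \<Longrightarrow> \<psi> (c \<cdot>\<^sub>v a) = c \<cdot>\<^sub>v \<psi> a"
    "a \<in> carrier_vec (fst U v) \<Longrightarrow> G (single_vec Q (fst U) v a) = single_vec Q d v (\<psi> a)"
    "m \<in> rep_vectors Q (fst U) \<Longrightarrow> G m v = \<psi> (m v)" for a b c m
    unfolding \<psi>_def
    by (rule rep_hom_components[OF y x _ _ _ v, where F = G, folded M_def];
        (rule G' G_add G_smult)?; assumption)+
  have inj: "inj_on \<psi> (carrier_vec (fst U v))"
  proof (rule inj_onI)
    fix a b :: "'k vec" assume ab: "a \<in> carrier_vec (fst U v)" "b \<in> carrier_vec (fst U v)" "\<psi> a = \<psi> b"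
    have "G (single_vec Q (fst U) v a) = G (single_vec Q (fst U) v b)" using comp(4) ab by simp
    then have "f (G (single_vec Q (fst U) v a)) = f (G (single_vec Q (fst U) v b))" by (rule arg_cong)
    then have "single_vec Q (fst U) v a = single_vec Q (fst U) v b"
      unfolding G(2)[OF single_vec_in[of _ "fst U" v, OF ab(1)]] G(2)[OF single_vec_in[of _ "fst U" v, OF ab(2)]] .
    from fun_cong[OF this, of v] show "a = b" using v by (simp add: single_vec_apply)
  qed
  have image: "\<psi> ` carrier_vec (fst U v) = arrow_kernel Q d x v"
  proof (intro subset_antisym subsetI)
    fix w assume "w \<in> \<psi> ` carrier_vec (fst U v)"
    then show "w \<in> arrow_kernel Q d x v" using G(1)[OF single_vec_in[of _ "fst U" v]] v by (auto simp: \<psi>_def S_iff)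
  next
    fix w assume w: "w \<in> arrow_kernel Q d x v"
    then have wc: "w \<in> carrier_vec (d v)" by (simp add: arrow_kernel_def)
    have sS: "single_vec Q d v w \<in> S"
      using w wc sub by (auto simp: S_iff single_vec_apply vec_subspace_def)
    define m where "m = f (single_vec Q d v w)"
    have m: "m \<in> rep_vectors Q (fst U)" unfolding m_def using bij_betwE[OF f(1)] sS by blast
    have "G m v = w" unfolding m_def Gf[OF sS] using v by (simp add: single_vec_apply)
    then have "\<psi> (m v) = w" unfolding comp(5)[OF m] .
    then show "w \<in> \<psi> ` carrier_vec (fst U v)" using rep_vectors_carrier[OF m v] by blast
  qed
  have "vdim (d v) (\<psi> ` carrier_vec (fst U v)) = fst U v"
    by (rule vdim_image_of_injective[OF comp(1-3) inj]) (use image sub in auto)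
  then show ?thesis unfolding image .
qed

end

section \<open>Semicontinuity and the Zariski topology\<close>

lemma rep_poly_sum:
  "(\<And>i. i \<in> S \<Longrightarrow> f i \<in> rep_poly_functions Q d) \<Longrightarrow> (\<lambda>x. \<Sum>i\<in>S. f i x) \<in> rep_poly_functions Q d"
  by (induction S rule: infinite_finite_induct) (auto intro: rep_poly_functions.intros)

lemma rep_poly_prod:
  "(\<And>i. i \<in> S \<Longrightarrow> f i \<in> rep_poly_functions Q d) \<Longrightarrow> (\<lambda>x. \<Prod>i\<in>S. f i x) \<in> rep_poly_functions Q d"
  by (induction S rule: infinite_finite_induct) (auto intro: rep_poly_functions.intros)

lemma rep_poly_det:
  assumes "\<And>i j. i < k \<Longrightarrow> j < k \<Longrightarrow> f i j \<in> rep_poly_functions Q d"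
  shows "(\<lambda>x. det (mat k k (\<lambda>(i, j). f i j x))) \<in> rep_poly_functions Q d"
proof -
  have eq: "det (mat k k (\<lambda>(i, j). f i j x)) =
      (\<Sum>p\<in>{p. p permutes {0..<k}}. signof p * (\<Prod>i = 0..<k. f i (p i) x))" for x
    by (subst det_def'[of _ k]) (auto intro!: sum.cong prod.cong dest: permutes_in_image)
  show ?thesis
    unfolding eq using assms
    by (intro rep_poly_sum rep_poly_prod rep_poly_functions.mult rep_poly_functions.const)
      (auto dest: permutes_in_image)
qed

text \<open>The inverse of the matrix of pairings recombines the functionals \<open>a\<close> into
  functionals dual to \<open>b\<close>.\<close>

lemma le_vdim_of_det:
  fixes a b :: "nat \<Rightarrow> 'k :: field vec"
  assumes a: "\<And>i. i < k \<Longrightarrow> a i \<in> carrier_vec n" and b: "\<And>i. i < k \<Longrightarrow> b i \<in> carrier_vec n"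
    and W: "\<And>i. i < k \<Longrightarrow> b i \<in> W" and det: "det (mat k k (\<lambda>(i, j). a i \<bullet> b j)) \<noteq> 0"
  shows "k \<le> vdim n W"
proof -
  define M where "M = mat k k (\<lambda>(i, j). a i \<bullet> b j)"
  have M: "M \<in> carrier_mat k k" by (simp add: M_def)
  define M' where "M' = (1 / det M) \<cdot>\<^sub>m adj_mat M"
  have M': "M' \<in> carrier_mat k k" using adj_mat(1)[OF M] by (simp add: M'_def)
  have inv: "M' * M = 1\<^sub>m k"
  proof -
    have "M' * M = (1 / det M) \<cdot>\<^sub>m (det M \<cdot>\<^sub>m 1\<^sub>m k)"
      unfolding M'_def adj_mat(3)[OF M, symmetric] by (rule mult_smult_assoc_mat[OF adj_mat(1)[OF M] M])
    also have "\<dots> = 1\<^sub>m k" using det by (intro eq_matI) (auto simp: M_def)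
    finally show ?thesis .
  qed
  define a' where "a' = (\<lambda>i. lin_comb n k (\<lambda>l. M' $$ (i, l)) a)"
  have "dual_system n k a' b"
    unfolding dual_system_def
  proof (intro conjI allI impI)
    fix i j assume ij: "i < k" "j < k"
    have "a' i \<bullet> b j = b j \<bullet> a' i" using b[OF ij(2)] by (intro comm_scalar_prod[of _ n]) (auto simp: a'_def)
    also have "\<dots> = (\<Sum>l<k. M' $$ (i, l) * (b j \<bullet> a l))"
      unfolding a'_def using a b ij by (intro scalar_prod_lin_comb) auto
    also have "\<dots> = (\<Sum>l<k. M' $$ (i, l) * M $$ (l, j))"
    proof (rule sum.cong)
      fix l assume "l \<in> {..<k}"
      then show "M' $$ (i, l) * (b j \<bullet> a l) = M' $$ (i, l) * M $$ (l, j)"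
        using ij comm_scalar_prod[OF b[OF ij(2)] a[of l]] by (simp add: M_def)
    qed simp
    also have "\<dots> = (M' * M) $$ (i, j)"
      using M M' ij by (auto simp: scalar_prod_def lessThan_atLeast0 intro!: sum.cong)
    finally show "a' i \<bullet> b j = (if i = j then 1 else 0)" using ij by (simp add: inv)
  qed (use b in \<open>auto simp: a'_def\<close>)
  then show ?thesis by (rule le_vdim) (rule W)
qed

text \<open>If functionals are dual to the vectors at \<open>x\<close>, then their pairing with the vectors at \<open>y\<close> has nonzero
  determinant for all \<open>y\<close> in an open neighbourhood of \<open>x\<close>.\<close>

lemma vdim_semicontinuous:
  fixes b :: "'c \<Rightarrow> ('a \<Rightarrow> 'k :: field mat) \<Rightarrow> 'k vec"
  assumes x: "x \<in> rep_affine_space Q d"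
    and W: "\<And>y. y \<in> rep_affine_space Q d \<Longrightarrow> W y = {b c y | c. c \<in> C}"
    and b: "\<And>c y. b c y \<in> carrier_vec n"
    and poly: "\<And>c p. c \<in> C \<Longrightarrow> p < n \<Longrightarrow> \<exists>f\<in>rep_poly_functions Q d. \<forall>y\<in>rep_affine_space Q d. b c y $ p = f y"
    and k: "k \<le> vdim n (W x)"
  obtains f where "f \<in> rep_poly_functions Q d" "f x \<noteq> 0"
    "\<And>y. y \<in> rep_affine_space Q d \<Longrightarrow> f y \<noteq> 0 \<Longrightarrow> k \<le> vdim n (W y)"
proof -
  obtain a u where au: "dual_system n (vdim n (W x)) a u" "\<And>i. i < vdim n (W x) \<Longrightarrow> u i \<in> W x"
    using vdim_attained by metis
  have a: "a i \<in> carrier_vec n" if "i < k" for i using au(1) that k by (simp add: dual_system_def)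
  have "\<forall>j<k. \<exists>c\<in>C. u j = b c x" using au(2) k W[OF x] by force
  \<comment> \<open>The parameters that produce the dual vectors at \<open>x\<close> are now fixed;
    only the point varies.\<close>
  then obtain c where c: "\<And>j. j < k \<Longrightarrow> c j \<in> C" "\<And>j. j < k \<Longrightarrow> u j = b (c j) x" by metis
  have "\<forall>j<k. \<forall>p<n. \<exists>f. f \<in> rep_poly_functions Q d \<and> (\<forall>y\<in>rep_affine_space Q d. b (c j) y $ p = f y)"
    using poly c(1) by blast
  then obtain f where f: "\<And>j p. j < k \<Longrightarrow> p < n \<Longrightarrow> f j p \<in> rep_poly_functions Q d"
    "\<And>j p y. j < k \<Longrightarrow> p < n \<Longrightarrow> y \<in> rep_affine_space Q d \<Longrightarrow> b (c j) y $ p = f j p y" by metis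
  define g where "g = (\<lambda>y. det (mat k k (\<lambda>(i, j). \<Sum>p<n. a i $ p * f j p y)))"
  have g: "g y = det (mat k k (\<lambda>(i, j). a i \<bullet> b (c j) y))" if y: "y \<in> rep_affine_space Q d" for y
  proof -
    have "mat k k (\<lambda>(i, j). \<Sum>p<n. a i $ p * f j p y) = mat k k (\<lambda>(i, j). a i \<bullet> b (c j) y)"
      using f(2)[OF _ _ y] carrier_vecD[OF b]
      by (intro eq_matI) (auto simp: scalar_prod_def lessThan_atLeast0 intro!: sum.cong)
    then show ?thesis by (simp add: g_def)
  qed
  show thesis
  proof (rule that)
    show "g \<in> rep_poly_functions Q d"
      unfolding g_def using f(1)
      by (intro rep_poly_det rep_poly_sum rep_poly_functions.mult rep_poly_functions.const) auto
    have "mat k k (\<lambda>(i, j). a i \<bullet> b (c j) x) = 1\<^sub>m k"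
      using au(1) k by (intro eq_matI) (auto simp: dual_system_def simp flip: c(2))
    then show "g x \<noteq> 0" by (simp add: g[OF x])
    show "k \<le> vdim n (W y)" if y: "y \<in> rep_affine_space Q d" "g y \<noteq> 0" for y
      by (rule le_vdim_of_det[where a = a and b = "\<lambda>j. b (c j) y"])
        (use a b c(1) W[OF y(1)] y(2) g[OF y(1)] in auto)
  qed
qed

text \<open>For a fixed family \<open>c\<close>, the entries of the arrow sum are linear in the
  matrix entries of the point.\<close>

lemma vdim_arrow_image_semicontinuous:
  fixes x :: "'a \<Rightarrow> 'k :: field mat"
  assumes x: "x \<in> rep_affine_space Q d" and k: "k \<le> vdim (d v) (arrow_image Q d x v)"
  obtains f where "f \<in> rep_poly_functions Q d" "f x \<noteq> 0"
    "\<And>y. y \<in> rep_affine_space Q d \<Longrightarrow> f y \<noteq> 0 \<Longrightarrow> k \<le> vdim (d v) (arrow_image Q d y v)"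
proof (rule vdim_semicontinuous[OF x, where b = "\<lambda>c y. arrow_sum Q d y v c" and W = "\<lambda>y. arrow_image Q d y v"
      and n = "d v" and k = k and C = "{c. \<forall>e\<in>arcs Q. head Q e = v \<longrightarrow> c e \<in> carrier_vec (d (tail Q e))}"])
  fix c :: "'a \<Rightarrow> 'k vec" and p
  assume c: "c \<in> {c. \<forall>e\<in>arcs Q. head Q e = v \<longrightarrow> c e \<in> carrier_vec (d (tail Q e))}" and p: "p < d v"
  show "\<exists>f\<in>rep_poly_functions Q d. \<forall>y\<in>rep_affine_space Q d. arrow_sum Q d y v c $ p = f y"
  proof (intro bexI ballI)
    show "(\<lambda>y. \<Sum>e | e \<in> arcs Q \<and> head Q e = v. \<Sum>l<d (tail Q e). y e $$ (p, l) * c e $ l) \<in> rep_poly_functions Q d"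
      using p by (intro rep_poly_sum rep_poly_functions.mult rep_poly_functions.coord rep_poly_functions.const) auto
    fix y :: "'a \<Rightarrow> 'k mat" assume y: "y \<in> rep_affine_space Q d"
    show "arrow_sum Q d y v c $ p = (\<Sum>e | e \<in> arcs Q \<and> head Q e = v. \<Sum>l<d (tail Q e). y e $$ (p, l) * c e $ l)"
      unfolding arrow_sum_def index_vec[OF p]
    proof (rule sum.cong[OF refl])
      fix e assume e: "e \<in> {e. e \<in> arcs Q \<and> head Q e = v}"
      then show "(y e *\<^sub>v c e) $ p = (\<Sum>l<d (tail Q e). y e $$ (p, l) * c e $ l)"
        using rep_affine_space_carrier[OF y, of e] c p
        by (auto simp: scalar_prod_def lessThan_atLeast0 intro!: sum.cong)
    qed
  qed
qed (use k that in \<open>auto simp: arrow_image_def\<close>)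

text \<open>Transposed matrices form a representation of this quiver with the same dimension vector,
  so row spaces become images.\<close>

definition reverse_quiver :: "('v, 'a) pre_digraph \<Rightarrow> ('v, 'a) pre_digraph" where
  "reverse_quiver Q = Q\<lparr>tail := head Q, head := tail Q\<rparr>"

text \<open>The orthogonal complement of \<^const>\<open>arrow_kernel\<close>, which reduces kernels to images.\<close>

definition arrow_row_space ::
    "('v, 'a) pre_digraph \<Rightarrow> ('v \<Rightarrow> nat) \<Rightarrow> ('a \<Rightarrow> 'k :: field mat) \<Rightarrow> 'v \<Rightarrow> 'k vec set" where
  "arrow_row_space Q d x v = arrow_image (reverse_quiver Q) d (\<lambda>e\<in>arcs Q. transpose_mat (x e)) v"

lemma reverse_quiver_simps [simp]:
  "verts (reverse_quiver Q) = verts Q" "arcs (reverse_quiver Q) = arcs Q"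
  "tail (reverse_quiver Q) = head Q" "head (reverse_quiver Q) = tail Q"
  by (simp_all add: reverse_quiver_def)

lemma reverse_affine:
  "x \<in> rep_affine_space Q d \<Longrightarrow> (\<lambda>e\<in>arcs Q. transpose_mat (x e)) \<in> rep_affine_space (reverse_quiver Q) d"
  by (auto simp: rep_affine_space_def)

text \<open>A vector is killed by the arrows leaving \<open>v\<close> exactly if it is orthogonal to
  all rows of their matrices, and those rows generate the joint image of the transposed
  matrices.\<close>

lemma arrow_kernel_orthogonal:
  fixes x :: "'a \<Rightarrow> 'k :: field mat"
  assumes fin: "finite (arcs Q)" and x: "x \<in> rep_affine_space Q d"
  shows "arrow_kernel Q d x v = {w \<in> carrier_vec (d v). \<forall>u\<in>arrow_row_space Q d x v. u \<bullet> w = 0}"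
proof (intro subset_antisym subsetI)
  let ?Q = "reverse_quiver Q" and ?x = "\<lambda>e\<in>arcs Q. transpose_mat (x e)"
  note carr = rep_affine_space_carrier[OF x]
  fix w assume w: "w \<in> arrow_kernel Q d x v"
  then have wc: "w \<in> carrier_vec (d v)" by (simp add: arrow_kernel_def)
  have "arrow_sum ?Q d ?x v c \<bullet> w = 0"
    if c: "\<forall>e\<in>arcs Q. tail Q e = v \<longrightarrow> c e \<in> carrier_vec (d (head Q e))" for c
  proof -
    have "arrow_sum ?Q d ?x v c \<bullet> w = (\<Sum>p<d v. (\<Sum>e | e \<in> arcs Q \<and> tail Q e = v. (?x e *\<^sub>v c e) $ p) * w $ p)"
      using wc by (auto simp: arrow_sum_def scalar_prod_def lessThan_atLeast0 intro!: sum.cong)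
    also have "\<dots> = (\<Sum>e | e \<in> arcs Q \<and> tail Q e = v. \<Sum>p<d v. (?x e *\<^sub>v c e) $ p * w $ p)"
      by (simp only: sum_distrib_right) (rule sum.swap)
    also have "\<dots> = 0"
    proof (rule sum.neutral, intro ballI)
      fix e assume e: "e \<in> {e. e \<in> arcs Q \<and> tail Q e = v}"
      have "(\<Sum>p<d v. (?x e *\<^sub>v c e) $ p * w $ p) = (transpose_mat (x e) *\<^sub>v c e) \<bullet> w"
        using e wc by (auto simp: scalar_prod_def lessThan_atLeast0)
      also have "\<dots> = c e \<bullet> (x e *\<^sub>v w)"
        using e c wc carr[of e] by (intro transpose_vec_mult_scalar) auto
      also have "\<dots> = 0" using e w c by (auto simp: arrow_kernel_def)
      finally show "(\<Sum>p<d v. (?x e *\<^sub>v c e) $ p * w $ p) = 0" .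
    qed
    finally show ?thesis .
  qed
  then show "w \<in> {w \<in> carrier_vec (d v). \<forall>u\<in>arrow_row_space Q d x v. u \<bullet> w = 0}"
    using wc by (auto simp: arrow_row_space_def arrow_image_def)
next
  let ?Q = "reverse_quiver Q" and ?x = "\<lambda>e\<in>arcs Q. transpose_mat (x e)"
  note carr = rep_affine_space_carrier[OF x]
  fix w assume w: "w \<in> {w \<in> carrier_vec (d v). \<forall>u\<in>arrow_row_space Q d x v. u \<bullet> w = 0}"
  have wc: "w \<in> carrier_vec (d v)" using w by simp
  have "x e *\<^sub>v w = 0\<^sub>v (d (head Q e))" if e: "e \<in> arcs Q" "tail Q e = v" for e
  proof (rule eq_vecI)
    fix i assume "i < dim_vec (0\<^sub>v (d (head Q e)))"
    then have i: "i < d (head Q e)" by simp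
    \<comment> \<open>This family singles out row \<open>i\<close> of \<open>x e\<close> as an
      element of the row space.\<close>
    define c where "c = (\<lambda>e'. if e' = e then unit_vec (d (head Q e)) i else 0\<^sub>v (d (head Q e')) :: 'k vec)"
    have "arrow_sum ?Q d ?x v c = ?x e *\<^sub>v c e"
      using mult_mat_zero_vec[OF rep_affine_space_carrier[OF reverse_affine[OF x]]] e fin
      by (intro arrow_sum_single reverse_affine[OF x]) (auto simp: c_def)
    also have "\<dots> = row (x e) i"
      using carr[OF e(1)] e i by (intro eq_vecI) (auto simp: c_def)
    finally have "row (x e) i \<in> arrow_row_space Q d x v"
      unfolding arrow_row_space_def arrow_image_def by (intro CollectI exI[of _ c]) (auto simp: c_def)
    then have "row (x e) i \<bullet> w = 0" using w by blast
    then show "(x e *\<^sub>v w) $ i = 0\<^sub>v (d (head Q e)) $ i" using carr[OF e(1)] i by simp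
  qed (use carr[OF e(1)] in auto)
  then show "w \<in> arrow_kernel Q d x v" using wc by (simp add: arrow_kernel_def)
qed

text \<open>Through this equation, lower semicontinuity of row spaces becomes upper semicontinuity
  of kernels.\<close>

lemma vdim_arrow_kernel:
  assumes "finite (arcs Q)" "x \<in> rep_affine_space Q d"
  shows "vdim (d v) (arrow_kernel Q d x v) + vdim (d v) (arrow_row_space Q d x v) = d v"
  unfolding arrow_kernel_orthogonal[OF assms] arrow_row_space_def
  by (intro vdim_orthogonal vec_subspace_arrow_image reverse_affine assms)

lemma vdim_arrow_row_space_semicontinuous:
  fixes x :: "'a \<Rightarrow> 'k :: field mat"
  assumes x: "x \<in> rep_affine_space Q d" and k: "k \<le> vdim (d v) (arrow_row_space Q d x v)"
  obtains f where "f \<in> rep_poly_functions Q d" "f x \<noteq> 0"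
    "\<And>y. y \<in> rep_affine_space Q d \<Longrightarrow> f y \<noteq> 0 \<Longrightarrow> k \<le> vdim (d v) (arrow_row_space Q d y v)"
proof (rule vdim_semicontinuous[OF x, where W = "\<lambda>y. arrow_row_space Q d y v" and n = "d v" and k = k
      and b = "\<lambda>c y. arrow_sum (reverse_quiver Q) d (\<lambda>e\<in>arcs Q. transpose_mat (y e)) v c"
      and C = "{c. \<forall>e\<in>arcs Q. tail Q e = v \<longrightarrow> c e \<in> carrier_vec (d (head Q e))}"])
  fix c :: "'a \<Rightarrow> 'k vec" and p
  assume c: "c \<in> {c. \<forall>e\<in>arcs Q. tail Q e = v \<longrightarrow> c e \<in> carrier_vec (d (head Q e))}" and p: "p < d v"
  show "\<exists>f\<in>rep_poly_functions Q d. \<forall>y\<in>rep_affine_space Q d.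
      arrow_sum (reverse_quiver Q) d (\<lambda>e\<in>arcs Q. transpose_mat (y e)) v c $ p = f y"
  proof (intro bexI ballI)
    show "(\<lambda>y. \<Sum>e | e \<in> arcs Q \<and> tail Q e = v. \<Sum>l<d (head Q e). y e $$ (l, p) * c e $ l) \<in> rep_poly_functions Q d"
      using p by (intro rep_poly_sum rep_poly_functions.mult rep_poly_functions.coord rep_poly_functions.const) auto
    fix y :: "'a \<Rightarrow> 'k mat" assume y: "y \<in> rep_affine_space Q d"
    show "arrow_sum (reverse_quiver Q) d (\<lambda>e\<in>arcs Q. transpose_mat (y e)) v c $ p =
        (\<Sum>e | e \<in> arcs Q \<and> tail Q e = v. \<Sum>l<d (head Q e). y e $$ (l, p) * c e $ l)"
      unfolding arrow_sum_def index_vec[OF p] reverse_quiver_simps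
    proof (rule sum.cong[OF refl])
      fix e assume e: "e \<in> {e. e \<in> arcs Q \<and> tail Q e = v}"
      then show "((\<lambda>e\<in>arcs Q. transpose_mat (y e)) e *\<^sub>v c e) $ p = (\<Sum>l<d (head Q e). y e $$ (l, p) * c e $ l)"
        using rep_affine_space_carrier[OF y, of e] c p
        by (auto simp: scalar_prod_def lessThan_atLeast0 intro!: sum.cong)
    qed
  qed
qed (use k that in \<open>auto simp: arrow_row_space_def arrow_image_def\<close>)

section \<open>The Zariski topology on the variety, and lines in affine space\<close>

lemma openin_zariski_affine: "openin (zariski_affine Q d) = zariski_open Q d"
  unfolding zariski_affine_def by (rule topology_inverse'[OF istopology_zariski_open])

text \<open>The nonvanishing sets of single polynomials form a basis of the topology, and this
  passes to the subspace.\<close>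

lemma openin_zariski_Rep_iff:
  "openin (zariski_Rep Q I d) S \<longleftrightarrow> S \<subseteq> Rep Q I d \<and>
     (\<forall>x\<in>S. \<exists>f\<in>rep_poly_functions Q d. f x \<noteq> 0 \<and> (\<forall>y\<in>Rep Q I d. f y \<noteq> 0 \<longrightarrow> y \<in> S))"
proof
  assume "openin (zariski_Rep Q I d) S"
  then obtain U where U: "zariski_open Q d U" "S = U \<inter> Rep Q I d"
    unfolding zariski_Rep_def openin_subtopology openin_zariski_affine by blast
  have "Rep Q I d \<subseteq> rep_affine_space Q d" by (auto simp: Rep_def)
  then show "S \<subseteq> Rep Q I d \<and>
     (\<forall>x\<in>S. \<exists>f\<in>rep_poly_functions Q d. f x \<noteq> 0 \<and> (\<forall>y\<in>Rep Q I d. f y \<noteq> 0 \<longrightarrow> y \<in> S))"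
  proof (intro conjI ballI)
    fix x assume "x \<in> S"
    then have "x \<in> U" using U(2) by simp
    then obtain f where f: "f \<in> rep_poly_functions Q d" "f x \<noteq> 0" "\<forall>y\<in>rep_affine_space Q d. f y \<noteq> 0 \<longrightarrow> y \<in> U"
      using U(1) unfolding zariski_open_iff by auto
    then show "\<exists>f\<in>rep_poly_functions Q d. f x \<noteq> 0 \<and> (\<forall>y\<in>Rep Q I d. f y \<noteq> 0 \<longrightarrow> y \<in> S)"
      using U(2) \<open>Rep Q I d \<subseteq> _\<close> by (intro bexI[of _ f] conjI ballI impI) auto
  qed (simp add: U(2))
next
  assume S: "S \<subseteq> Rep Q I d \<and>
     (\<forall>x\<in>S. \<exists>f\<in>rep_poly_functions Q d. f x \<noteq> 0 \<and> (\<forall>y\<in>Rep Q I d. f y \<noteq> 0 \<longrightarrow> y \<in> S))"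
  \<comment> \<open>The union of all basic open sets of the affine space that meet the variety only
    inside \<open>S\<close>.\<close>
  define U where "U = {x \<in> rep_affine_space Q d. \<exists>f\<in>rep_poly_functions Q d. f x \<noteq> 0 \<and> (\<forall>y\<in>Rep Q I d. f y \<noteq> 0 \<longrightarrow> y \<in> S)}"
  have "zariski_open Q d U"
    unfolding zariski_open_iff
  proof (intro conjI ballI)
    fix x assume "x \<in> U"
    then obtain f where f: "f \<in> rep_poly_functions Q d" "f x \<noteq> 0" "\<forall>y\<in>Rep Q I d. f y \<noteq> 0 \<longrightarrow> y \<in> S"
      by (auto simp: U_def)
    then show "\<exists>f\<in>rep_poly_functions Q d. f x \<noteq> 0 \<and> (\<forall>y\<in>rep_affine_space Q d. f y \<noteq> 0 \<longrightarrow> y \<in> U)"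
      by (intro bexI[of _ f] conjI ballI impI) (auto simp: U_def)
  qed (simp add: U_def)
  moreover have "S = U \<inter> Rep Q I d"
  proof (intro subset_antisym subsetI)
    fix x assume "x \<in> S"
    then show "x \<in> U \<inter> Rep Q I d" using S by (auto simp: U_def Rep_def)
  qed (auto simp: U_def)
  ultimately show "openin (zariski_Rep Q I d) S"
    unfolding zariski_Rep_def openin_subtopology openin_zariski_affine by blast
qed

lemma topspace_zariski_Rep: "topspace (zariski_Rep Q I d) = Rep Q I d"
proof (rule subset_antisym)
  show "topspace (zariski_Rep Q I d) \<subseteq> Rep Q I d"
    by (simp add: zariski_Rep_def)
  have "openin (zariski_Rep Q I d) (Rep Q I d)"
    unfolding openin_zariski_Rep_iff
    by (auto intro!: bexI[of _ "\<lambda>x. 1"] rep_poly_functions.const)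
  then show "Rep Q I d \<subseteq> topspace (zariski_Rep Q I d)" by (rule openin_subset)
qed

text \<open>It suffices to test basic open neighbourhoods. Read contrapositively, \<open>x\<close>
  satisfies every polynomial equation that holds on \<open>X\<close>; the form with nonvanishing
  suits the argument along a line.\<close>

lemma in_zariski_closure_iff:
  assumes "X \<subseteq> Rep Q I d"
  shows "x \<in> zariski_Rep Q I d closure_of X \<longleftrightarrow> x \<in> Rep Q I d \<and>
    (\<forall>f\<in>rep_poly_functions Q d. f x \<noteq> 0 \<longrightarrow> (\<exists>y\<in>X. f y \<noteq> 0))"
proof
  assume "x \<in> zariski_Rep Q I d closure_of X"
  then have x: "x \<in> Rep Q I d" and
    cl: "\<And>S. x \<in> S \<Longrightarrow> openin (zariski_Rep Q I d) S \<Longrightarrow> \<exists>y\<in>X. y \<in> S"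
    unfolding in_closure_of topspace_zariski_Rep by blast+
  have "\<exists>y\<in>X. f y \<noteq> 0" if f: "f \<in> rep_poly_functions Q d" "f x \<noteq> 0" for f
  proof -
    have "openin (zariski_Rep Q I d) {y \<in> Rep Q I d. f y \<noteq> 0}"
      unfolding openin_zariski_Rep_iff using f(1) by blast
    then show ?thesis using cl[of "{y \<in> Rep Q I d. f y \<noteq> 0}"] x f(2) by blast
  qed
  then show "x \<in> Rep Q I d \<and> (\<forall>f\<in>rep_poly_functions Q d. f x \<noteq> 0 \<longrightarrow> (\<exists>y\<in>X. f y \<noteq> 0))"
    using x by blast
next
  assume x: "x \<in> Rep Q I d \<and> (\<forall>f\<in>rep_poly_functions Q d. f x \<noteq> 0 \<longrightarrow> (\<exists>y\<in>X. f y \<noteq> 0))"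
  show "x \<in> zariski_Rep Q I d closure_of X"
    unfolding in_closure_of topspace_zariski_Rep
  proof (intro conjI allI impI)
    fix S assume S: "x \<in> S \<and> openin (zariski_Rep Q I d) S"
    then obtain f where f: "f \<in> rep_poly_functions Q d" "f x \<noteq> 0" "\<And>y. y \<in> Rep Q I d \<Longrightarrow> f y \<noteq> 0 \<Longrightarrow> y \<in> S"
      unfolding openin_zariski_Rep_iff by blast
    then show "\<exists>y. y \<in> X \<and> y \<in> S" using x assms by blast
  qed (use x in blast)
qed

text \<open>Euclid's argument: over a finite field, one plus the product of all \<open>X - a\<close>
  would be a nonconstant polynomial without a root.\<close>

lemma infinite_alg_closed_field: "infinite (UNIV :: 'k :: alg_closed_field set)"
proof
  assume fin: "finite (UNIV :: 'k set)"
  define p where "p = (\<Prod>a\<in>UNIV. [:- a, 1:]) + (1 :: 'k poly)"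
  have deg: "degree (\<Prod>a\<in>UNIV. [:- a, 1 :: 'k:]) = card (UNIV :: 'k set)"
    by (subst degree_prod_eq_sum_degree) auto
  have "card (UNIV :: 'k set) > 0" using fin by (simp add: card_gt_0_iff)
  then have "degree p > 0" unfolding p_def by (subst degree_add_eq_left) (simp_all add: deg)
  then obtain z where "poly p z = 0" using alg_closed_imp_poly_has_root by blast
  moreover have "poly (\<Prod>a\<in>UNIV. [:- a, 1:]) z = 0"
    using fin by (auto simp: poly_prod prod_zero_iff)
  ultimately show False by (simp add: p_def)
qed

text \<open>Coordinates are affine in \<open>s\<close>, and polynomials in \<open>s\<close> are
  closed under sums and products.\<close>

lemma rep_poly_on_line:
  fixes x y :: "'a \<Rightarrow> 'k :: field mat"
  assumes f: "f \<in> rep_poly_functions Q d"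
    and x: "x \<in> rep_affine_space Q d" and y: "y \<in> rep_affine_space Q d"
  shows "\<exists>p. \<forall>s. f (\<lambda>e\<in>arcs Q. (1 - s) \<cdot>\<^sub>m x e + s \<cdot>\<^sub>m y e) = poly p s"
  using f
proof induction
  case (const c)
  show ?case by (rule exI[of _ "[:c:]"]) simp
next
  case (coord e i j)
  show ?case
    using coord rep_affine_space_carrier[OF x coord(1)] rep_affine_space_carrier[OF y coord(1)]
    by (intro exI[of _ "[:x e $$ (i, j), y e $$ (i, j) - x e $$ (i, j):]"]) (auto simp: algebra_simps)
next
  case (add f g)
  then obtain p q where "\<forall>s. f (\<lambda>e\<in>arcs Q. (1 - s) \<cdot>\<^sub>m x e + s \<cdot>\<^sub>m y e) = poly p s"
    "\<forall>s. g (\<lambda>e\<in>arcs Q. (1 - s) \<cdot>\<^sub>m x e + s \<cdot>\<^sub>m y e) = poly q s" by blast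
  then show ?case by (intro exI[of _ "p + q"] allI) (simp only: poly_add)
next
  case (mult f g)
  then obtain p q where "\<forall>s. f (\<lambda>e\<in>arcs Q. (1 - s) \<cdot>\<^sub>m x e + s \<cdot>\<^sub>m y e) = poly p s"
    "\<forall>s. g (\<lambda>e\<in>arcs Q. (1 - s) \<cdot>\<^sub>m x e + s \<cdot>\<^sub>m y e) = poly q s" by blast
  then show ?case by (intro exI[of _ "p * q"] allI) (simp only: poly_mult)
qed

text \<open>Each function restricts to a polynomial in \<open>s\<close> that is nonzero at
  \<open>s = 0\<close> or at \<open>s = 1\<close>, hence has finitely many roots. The disjunction
  allows conditions that are open around different endpoints to be combined.\<close>

lemma exists_on_line_nonzero:
  fixes x y :: "'a \<Rightarrow> 'k :: alg_closed_field mat"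
  assumes F: "finite F" "F \<subseteq> rep_poly_functions Q d"
    and x: "x \<in> rep_affine_space Q d" and y: "y \<in> rep_affine_space Q d"
    and nz: "\<And>f. f \<in> F \<Longrightarrow> f x \<noteq> 0 \<or> f y \<noteq> 0"
  obtains s where "\<And>f. f \<in> F \<Longrightarrow> f (\<lambda>e\<in>arcs Q. (1 - s) \<cdot>\<^sub>m x e + s \<cdot>\<^sub>m y e) \<noteq> 0"
proof -
  define l where "l = (\<lambda>s. \<lambda>e\<in>arcs Q. (1 - s) \<cdot>\<^sub>m x e + s \<cdot>\<^sub>m y e)"
  have l0: "l 0 = x" and l1: "l 1 = y"
  proof -
    have "l 0 e = x e" "l 1 e = y e" if "e \<in> arcs Q" for e
      using rep_affine_space_carrier[OF x that] rep_affine_space_carrier[OF y that] that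
      by (auto simp: l_def intro!: eq_matI)
    moreover have "l s e = undefined" "x e = undefined" "y e = undefined" if "e \<notin> arcs Q" for e s
      using x y that by (auto simp: l_def rep_affine_space_def)
    ultimately show "l 0 = x" "l 1 = y" by (metis ext)+
  qed
  have "finite {s. f (l s) = 0}" if f: "f \<in> F" for f
  proof -
    obtain p where p: "\<And>s. f (l s) = poly p s"
      using rep_poly_on_line[OF _ x y] f F(2) unfolding l_def by blast
    have "p \<noteq> 0"
    proof
      assume "p = 0"
      then have "f (l 0) = 0" "f (l 1) = 0" unfolding p by simp_all
      then show False using nz[OF f] unfolding l0 l1 by blast
    qed
    then show ?thesis unfolding p by (rule poly_roots_finite)
  qed
  then have "finite (\<Union>f\<in>F. {s. f (l s) = 0})" using F(1) by blast
  then obtain s where "s \<notin> (\<Union>f\<in>F. {s. f (l s) = 0})"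
    using ex_new_if_finite[OF infinite_alg_closed_field] by blast
  then show thesis using that[of s] unfolding l_def by blast
qed

section \<open>Closures of strata\<close>

lemma scalar_prod_arrow_sum:
  assumes x: "x \<in> rep_affine_space Q d" and a: "a \<in> carrier_vec (d v)"
  shows "a \<bullet> arrow_sum Q d x v c = (\<Sum>e | e \<in> arcs Q \<and> head Q e = v. a \<bullet> (x e *\<^sub>v c e))"
proof -
  let ?A = "{e. e \<in> arcs Q \<and> head Q e = v}"
  have "a \<bullet> arrow_sum Q d x v c = (\<Sum>p<d v. a $ p * (\<Sum>e\<in>?A. (x e *\<^sub>v c e) $ p))"
    by (auto simp: arrow_sum_def scalar_prod_def lessThan_atLeast0 intro!: sum.cong)
  also have "\<dots> = (\<Sum>e\<in>?A. \<Sum>p<d v. a $ p * (x e *\<^sub>v c e) $ p)"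
    by (simp only: sum_distrib_left) (rule sum.swap)
  also have "\<dots> = (\<Sum>e\<in>?A. a \<bullet> (x e *\<^sub>v c e))"
  proof (rule sum.cong[OF refl])
    fix e assume e: "e \<in> ?A"
    then have "dim_vec (x e *\<^sub>v c e) = d v" using rep_affine_space_carrier[OF x, of e] by auto
    then show "(\<Sum>p<d v. a $ p * (x e *\<^sub>v c e) $ p) = a \<bullet> (x e *\<^sub>v c e)"
      by (simp only: scalar_prod_def lessThan_atLeast0)
  qed
  finally show ?thesis .
qed

lemma mult_mat_vec_arrow_sum:
  assumes x: "x \<in> rep_affine_space Q d" and A: "A \<in> carrier_mat n (d v)" and i: "i < n"
  shows "(A *\<^sub>v arrow_sum Q d x v c) $ i = (\<Sum>e | e \<in> arcs Q \<and> head Q e = v. (A *\<^sub>v (x e *\<^sub>v c e)) $ i)"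
  using scalar_prod_arrow_sum[OF x, of "row A i" v c] A i by auto

lemma mult_vec_in_arrow_image:
  assumes fin: "finite (arcs Q)" and x: "x \<in> rep_affine_space Q d" and e: "e \<in> arcs Q" "head Q e = v"
    and w: "w \<in> carrier_vec (d (tail Q e))"
  shows "x e *\<^sub>v w \<in> arrow_image Q d x v"
proof -
  define c where "c = (\<lambda>e'. if e' = e then w else 0\<^sub>v (d (tail Q e')))"
  have "arrow_sum Q d x v c = x e *\<^sub>v c e"
    using mult_mat_zero_vec[OF rep_affine_space_carrier[OF x]]
    by (intro arrow_sum_single fin e x) (auto simp: c_def)
  then show ?thesis
    unfolding arrow_image_def using w by (intro CollectI exI[of _ c]) (auto simp: c_def)
qed

text \<open>The subspace is given by linear equations, and a functional applied to an arrow sum is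
  the sum of its values on the contributions of the single arrows.\<close>

lemma arrow_image_subset_coord:
  assumes x: "x \<in> rep_affine_space Q d" and a: "\<And>i. i < d v \<Longrightarrow> a i \<in> carrier_vec (d v)"
    and im: "\<And>e w. e \<in> arcs Q \<Longrightarrow> head Q e = v \<Longrightarrow> w \<in> carrier_vec (d (tail Q e)) \<Longrightarrow>
      x e *\<^sub>v w \<in> coord_subspace (d v) k a"
  shows "arrow_image Q d x v \<subseteq> coord_subspace (d v) k a"
proof
  fix u assume "u \<in> arrow_image Q d x v"
  then obtain c where c: "u = arrow_sum Q d x v c"
      "\<And>e. e \<in> arcs Q \<Longrightarrow> head Q e = v \<Longrightarrow> c e \<in> carrier_vec (d (tail Q e))"
    by (auto simp: arrow_image_def)
  have "a i \<bullet> u = 0" if i: "i \<in> {k..<d v}" for i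
    unfolding c(1) scalar_prod_arrow_sum[OF x a[of i]]
  proof -
    have ai: "a i \<in> carrier_vec (d v)" using a i by simp
    show "a i \<bullet> arrow_sum Q d x v c = 0"
      unfolding scalar_prod_arrow_sum[OF x ai]
      using im c(2) i by (intro sum.neutral) (auto simp: coord_subspace_def)
  qed
  then show "u \<in> coord_subspace (d v) k a" by (simp add: coord_subspace_def c(1))
qed

text \<open>For fixed \<open>W\<close> the two conditions are linear in \<open>y\<close>, unlike the
  products in \<open>square_zero_rep\<close>, and therefore pass from two points to the line through
  them.\<close>

lemma square_zero_repI:
  assumes y: "y \<in> rep_affine_space Q d"
    and ker: "\<And>e w. e \<in> arcs Q \<Longrightarrow> w \<in> W (tail Q e) \<Longrightarrow> y e *\<^sub>v w = 0\<^sub>v (d (head Q e))"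
    and im: "\<And>e w. e \<in> arcs Q \<Longrightarrow> w \<in> carrier_vec (d (tail Q e)) \<Longrightarrow> y e *\<^sub>v w \<in> W (head Q e)"
  shows "square_zero_rep Q d y"
  unfolding square_zero_rep_def
proof (intro conjI ballI impI y)
  fix e e' assume arcs': "e \<in> arcs Q" "e' \<in> arcs Q" "head Q e = tail Q e'"
  note carr = rep_affine_space_carrier[OF y arcs'(1)] rep_affine_space_carrier[OF y arcs'(2)]
  show "y e' * y e = 0\<^sub>m (d (head Q e')) (d (tail Q e))"
  proof (rule eq_matI)
    fix i j assume "i < dim_row (0\<^sub>m (d (head Q e')) (d (tail Q e)))" "j < dim_col (0\<^sub>m (d (head Q e')) (d (tail Q e)))"
    then have ij: "i < d (head Q e')" "j < d (tail Q e)" by auto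
    have "col (y e) j = y e *\<^sub>v unit_vec (d (tail Q e)) j"
      using carr(1) ij by (intro eq_vecI) auto
    then have "col (y e) j \<in> W (tail Q e')" using im[OF arcs'(1)] arcs'(3) by simp
    then have "y e' *\<^sub>v col (y e) j = 0\<^sub>v (d (head Q e'))" by (rule ker[OF arcs'(2)])
    moreover have "(y e' * y e) $$ (i, j) = (y e' *\<^sub>v col (y e) j) $ i" using carr ij by simp
    ultimately show "(y e' * y e) $$ (i, j) = 0\<^sub>m (d (head Q e')) (d (tail Q e)) $$ (i, j)" using ij by simp
  qed (use carr in auto)
qed

text \<open>The sum of the products of the columns \<open>b j\<close> with the rows
  \<open>a j\<close>. If \<open>a\<close> is dual to a basis, it sends the members of that basis to
  the \<open>b j\<close>.\<close>

definition base_change :: "nat \<Rightarrow> (nat \<Rightarrow> 'k :: field vec) \<Rightarrow> (nat \<Rightarrow> 'k vec) \<Rightarrow> 'k mat" where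
  "base_change n a b = mat n n (\<lambda>(i, l). \<Sum>j<n. b j $ i * a j $ l)"

lemma base_change_carrier [simp]: "base_change n a b \<in> carrier_mat n n"
  by (simp add: base_change_def)

lemma base_change_mult:
  assumes "\<And>j. j < n \<Longrightarrow> a j \<in> carrier_vec n" "w \<in> carrier_vec n"
  shows "base_change n a b *\<^sub>v w = lin_comb n n (\<lambda>j. a j \<bullet> w) b"
proof (rule eq_vecI)
  fix i assume "i < dim_vec (lin_comb n n (\<lambda>j. a j \<bullet> w) b)"
  then have i: "i < n" by simp
  have "(base_change n a b *\<^sub>v w) $ i = (\<Sum>l<n. (\<Sum>j<n. b j $ i * a j $ l) * w $ l)"
    using i assms(2) by (auto simp: base_change_def scalar_prod_def lessThan_atLeast0 intro!: sum.cong)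
  also have "\<dots> = (\<Sum>j<n. \<Sum>l<n. b j $ i * a j $ l * w $ l)"
    by (simp only: sum_distrib_right) (rule sum.swap)
  also have "\<dots> = (\<Sum>j<n. (a j \<bullet> w) * b j $ i)"
    using assms(2) by (auto simp: scalar_prod_def lessThan_atLeast0 sum_distrib_left mult_ac intro!: sum.cong)
  finally show "(base_change n a b *\<^sub>v w) $ i = lin_comb n n (\<lambda>j. a j \<bullet> w) b $ i"
    using i by (simp add: lin_comb_def)
qed (simp add: base_change_def)

text \<open>The coordinates of \<open>w\<close> with respect to \<open>b\<close> are the coordinates
  of its image with respect to \<open>b'\<close>.\<close>

lemma base_change_props:
  assumes ab: "dual_system n n a b" and ab': "dual_system n n a' b'"
  shows "w \<in> carrier_vec n \<Longrightarrow> base_change n a' b *\<^sub>v (base_change n a b' *\<^sub>v w) = w"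
    and "w \<in> coord_subspace n k a \<Longrightarrow> base_change n a b' *\<^sub>v w \<in> coord_subspace n k a'"
    and "j < n \<Longrightarrow> base_change n a b' *\<^sub>v b j = b' j"
proof -
  have a: "a j \<in> carrier_vec n" "a' j \<in> carrier_vec n" "b j \<in> carrier_vec n" "b' j \<in> carrier_vec n" if "j < n" for j
    using ab ab' that by (auto simp: dual_system_def)
  have coeff: "a' j \<bullet> (base_change n a b' *\<^sub>v w) = a j \<bullet> w" if "w \<in> carrier_vec n" "j < n" for w j
    using base_change_mult[OF a(1) that(1)] dual_system_coeff[OF ab' that(2)] by simp
  have carr: "base_change n a b' *\<^sub>v w \<in> carrier_vec n" for w by (simp add: base_change_def carrier_vecI)
  show "base_change n a' b *\<^sub>v (base_change n a b' *\<^sub>v w) = w" if w: "w \<in> carrier_vec n"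
  proof -
    have "base_change n a' b *\<^sub>v (base_change n a b' *\<^sub>v w) = lin_comb n n (\<lambda>j. a' j \<bullet> (base_change n a b' *\<^sub>v w)) b"
      by (rule base_change_mult[OF a(2) carr])
    also have "\<dots> = lin_comb n n (\<lambda>j. a j \<bullet> w) b" using coeff[OF w] by (intro lin_comb_cong) auto
    also have "\<dots> = w" by (rule dual_basis_expand[OF ab w, symmetric])
    finally show ?thesis .
  qed
  show "base_change n a b' *\<^sub>v w \<in> coord_subspace n k a'" if "w \<in> coord_subspace n k a"
    using that coeff carr by (auto simp: coord_subspace_def)
  show "base_change n a b' *\<^sub>v b j = b' j" if j: "j < n"
  proof -
    have "base_change n a b' *\<^sub>v b j = lin_comb n n (\<lambda>i. a i \<bullet> b j) b'" by (rule base_change_mult[OF a(1) a(3)[OF j]])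
    also have "\<dots> = lin_comb n n (\<lambda>i. a' i \<bullet> b' j) b'"
      using ab ab' j by (intro lin_comb_cong) (auto simp: dual_system_def)
    also have "\<dots> = b' j" by (rule dual_basis_expand[OF ab' a(4)[OF j], symmetric])
    finally show ?thesis .
  qed
qed

text \<open>Conjugate \<open>z\<close> by the base changes from a basis adapted to its own arrow
  images to the given basis. The first property holds because the images of \<open>z\<close> lie in
  its kernels; the last keeps the ranks from dropping.\<close>

lemma conjugate_arrow_images:
  fixes Q :: "('v, 'a) pre_digraph" and z :: "'a \<Rightarrow> 'k :: field mat" and a b :: "'v \<Rightarrow> nat \<Rightarrow> 'k vec"
  assumes wf: "wf_digraph Q" and fin: "finite (arcs Q)" and z: "square_zero_rep Q d z"
    and ab: "\<And>v. v \<in> verts Q \<Longrightarrow> dual_system (d v) (d v) (a v) (b v)"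
  obtains y where "y \<in> rep_affine_space Q d"
    "\<And>e w. e \<in> arcs Q \<Longrightarrow> w \<in> coord_subspace (d (tail Q e)) (vdim (d (tail Q e)) (arrow_image Q d z (tail Q e))) (a (tail Q e)) \<Longrightarrow>
      y e *\<^sub>v w = 0\<^sub>v (d (head Q e))"
    "\<And>e w. e \<in> arcs Q \<Longrightarrow> w \<in> carrier_vec (d (tail Q e)) \<Longrightarrow>
      y e *\<^sub>v w \<in> coord_subspace (d (head Q e)) (vdim (d (head Q e)) (arrow_image Q d z (head Q e))) (a (head Q e))"
    "\<And>v. v \<in> verts Q \<Longrightarrow> vdim (d v) (arrow_image Q d z v) \<le> vdim (d v) (arrow_image Q d y v)"
proof -
  interpret wf_digraph Q by (rule wf)
  have za: "z \<in> rep_affine_space Q d" using z by (simp add: square_zero_rep_def)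
  note zc = rep_affine_space_carrier[OF za]
  define k where "k = (\<lambda>v. vdim (d v) (arrow_image Q d z v))"
  have kd: "k v \<le> d v" for v by (simp add: k_def vdim_le)
  have sub: "vec_subspace (d v) (arrow_image Q d z v)" for v by (rule vec_subspace_arrow_image[OF za])
  have "\<exists>a0 b0. dual_system (d v) (d v) a0 b0 \<and> coord_subspace (d v) (k v) a0 = arrow_image Q d z v" for v
    using adapted_dual_basis[OF sub[of v] sub[of v] subset_refl] unfolding k_def by metis
  then obtain a0 b0 where ab0: "\<And>v. dual_system (d v) (d v) (a0 v) (b0 v)"
    "\<And>v. coord_subspace (d v) (k v) (a0 v) = arrow_image Q d z v" by metis
  \<comment> \<open>\<open>G v\<close> carries the adapted basis \<open>b0 v\<close> to
    \<open>b v\<close>, and \<open>H v\<close> carries it back.\<close>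
  define G where "G = (\<lambda>v. base_change (d v) (a0 v) (b v))"
  define H where "H = (\<lambda>v. base_change (d v) (a v) (b0 v))"
  have GH: "G v \<in> carrier_mat (d v) (d v)" "H v \<in> carrier_mat (d v) (d v)" for v by (simp_all add: G_def H_def)
  define y where "y = (\<lambda>e\<in>arcs Q. G (head Q e) * (z e * H (tail Q e)))"
  have y: "y \<in> rep_affine_space Q d"
    unfolding rep_affine_space_def y_def using zc GH by (auto intro!: mult_carrier_mat)
  have y_mult: "y e *\<^sub>v w = G (head Q e) *\<^sub>v (z e *\<^sub>v (H (tail Q e) *\<^sub>v w))"
    if e: "e \<in> arcs Q" and w: "w \<in> carrier_vec (d (tail Q e))" for e w
  proof -
    have "y e *\<^sub>v w = G (head Q e) *\<^sub>v ((z e * H (tail Q e)) *\<^sub>v w)"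
      using e w zc[OF e] GH unfolding y_def by (simp add: assoc_mult_mat_vec[of _ "d (head Q e)" "d (head Q e)" _ "d (tail Q e)"])
    also have "(z e * H (tail Q e)) *\<^sub>v w = z e *\<^sub>v (H (tail Q e) *\<^sub>v w)"
      by (rule assoc_mult_mat_vec[OF zc[OF e] GH(2) w])
    finally show ?thesis .
  qed
  have H_carr: "H v *\<^sub>v w \<in> carrier_vec (d v)" if "w \<in> carrier_vec (d v)" for v w
    using GH(2) that by (rule mult_mat_vec_carrier)
  have G_carr: "G v *\<^sub>v w \<in> carrier_vec (d v)" if "w \<in> carrier_vec (d v)" for v w
    using GH(1) that by (rule mult_mat_vec_carrier)
  show thesis
  proof (rule that[OF y])
    fix e and w :: "'k vec" assume e: "e \<in> arcs Q"
    have t: "tail Q e \<in> verts Q" and h: "head Q e \<in> verts Q" using e by auto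
    {
      assume "w \<in> coord_subspace (d (tail Q e)) (vdim (d (tail Q e)) (arrow_image Q d z (tail Q e))) (a (tail Q e))"
      then have w: "w \<in> coord_subspace (d (tail Q e)) (k (tail Q e)) (a (tail Q e))" by (simp add: k_def)
      then have wc: "w \<in> carrier_vec (d (tail Q e))" by (simp add: coord_subspace_def)
      have "H (tail Q e) *\<^sub>v w \<in> arrow_image Q d z (tail Q e)"
        using base_change_props(2)[OF ab[OF t] ab0(1) w] by (simp add: H_def ab0(2))
      then obtain c where c: "H (tail Q e) *\<^sub>v w = arrow_sum Q d z (tail Q e) c"
        "\<And>e'. e' \<in> arcs Q \<Longrightarrow> head Q e' = tail Q e \<Longrightarrow> c e' \<in> carrier_vec (d (tail Q e'))"
        by (auto simp: arrow_image_def)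
      have "H (tail Q e) *\<^sub>v w \<in> arrow_kernel Q d z (tail Q e)"
        unfolding c(1) by (rule arrow_kernel_arrow_sum[OF fin z c(2)])
      then have "z e *\<^sub>v (H (tail Q e) *\<^sub>v w) = 0\<^sub>v (d (head Q e))" using e by (simp add: arrow_kernel_def)
      then show "y e *\<^sub>v w = 0\<^sub>v (d (head Q e))"
        using mult_mat_zero_vec[OF GH(1)] by (simp add: y_mult[OF e wc])
    }
    {
      assume w: "w \<in> carrier_vec (d (tail Q e))"
      have "z e *\<^sub>v (H (tail Q e) *\<^sub>v w) \<in> coord_subspace (d (head Q e)) (k (head Q e)) (a0 (head Q e))"
        unfolding ab0(2) by (rule mult_vec_in_arrow_image[OF fin za e refl H_carr[OF w]])
      then have "y e *\<^sub>v w \<in> coord_subspace (d (head Q e)) (k (head Q e)) (a (head Q e))"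
        unfolding y_mult[OF e w] G_def by (rule base_change_props(2)[OF ab0(1) ab[OF h]])
      then show "y e *\<^sub>v w \<in> coord_subspace (d (head Q e)) (vdim (d (head Q e)) (arrow_image Q d z (head Q e))) (a (head Q e))"
        by (simp add: k_def)
    }
  next
    fix v assume v: "v \<in> verts Q"
    have G_image: "G v *\<^sub>v u \<in> arrow_image Q d y v" if u: "u \<in> arrow_image Q d z v" for u
    proof -
      obtain c where c: "u = arrow_sum Q d z v c"
        "\<And>e'. e' \<in> arcs Q \<Longrightarrow> head Q e' = v \<Longrightarrow> c e' \<in> carrier_vec (d (tail Q e'))"
        using u by (auto simp: arrow_image_def)
      \<comment> \<open>Transporting the family by \<open>G\<close> at the tails cancels against the
        factor \<open>H\<close> contained in \<open>y e'\<close>.\<close>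
      define c' where "c' = (\<lambda>e'. G (tail Q e') *\<^sub>v c e')"
      have "y e' *\<^sub>v c' e' = G v *\<^sub>v (z e' *\<^sub>v c e')" if e': "e' \<in> arcs Q" "head Q e' = v" for e'
      proof -
        have t: "tail Q e' \<in> verts Q" using e' by auto
        have "H (tail Q e') *\<^sub>v c' e' = c e'"
          unfolding c'_def H_def G_def by (rule base_change_props(1)[OF ab0(1) ab[OF t] c(2)[OF e']])
        moreover have "c' e' \<in> carrier_vec (d (tail Q e'))" unfolding c'_def by (rule G_carr[OF c(2)[OF e']])
        ultimately show ?thesis using y_mult[OF e'(1)] e'(2) by simp
      qed
      then have "arrow_sum Q d y v c' = G v *\<^sub>v u"
        using GH(1)[of v] unfolding c(1)
        by (intro eq_vecI) (auto simp: mult_mat_vec_arrow_sum[OF za GH(1)] arrow_sum_def[of _ _ y] simp del: index_mult_mat_vec intro!: sum.cong)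
      moreover have "c' e' \<in> carrier_vec (d (tail Q e'))" if "e' \<in> arcs Q" "head Q e' = v" for e'
        unfolding c'_def by (rule G_carr[OF c(2)[OF that]])
      ultimately show ?thesis
        unfolding arrow_image_def by (intro CollectI exI[of _ c'] conjI ballI impI) auto
    qed
    have "b v j \<in> arrow_image Q d y v" if j: "j < k v" for j
    proof -
      have "b0 v j \<in> arrow_image Q d z v"
        using dual_basis_mem_coord[OF ab0(1) j kd] by (simp add: ab0(2))
      from G_image[OF this] show ?thesis
        using base_change_props(3)[OF ab0(1) ab[OF v], of j] j kd[of v] by (simp add: G_def)
    qed
    moreover have "dual_system (d v) (k v) (a v) (b v)"
      using ab[OF v] kd[of v] by (auto simp: dual_system_def)
    ultimately show "vdim (d v) (arrow_image Q d z v) \<le> vdim (d v) (arrow_image Q d y v)"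
      unfolding k_def by (intro le_vdim) auto
  qed
qed

section \<open>Generic socles and the two implications\<close>

context square_zero_quiver_algebra
begin

text \<open>Density of \<open>V\<close> in \<open>X\<close> is restated by polynomials: one that is
  nonzero somewhere on \<open>X\<close> is nonzero somewhere on \<open>V\<close>. The socle
  isomorphism is replaced by kernel dimensions.\<close>

lemma generic_socleD:
  assumes U: "generic_socle Q I d X U" and X: "X \<subseteq> Rep Q I d"
  obtains V where "V \<subseteq> X" "X \<noteq> {} \<Longrightarrow> V \<noteq> {}"
    "\<And>x v. x \<in> V \<Longrightarrow> v \<in> verts Q \<Longrightarrow> vdim (d v) (arrow_kernel Q d x v) = fst U v"
    "\<And>x f. x \<in> X \<Longrightarrow> f \<in> rep_poly_functions Q d \<Longrightarrow> f x \<noteq> 0 \<Longrightarrow> \<exists>y\<in>V. f y \<noteq> 0"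
proof -
  from U obtain V where ss: "semisimple_fd_module Q I U"
    and V: "openin (subtopology (zariski_Rep Q I d) X) V" "subtopology (zariski_Rep Q I d) X closure_of V = X"
    and iso: "\<And>x. x \<in> V \<Longrightarrow> module_isomorphic \<Lambda> (socle_module \<Lambda> (rep_module Q d x)) (module_of Q U)"
    unfolding generic_socle_def by blast
  have VX: "V \<subseteq> X" using openin_subset[OF V(1)] by (simp add: topspace_subtopology)
  show thesis
  proof (rule that[OF VX])
    show "V \<noteq> {}" if "X \<noteq> {}" using V(2) that by auto
    show "vdim (d v) (arrow_kernel Q d x v) = fst U v" if "x \<in> V" "v \<in> verts Q" for x v
      using socle_iso_imp_vdim[OF ss _ iso[OF that(1)] that(2)] that VX X by blast
    fix x f assume x: "x \<in> X" and f: "f \<in> rep_poly_functions Q d" "f x \<noteq> 0"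
    have "openin (zariski_Rep Q I d) {y \<in> Rep Q I d. f y \<noteq> 0}"
      unfolding openin_zariski_Rep_iff using f(1) by blast
    then have op: "openin (subtopology (zariski_Rep Q I d) X) ({y \<in> Rep Q I d. f y \<noteq> 0} \<inter> X)"
      unfolding openin_subtopology by blast
    have "x \<in> subtopology (zariski_Rep Q I d) X closure_of V" using x V(2) by simp
    then have cl: "\<forall>S. x \<in> S \<and> openin (subtopology (zariski_Rep Q I d) X) S \<longrightarrow> (\<exists>y. y \<in> V \<and> y \<in> S)"
      unfolding in_closure_of by (rule conjunct2)
    have "x \<in> {y \<in> Rep Q I d. f y \<noteq> 0} \<inter> X" using x X f(2) by blast
    from mp[OF spec[OF cl] conjI[OF this op]]
    have "\<exists>y. y \<in> V \<and> y \<in> {y \<in> Rep Q I d. f y \<noteq> 0} \<inter> X" .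
    then show "\<exists>y\<in>V. f y \<noteq> 0" by blast
  qed
qed

lemma Rep_top_subset: "Rep_top Q I d T \<subseteq> Rep Q I d"
  by (auto simp: Rep_top_def)

lemma arrow_image_subset_kernel:
  assumes x: "x \<in> Rep Q I d"
  shows "arrow_image Q d x v \<subseteq> arrow_kernel Q d x v"
proof
  fix u assume "u \<in> arrow_image Q d x v"
  then obtain c where "u = arrow_sum Q d x v c"
      "\<And>e. e \<in> arcs Q \<Longrightarrow> head Q e = v \<Longrightarrow> c e \<in> carrier_vec (d (tail Q e))"
    by (auto simp: arrow_image_def)
  then show "u \<in> arrow_kernel Q d x v"
    using x unfolding Rep_iff by (simp only: arrow_kernel_arrow_sum[OF finite_arcs])
qed

text \<open>At a point \<open>x\<close> of the first stratum with generic socle, a polynomial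
  certifies the dimension of the image or of the row space. By the closure assumption it is nonzero
  somewhere on the second stratum, where that dimension is at least as large.\<close>

lemma closure_imp_dim_vector_le:
  assumes T: "semisimple_fd_module Q I T1" "semisimple_fd_module Q I T2"
    and real: "Rep_top Q I d T1 \<noteq> {}"
    and U: "generic_socle Q I d (Rep_top Q I d T1) U1" "generic_socle Q I d (Rep_top Q I d T2) U2"
    and cl: "Rep_top Q I d T1 \<subseteq> zariski_Rep Q I d closure_of Rep_top Q I d T2"
    and v: "v \<in> verts Q"
  shows "fst T2 v \<le> fst T1 v" "fst U2 v \<le> fst U1 v"
proof -
  obtain V1 where V1: "V1 \<subseteq> Rep_top Q I d T1" "V1 \<noteq> {}"
    "\<And>x. x \<in> V1 \<Longrightarrow> vdim (d v) (arrow_kernel Q d x v) = fst U1 v"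
    using generic_socleD[OF U(1) Rep_top_subset] real v by metis
  obtain V2 where V2: "V2 \<subseteq> Rep_top Q I d T2"
    "\<And>x. x \<in> V2 \<Longrightarrow> vdim (d v) (arrow_kernel Q d x v) = fst U2 v"
    "\<And>x f. x \<in> Rep_top Q I d T2 \<Longrightarrow> f \<in> rep_poly_functions Q d \<Longrightarrow> f x \<noteq> 0 \<Longrightarrow> \<exists>y\<in>V2. f y \<noteq> 0"
    using generic_socleD[OF U(2) Rep_top_subset] v by metis
  obtain x where x: "x \<in> V1" using V1(2) by blast
  have x1: "x \<in> Rep_top Q I d T1" using x V1(1) by blast
  have xa: "x \<in> rep_affine_space Q d" using x1 Rep_top_subset Rep_affine by blast
  have dense: "\<exists>y\<in>Rep_top Q I d T2. f y \<noteq> 0" if "f \<in> rep_poly_functions Q d" "f x \<noteq> 0" for f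
    using cl x1 that unfolding in_zariski_closure_iff[OF Rep_top_subset] subset_iff by blast
  have aff: "y \<in> rep_affine_space Q d" if "y \<in> Rep_top Q I d T2" for y
    using that Rep_top_subset Rep_affine by blast
  show "fst T2 v \<le> fst T1 v"
  proof -
    obtain f where f: "f \<in> rep_poly_functions Q d" "f x \<noteq> 0" "\<And>y. y \<in> rep_affine_space Q d \<Longrightarrow> f y \<noteq> 0 \<Longrightarrow>
        vdim (d v) (arrow_image Q d x v) \<le> vdim (d v) (arrow_image Q d y v)"
      using vdim_arrow_image_semicontinuous[OF xa order_refl] by blast
    obtain y where y: "y \<in> Rep_top Q I d T2" "f y \<noteq> 0" using dense f by blast
    show ?thesis
      using f(3)[OF aff[OF y(1)] y(2)] Rep_top_imp_vdim[OF T(1) x1 v] Rep_top_imp_vdim[OF T(2) y(1) v] by linarith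
  qed
  show "fst U2 v \<le> fst U1 v"
  proof -
    obtain f where f: "f \<in> rep_poly_functions Q d" "f x \<noteq> 0" "\<And>y. y \<in> rep_affine_space Q d \<Longrightarrow> f y \<noteq> 0 \<Longrightarrow>
        vdim (d v) (arrow_row_space Q d x v) \<le> vdim (d v) (arrow_row_space Q d y v)"
      using vdim_arrow_row_space_semicontinuous[OF xa order_refl] by blast
    \<comment> \<open>Closure leads from \<open>x\<close> to some point of the second stratum, and
      density from there to a point with generic socle.\<close>
    obtain y where y: "y \<in> V2" "f y \<noteq> 0" using dense[OF f(1,2)] V2(3)[OF _ f(1)] by blast
    have ya: "y \<in> rep_affine_space Q d" using y V2(1) aff by blast
    show ?thesis
      using f(3)[OF ya y(2)] vdim_arrow_kernel[OF finite_arcs xa, of v] vdim_arrow_kernel[OF finite_arcs ya, of v]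
        V1(3)[OF x] V2(2)[OF y(1)] by linarith
  qed
qed

end

lemma dim_vector_le_imp_closure:
  fixes Q :: "('v, 'a) pre_digraph" and I :: "(('v, 'a) path \<Rightarrow> 'k :: alg_closed_field) set"
  assumes alg: "square_zero_quiver_algebra Q I"
    and T: "semisimple_fd_module Q I T1" "semisimple_fd_module Q I T2"
    and real: "Rep_top Q I d T2 \<noteq> {}"
    and U: "generic_socle Q I d (Rep_top Q I d T1) U1" "generic_socle Q I d (Rep_top Q I d T2) U2"
    and tops: "\<And>v. v \<in> verts Q \<Longrightarrow> fst T2 v \<le> fst T1 v"
    and socles: "\<And>v. v \<in> verts Q \<Longrightarrow> fst U2 v \<le> fst U1 v"
  shows "Rep_top Q I d T1 \<subseteq> zariski_Rep Q I d closure_of Rep_top Q I d T2"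
proof
  interpret square_zero_quiver_algebra Q I by (rule alg)
  obtain V1 where V1: "V1 \<subseteq> Rep_top Q I d T1"
    "\<And>x v. x \<in> V1 \<Longrightarrow> v \<in> verts Q \<Longrightarrow> vdim (d v) (arrow_kernel Q d x v) = fst U1 v"
    "\<And>x f. x \<in> Rep_top Q I d T1 \<Longrightarrow> f \<in> rep_poly_functions Q d \<Longrightarrow> f x \<noteq> 0 \<Longrightarrow> \<exists>y\<in>V1. f y \<noteq> 0"
    using generic_socleD[OF U(1) Rep_top_subset] by metis
  obtain V2 where V2: "V2 \<subseteq> Rep_top Q I d T2" "V2 \<noteq> {}"
    "\<And>x v. x \<in> V2 \<Longrightarrow> v \<in> verts Q \<Longrightarrow> vdim (d v) (arrow_kernel Q d x v) = fst U2 v"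
    using generic_socleD[OF U(2) Rep_top_subset] real by metis
  \<comment> \<open>Taken in \<open>V2\<close> so that the kernels at \<open>z\<close> have the
    generic dimensions; this same point is conjugated below.\<close>
  obtain z where z: "z \<in> V2" using V2(2) by blast
  have z2: "z \<in> Rep_top Q I d T2" using z V2(1) by blast
  have zR: "z \<in> Rep Q I d" using z2 Rep_top_subset by blast
  define k where "k = (\<lambda>v. vdim (d v) (arrow_image Q d z v))"
  have k: "k v + fst T2 v = d v" if "v \<in> verts Q" for v
    unfolding k_def by (rule Rep_top_imp_vdim[OF T(2) z2 that])
  fix x assume x: "x \<in> Rep_top Q I d T1"
  have xR: "x \<in> Rep Q I d" using x Rep_top_subset by blast
  have xa: "x \<in> rep_affine_space Q d" using xR Rep_affine by blast
  have ker_x: "fst U1 v \<le> vdim (d v) (arrow_kernel Q d x v)" if v: "v \<in> verts Q" for v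
  proof -
    obtain f where f: "f \<in> rep_poly_functions Q d" "f x \<noteq> 0" "\<And>y. y \<in> rep_affine_space Q d \<Longrightarrow> f y \<noteq> 0 \<Longrightarrow>
        vdim (d v) (arrow_row_space Q d x v) \<le> vdim (d v) (arrow_row_space Q d y v)"
      using vdim_arrow_row_space_semicontinuous[OF xa order_refl] by blast
    obtain y where y: "y \<in> V1" "f y \<noteq> 0" using V1(3)[OF x f(1,2)] by blast
    have ya: "y \<in> rep_affine_space Q d" using y(1) V1(1) Rep_top_subset Rep_affine by blast
    show ?thesis
      using f(3)[OF ya y(2)] vdim_arrow_kernel[OF finite_arcs xa, of v] vdim_arrow_kernel[OF finite_arcs ya, of v]
        V1(2)[OF y(1) v] by linarith
  qed
  have "\<exists>a b. dual_system (d v) (d v) a b \<and> arrow_image Q d x v \<subseteq> coord_subspace (d v) (k v) a \<and>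
      coord_subspace (d v) (k v) a \<subseteq> arrow_kernel Q d x v" if v: "v \<in> verts Q" for v
  proof -
    have le1: "vdim (d v) (arrow_image Q d x v) \<le> k v"
      using Rep_top_imp_vdim[OF T(1) x v] k[OF v] tops[OF v] by linarith
    have le2: "k v \<le> vdim (d v) (arrow_kernel Q d x v)"
      \<comment> \<open>The chain is dim W_v(z) \<le> dim N_v(z) = \<open>fst U2 v\<close> \<le>
        \<open>fst U1 v\<close> \<le> dim N_v(x). Here both the socle condition and the choice of
        \<open>z\<close> are used.\<close>
      using vdim_mono[OF arrow_image_subset_kernel[OF zR], where n = "d v" and v1 = v] V2(3)[OF z v]
        socles[OF v] ker_x[OF v] unfolding k_def by linarith
    obtain a b where "dual_system (d v) (d v) a b" "arrow_image Q d x v \<subseteq> coord_subspace (d v) (k v) a"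
        "coord_subspace (d v) (k v) a \<subseteq> arrow_kernel Q d x v"
      by (rule intermediate_subspace[OF vec_subspace_arrow_image[OF xa] vec_subspace_arrow_kernel[OF xa]
          arrow_image_subset_kernel[OF xR] le1 le2])
    then show ?thesis by (intro exI conjI)
  qed
  then obtain a b where ab: "\<And>v. v \<in> verts Q \<Longrightarrow> dual_system (d v) (d v) (a v) (b v)"
    "\<And>v. v \<in> verts Q \<Longrightarrow> arrow_image Q d x v \<subseteq> coord_subspace (d v) (k v) (a v)"
    "\<And>v. v \<in> verts Q \<Longrightarrow> coord_subspace (d v) (k v) (a v) \<subseteq> arrow_kernel Q d x v" by metis
  define W where "W = (\<lambda>v. coord_subspace (d v) (k v) (a v))"
  have ac: "a v i \<in> carrier_vec (d v)" if "v \<in> verts Q" "i < d v" for v i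
    using ab(1)[OF that(1)] that(2) by (simp add: dual_system_def)
  have W: "vec_subspace (d v) (W v)" if "v \<in> verts Q" for v
    unfolding W_def by (rule vec_subspace_coord) (rule ac[OF that])
  have zsq: "square_zero_rep Q d z" using zR Rep_iff by blast
  obtain y where y: "y \<in> rep_affine_space Q d"
    "\<And>e w. e \<in> arcs Q \<Longrightarrow> w \<in> W (tail Q e) \<Longrightarrow> y e *\<^sub>v w = 0\<^sub>v (d (head Q e))"
    "\<And>e w. e \<in> arcs Q \<Longrightarrow> w \<in> carrier_vec (d (tail Q e)) \<Longrightarrow> y e *\<^sub>v w \<in> W (head Q e)"
    "\<And>v. v \<in> verts Q \<Longrightarrow> k v \<le> vdim (d v) (arrow_image Q d y v)"
    using conjugate_arrow_images[OF wf_digraph_axioms finite_arcs zsq ab(1)] unfolding W_def k_def by blast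
  have x_ker: "x e *\<^sub>v w = 0\<^sub>v (d (head Q e))" if "e \<in> arcs Q" "w \<in> W (tail Q e)" for e w
    using ab(3)[OF tail_in_verts[OF that(1)]] that by (auto simp: W_def arrow_kernel_def)
  have x_im: "x e *\<^sub>v w \<in> W (head Q e)" if "e \<in> arcs Q" "w \<in> carrier_vec (d (tail Q e))" for e w
    using ab(2)[OF head_in_verts[OF that(1)]] mult_vec_in_arrow_image[OF finite_arcs xa that(1) refl that(2)]
    by (auto simp: W_def)
  have "\<exists>y\<in>Rep_top Q I d T2. f y \<noteq> 0" if f: "f \<in> rep_poly_functions Q d" "f x \<noteq> 0" for f
  proof -
    \<comment> \<open>For each vertex, a polynomial that is nonzero at \<open>y\<close> and whose
      nonvanishing guarantees an arrow image of dimension at least \<open>k v\<close>.\<close>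
    have "\<exists>g. g \<in> rep_poly_functions Q d \<and> g y \<noteq> 0 \<and>
        (\<forall>u. u \<in> rep_affine_space Q d \<longrightarrow> g u \<noteq> 0 \<longrightarrow> k v \<le> vdim (d v) (arrow_image Q d u v))" if "v \<in> verts Q" for v
      using vdim_arrow_image_semicontinuous[OF y(1) y(4)[OF that]] by metis
    then obtain g where g: "\<And>v. v \<in> verts Q \<Longrightarrow> g v \<in> rep_poly_functions Q d" "\<And>v. v \<in> verts Q \<Longrightarrow> g v y \<noteq> 0"
      "\<And>v u. v \<in> verts Q \<Longrightarrow> u \<in> rep_affine_space Q d \<Longrightarrow> g v u \<noteq> 0 \<Longrightarrow> k v \<le> vdim (d v) (arrow_image Q d u v)"
      by metis
    \<comment> \<open>\<open>f\<close> is nonzero at \<open>x\<close>, the others at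
      \<open>y\<close>. A common point of nonvanishing on the line is still in the neighbourhood of
      \<open>x\<close> given by \<open>f\<close> and has images as large as those of
      \<open>y\<close>.\<close>
    define F where "F = insert f (g ` verts Q)"
    have F: "finite F" "F \<subseteq> rep_poly_functions Q d" "\<And>h. h \<in> F \<Longrightarrow> h x \<noteq> 0 \<or> h y \<noteq> 0"
      using f g(1,2) finite_verts by (auto simp: F_def)
    obtain s where s: "\<And>h. h \<in> F \<Longrightarrow> h (\<lambda>e\<in>arcs Q. (1 - s) \<cdot>\<^sub>m x e + s \<cdot>\<^sub>m y e) \<noteq> 0"
      using exists_on_line_nonzero[OF F(1,2) xa y(1) F(3)] by blast
    define u where "u = (\<lambda>e\<in>arcs Q. (1 - s) \<cdot>\<^sub>m x e + s \<cdot>\<^sub>m y e)"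
    note xc = rep_affine_space_carrier[OF xa] and yc = rep_affine_space_carrier[OF y(1)]
    have u: "u \<in> rep_affine_space Q d"
      unfolding rep_affine_space_def u_def using xc yc by (auto intro!: add_carrier_mat smult_carrier_mat)
    have u_mult: "u e *\<^sub>v w = (1 - s) \<cdot>\<^sub>v (x e *\<^sub>v w) + s \<cdot>\<^sub>v (y e *\<^sub>v w)"
      if e: "e \<in> arcs Q" and w: "w \<in> carrier_vec (d (tail Q e))" for e w
      using e w xc[OF e] yc[OF e]
      by (intro eq_vecI) (auto simp: u_def add_scalar_prod_distrib[of _ "d (tail Q e)"] row_add)
    have u_ker: "u e *\<^sub>v w = 0\<^sub>v (d (head Q e))" if e: "e \<in> arcs Q" and w: "w \<in> W (tail Q e)" for e w
    proof -
      have "w \<in> carrier_vec (d (tail Q e))" using w by (simp add: W_def coord_subspace_def)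
      from u_mult[OF e this] show ?thesis unfolding x_ker[OF e w] y(2)[OF e w] by auto
    qed
    have u_im: "u e *\<^sub>v w \<in> W (head Q e)" if e: "e \<in> arcs Q" and w: "w \<in> carrier_vec (d (tail Q e))" for e w
      unfolding u_mult[OF e w]
      using W[OF head_in_verts[OF e]] x_im[OF e w] y(3)[OF e w] by (simp add: vec_subspace_def)
    have uR: "u \<in> Rep Q I d" unfolding Rep_iff by (rule square_zero_repI[where W = W, OF u u_ker u_im])
    have "u \<in> Rep_top Q I d T2"
    proof (rule Rep_top_if_vdim[OF T(2) uR])
      fix v assume v: "v \<in> verts Q"
      \<comment> \<open>The containment bounds the dimension above by \<open>k v\<close>, and
        \<open>g v\<close> bounds it below; equality is what places \<open>u\<close> in the second
        stratum.\<close>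
      have "arrow_image Q d u v \<subseteq> W v"
        unfolding W_def by (rule arrow_image_subset_coord[OF u ac[OF v]]) (use u_im in \<open>auto simp: W_def\<close>)
      moreover have "vdim (d v) (W v) = k v"
        unfolding W_def using k[OF v] by (intro vdim_coord_subspace[OF ab(1)[OF v]]) simp
      ultimately have "vdim (d v) (arrow_image Q d u v) \<le> k v" using vdim_mono by metis
      moreover have "k v \<le> vdim (d v) (arrow_image Q d u v)"
        using g(3)[OF v u] s[of "g v"] v by (simp add: F_def u_def)
      ultimately show "vdim (d v) (arrow_image Q d u v) + fst T2 v = d v" using k[OF v] by simp
    qed
    moreover have "f u \<noteq> 0" using s[of f] by (simp add: F_def u_def)
    ultimately show ?thesis by blast
  qed
  then show "x \<in> zariski_Rep Q I d closure_of Rep_top Q I d T2"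
    unfolding in_zariski_closure_iff[OF Rep_top_subset] using xR by blast
qed

theorem theorem3p6:
  fixes Q :: "('v, 'a) pre_digraph"
    and I :: "(('v, 'a) path \<Rightarrow> 'k :: alg_closed_field) set"
    and d :: "'v \<Rightarrow> nat"
    and T1 T2 U1 U2 :: "('v, 'a, 'k) fd_module"
  assumes "fin_digraph Q"
    and "admissible_ideal Q I"
    and "jacobson_radical_square_zero (bound_quiver_algebra Q I)"
    and "semisimple_fd_module Q I T1" and "semisimple_fd_module Q I T2"
    and "realizable Q I d T1" and "realizable Q I d T2"
    and "generic_socle Q I d (Rep_top Q I d T1) U1"
    and "generic_socle Q I d (Rep_top Q I d T2) U2"
  shows "Rep_top Q I d T1 \<subseteq> zariski_Rep Q I d closure_of (Rep_top Q I d T2) \<longleftrightarrow>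
    (\<forall>v\<in>verts Q. dim_vector T1 v \<ge> dim_vector T2 v) \<and>
    (\<forall>v\<in>verts Q. dim_vector U1 v \<ge> dim_vector U2 v)"
proof -
  have alg: "square_zero_quiver_algebra Q I"
    using assms(1-3) by (intro square_zero_quiver_algebra.intro square_zero_quiver_algebra_axioms.intro)
  have real: "Rep_top Q I d T1 \<noteq> {}" "Rep_top Q I d T2 \<noteq> {}"
    using assms(6,7) by (simp_all add: realizable_def)
  show ?thesis
    using square_zero_quiver_algebra.closure_imp_dim_vector_le[OF alg assms(4,5) real(1) assms(8,9)]
      dim_vector_le_imp_closure[OF alg assms(4,5) real(2) assms(8,9)]
    by blast
qed

end
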